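(* Let $d\ge2$, $1<p\le\infty$, and $b\in(0,1)$. For all $N>|\mathbb S^{d-1}|^{1/p}$ there exist constants $C_{d,N,p,b}>0$ and $0<\delta_{d,p,b}<1$ such that, for all $V_1,V_2\in\mathcal V_d$ satisfying $$\max_{j=1,2}\|V_j\|_{L^p(U_b)}\le N,\qquad \|V_1^{\mathrm B}-V_2^{\mathrm B}\|_{L^1(U_b)}<\delta_{d,p,b},$$ one has $$\|V_1-V_2\|_{L^1(U_b)}\le C_{d,N,p,b}\,\|V_1^{\mathrm B}-V_2^{\mathrm B}\|_{L^1(U_b)}^{\frac{p}{2p-1}}.$$ Here $V_j^{\mathrm B}$ is the Born approximation of $V_j$, $U_b=\{x\in\mathbb B^d:b<|x|<1\}$, and for $p=\infty$ one reads $|\mathbb S^{d-1}|^{1/p}=1$ and $\frac p{2p-1}=\frac12$. The constants depend only on the quantities indicated by their subscripts.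
   Context: $\mathbb B^d=\{x\in\mathbb R^d:|x|<1\}$, $\mathbb S^{d-1}=\partial\mathbb B^d$, $|\mathbb S^{d-1}|$ is its surface measure, $\mathbb N_0=\{0,1,2,\dots\}$. The space $\mathcal V_d$: real-valued radial $V\in L^1_{\mathrm{loc}}(\mathbb B^d\setminus\{0\})$, $V=q(|\cdot|)$, with $$\|V\|_{\mathcal V_d}:=\sup_{j\in\mathbb N_0}\int_{2^{-(j+1)}<|x|<2^{-j}}|V(x)||x|^{2-d}dx<\infty .$$ Constants: $\beta_V:=\frac{2}{|\mathbb S^{d-1}|}\max\big(\sqrt{6|\mathbb S^{d-1}|\,\|V\|_{\mathcal V_d}},3e\|V\|_{\mathcal V_d}\big)$, $k_V:=\beta_V-\frac{d-2}{2}$. For an integer $k\ge0$, $k>k_V$, there is a unique solution $b_k$ on $(0,1]$ of $$-\frac1{r^{d-1}}\frac{d}{dr}\Big(r^{d-1}\frac{d b_k}{dr}\Big)+\Big(\frac{k(k+d-2)}{r^2}+q(r)\Big)b_k=0,\qquad b_k(1)=1,$$ such that $b_k(|x|)Y_k(x/|x|)\in L^2(\mathbb B^d,|x|^{-2}dx)$ for all spherical harmonics $Y_k$ of degree $k$; set $\lambda_k[V]:=\partial_rb_k(1)$ (when the Dirichlet-to-Neumann map of $-\Delta+V$ on $\mathbb B^d$ is well defined, this is its eigenvalue on spherical harmonics of degree $k$). Born approximation: $V^{\mathrm B}$ is the unique radial function that belongs to $L^1(\mathbb B^d,|x|^{2s}dx)$ for some $s>0$ and satisfies $$\frac1{|\mathbb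 S^{d-1}|}\int_{\mathbb B^d}V^{\mathrm B}(x)|x|^{2k}dx=\lambda_k[V]-k\qquad\text{for all sufficiently large integers }k$$ (it exists for every $V\in\mathcal V_d$). *)

theory Defs
  imports "HOL-Probability.Essential_Supremum"
begin

(* Surface measure of the unit sphere of a d-dimensional Euclidean space, from
   d/dR (unit_ball_vol d * R^d) at R = 1; it equals 2 * pi powr (d/2) / Gamma (d/2). *)
definition sphere_area :: "nat \<Rightarrow> real" where
  "sphere_area d = real d * unit_ball_vol (real d)"

definition Lp_norm :: "ennreal \<Rightarrow> 'a::euclidean_space set \<Rightarrow> ('a \<Rightarrow> real) \<Rightarrow> ennreal" where
  "Lp_norm p A f =
    (if p = \<infinity> then esssup (lebesgue_on A) (\<lambda>x. ennreal \<bar>f x\<bar>)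
     else let I = (\<integral>\<^sup>+x. ennreal (\<bar>f x\<bar> powr enn2real p) \<partial>lebesgue_on A)
          in if I = \<infinity> then \<infinity> else ennreal (enn2real I powr (1 / enn2real p)))"

definition shell :: "real \<Rightarrow> real \<Rightarrow> 'a::euclidean_space set" where
  "shell a c = {x. a < norm x \<and> norm x < c}"

(* Functions are total on 'a; only their values on ball 0 1 - {0} are ever used.  Equivalence
   classes modulo null sets are represented by genuinely radial functions. *)
definition radial :: "('a::euclidean_space \<Rightarrow> real) \<Rightarrow> bool" where
  "radial V \<longleftrightarrow> (\<exists>q. \<forall>x\<in>ball 0 1 - {0}. V x = q (norm x))"

(* For radial V and 0 < r < 1 this is the q r with V x = q (norm x); other r are irrelevant. *)
definition profile :: "('a::euclidean_space \<Rightarrow> real) \<Rightarrow> real \<Rightarrow> real" where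
  "profile V r = (THE c. \<forall>x\<in>sphere 0 r. V x = c)"

definition V_norm :: "('a::euclidean_space \<Rightarrow> real) \<Rightarrow> ennreal" where
  "V_norm V =
    (SUP j::nat. \<integral>\<^sup>+x. ennreal (\<bar>V x\<bar> * norm x powi (2 - int DIM('a)))
                   \<partial>lebesgue_on (shell (1 / 2 ^ (j + 1)) (1 / 2 ^ j)))"

definition V_space :: "('a::euclidean_space \<Rightarrow> real) set" where
  "V_space = {V. radial V
      \<and> (\<forall>K. compact K \<and> K \<subseteq> ball 0 1 - {0} \<longrightarrow> V absolutely_integrable_on K)
      \<and> V_norm V < \<infinity>}"

definition laplacian :: "('a::euclidean_space \<Rightarrow> real) \<Rightarrow> 'a \<Rightarrow> real" where
  "laplacian P x = (\<Sum>i\<in>Basis. (deriv ^^ 2) (\<lambda>t. P (x + t *\<^sub>R i)) 0)"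

definition spherical_harmonic :: "nat \<Rightarrow> ('a::euclidean_space \<Rightarrow> real) \<Rightarrow> bool" where
  "spherical_harmonic k Y \<longleftrightarrow>
    (\<exists>P. real_polynomial_function P \<and> (\<forall>c x. P (c *\<^sub>R x) = c ^ k * P x)
       \<and> (\<forall>x. laplacian P x = 0) \<and> (\<forall>x\<in>sphere 0 1. Y x = P x))"

(* Since q is merely locally integrable on (0,1], the radial equation is read in the Caratheodory
   sense: u is C^1 with derivative v, and r^(d-1) v is locally absolutely continuous on (0,1] with
   (r^(d-1) v)' = r^(d-1) (k(k+d-2)/r^2 + q) u almost everywhere, written in integral form. *)
definition radial_solution ::
    "nat \<Rightarrow> nat \<Rightarrow> (real \<Rightarrow> real) \<Rightarrow> (real \<Rightarrow> real) \<Rightarrow> (real \<Rightarrow> real) \<Rightarrow> bool" where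
  "radial_solution d k q u v \<longleftrightarrow>
    (let g = (\<lambda>s. s ^ (d - 1) * (real k * (real k + real d - 2) / s\<^sup>2 + q s) * u s)
     in \<forall>r\<in>{0<..1}. (u has_real_derivative v r) (at r within {0<..1})
          \<and> g absolutely_integrable_on {r..1}
          \<and> v 1 - r ^ (d - 1) * v r = integral {r..1} g)"

definition regular_solution ::
    "('a::euclidean_space \<Rightarrow> real) \<Rightarrow> nat \<Rightarrow> (real \<Rightarrow> real) \<Rightarrow> (real \<Rightarrow> real) \<Rightarrow> bool" where
  "regular_solution V k u v \<longleftrightarrow>
    radial_solution DIM('a) k (profile V) u v \<and> u 1 = 1
    \<and> (\<forall>Y :: 'a \<Rightarrow> real. spherical_harmonic k Y \<longrightarrow>
         (\<lambda>x. (u (norm x) * Y (x /\<^sub>R norm x))\<^sup>2 * norm x powi (-2))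
           absolutely_integrable_on ball 0 1)"

(* Only meaningful when the regular solution exists and is unique on (0,1],
   which is the case for all sufficiently large k if V is in V_space. *)
definition DN_eigenvalue :: "('a::euclidean_space \<Rightarrow> real) \<Rightarrow> nat \<Rightarrow> real" where
  "DN_eigenvalue V k = (THE l. \<exists>u v. regular_solution V k u v \<and> l = v 1)"

(* A relation, because the Born approximation is determined only up to null sets. *)
definition is_Born_approximation ::
    "('a::euclidean_space \<Rightarrow> real) \<Rightarrow> ('a \<Rightarrow> real) \<Rightarrow> bool" where
  "is_Born_approximation V W \<longleftrightarrow>
    radial W
    \<and> (\<exists>s>0. (\<lambda>x. W x * norm x powr (2 * s)) absolutely_integrable_on ball 0 1)
    \<and> (\<forall>\<^sub>F k in sequentially.
         1 / sphere_area DIM('a) * (LINT x:ball 0 1|lebesgue. W x * norm x ^ (2 * k))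
           = DN_eigenvalue V k - real k)"

end

theory Submission
  imports Defs
begin

text \<open>In the variable t = - ln r the radial equation of degree k becomes the half-line Schroedinger
equation \<phi>'' = (\<kappa>^2 + Q) \<phi> with \<kappa> = k + (d - 2) / 2 and Q(t) = e^(-2t) q(e^(-t)). The regular solution
becomes the decaying solution normalised by \<phi>(0) = 1, and the shell b < |x| < 1 becomes the interval
0 < t < - ln b.

Read \<kappa> as dual to a time s. The decaying solution is then the Laplace transform in s of the wave
delta(s - t) + K(t, s) that a pulse at the end point t = 0 sends into the half-line. Duhamel's formula is
a Volterra equation for K, so K exists (\<open>wave_kernel_exists\<close>), and since waves have speed one,
K(t, s) depends on Q only through its values on [0, (t + s) / 2]. In this picture the Dirichlet-to-Neumann
eigenvalues are Laplace transforms (\<open>DN_eigenvalue_response\<close>):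

  \<lambda>_k - k = \<integral> A(\<sigma>) e^(-2 \<kappa> \<sigma>) d\<sigma>,   A(\<sigma>) = Q(\<sigma>) + 2 \<integral> Q(x) K(x, 2 \<sigma> - x) dx.

The Born approximation has, in logarithmic variables, the same Laplace transform at the points
\<kappa> = k + (d - 2) / 2 for all large k, and the values along an arithmetic progression determine a
function (\<open>laplace_moments_unique\<close>). So A is the Born approximation written in the
variable t, up to the factor e^(-2t) (\<open>born_profile_eq_response\<close>).

The theorem is now a statement about the map from Q to A on a finite interval. The identity for A shows that
A1 - A2 = Q1 - Q2 plus a Volterra operator applied to |Q1 - Q2|, with a kernel bounded in terms of
the L^1 norms of Q1 and Q2 on that interval: this uses the local bound for K (\<open>K_local\<close>) and
its local Lipschitz dependence on Q (\<open>two_kernel_difference\<close>). Gronwall's inequality gives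
\<open>halfline_stability\<close>, a Lipschitz estimate of the potentials by their Born approximations in
L^1 of the shell. When the distance of the Born approximations is below 1, raising it to an exponent in
(0, 1] does not decrease it, so the Lipschitz estimate implies the Hoelder estimate.\<close>

section \<open>The wave kernel of a potential on the half-line\<close>

lemma nn_integral_exp_atMost:
  assumes "c > (0::real)"
  shows "(\<integral>\<^sup>+y. ennreal (exp (c * y)) * indicator {..z} y \<partial>lborel) = ennreal (exp (c * z) / c)"
proof -
  have "(\<integral>\<^sup>+y. ennreal (exp (c * y)) * indicator {..z} y \<partial>lborel)
      = (\<integral>\<^sup>+y. ennreal (exp (- c * y)) * indicator {-z..} y \<partial>lborel)"
    by (subst nn_integral_real_affine[where c="-1" and t=0])
       (auto intro!: nn_integral_cong simp: indicator_def)
  also have "\<dots> = ennreal (0 - (- exp (- c * (-z)) / c))"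
  proof (rule nn_integral_FTC_atLeast)
    show "((\<lambda>y. - exp (- c * y) / c) has_real_derivative exp (- c * x)) (at x)" for x
      using assms by (auto intro!: derivative_eq_intros)
    have "filterlim (\<lambda>y. - c * y) at_bot at_top"
      using assms by (intro filterlim_tendsto_neg_mult_at_bot[OF tendsto_const _ filterlim_ident]) auto
    then have "((\<lambda>y. exp (- c * y)) \<longlongrightarrow> 0) at_top"
      by (rule filterlim_compose[OF exp_at_bot])
    then have "((\<lambda>y. - exp (- c * y) / c) \<longlongrightarrow> - 0 / c) at_top"
      by (intro tendsto_intros) (use assms in auto)
    then show "((\<lambda>y. - exp (- c * y) / c) \<longlongrightarrow> 0) at_top" by simp
  qed auto
  finally show ?thesis by simp
qed

lemma nn_integral_exp_atLeast:
  assumes "c > (0::real)"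
  shows "(\<integral>\<^sup>+y. ennreal (exp (- c * y)) * indicator {z..} y \<partial>lborel) = ennreal (exp (- c * z) / c)"
proof -
  have "(\<integral>\<^sup>+y. ennreal (exp (- c * y)) * indicator {z..} y \<partial>lborel)
     = (\<integral>\<^sup>+y. ennreal (exp (c * y)) * indicator {..-z} y \<partial>lborel)"
    by (subst nn_integral_real_affine[where c="-1" and t=0])
       (auto intro!: nn_integral_cong simp: indicator_def)
  then show ?thesis using nn_integral_exp_atMost[OF assms, of "-z"] by simp
qed

text \<open>The fundamental solution of the wave equation on the half-line with Dirichlet condition at 0:
d'Alembert's solution, 1/2 on |t - x| \<le> \<tau>, minus its odd reflection, 1/2 on t + x \<le> \<tau>.\<close>

definition dwave :: "real \<Rightarrow> real \<Rightarrow> real \<Rightarrow> real" where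
  "dwave t x \<tau> = (if \<bar>t - x\<bar> \<le> \<tau> \<and> \<tau> \<le> t + x then 1/2 else 0)"

lemma dwave_measurable [measurable]:
  assumes [measurable]: "f \<in> borel_measurable M" "g \<in> borel_measurable M" "h \<in> borel_measurable M"
  shows "(\<lambda>z. dwave (f z) (g z) (h z)) \<in> borel_measurable M"
  unfolding dwave_def by measurable

lemma dwave_nonneg [simp]: "0 \<le> dwave t x \<tau>"
  by (simp add: dwave_def)

lemma dwave_le_half: "dwave t x \<tau> \<le> 1/2"
  by (simp add: dwave_def)

lemma dwave_nonzeroD:
  "dwave t x \<tau> \<noteq> 0 \<Longrightarrow> \<bar>t - x\<bar> \<le> \<tau> \<and> \<tau> \<le> t + x"
  by (auto simp: dwave_def split: if_splits)

text \<open>A signal needs the time |t - x| to travel from x to t, which is where the factor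
e^(-c |t - x|) comes from.\<close>

lemma nn_integral_dwave_source_time:
  assumes "c > 0"
  shows "(\<integral>\<^sup>+y. ennreal (exp (c * y) * dwave t x (s - y)) \<partial>lborel)
      \<le> ennreal (exp (c * (s - \<bar>t - x\<bar>)) / (2 * c))"
proof -
  have "(\<integral>\<^sup>+y. ennreal (exp (c * y) * dwave t x (s - y)) \<partial>lborel)
     \<le> (\<integral>\<^sup>+y. ennreal (1/2) * (ennreal (exp (c * y)) * indicator {..s - \<bar>t - x\<bar>} y) \<partial>lborel)"
    by (intro nn_integral_mono)
       (auto simp: dwave_def indicator_def ennreal_mult'[symmetric] simp del: ennreal_half)
  also have "\<dots> = ennreal (1/2) * ennreal (exp (c * (s - \<bar>t - x\<bar>)) / c)"
    using nn_integral_exp_atMost[OF assms] by (subst nn_integral_cmult) auto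
  also have "\<dots> = ennreal (exp (c * (s - \<bar>t - x\<bar>)) / (2 * c))"
    using assms by (subst ennreal_mult'[symmetric]) auto
  finally show ?thesis .
qed

text \<open>Green's function of \<kappa>^2 - d^2/dt^2 on the half-line with Dirichlet condition, in other
words sinh(\<kappa> min(t, x)) e^(-\<kappa> max(t, x)) / \<kappa>.\<close>

definition dgreen :: "real \<Rightarrow> real \<Rightarrow> real \<Rightarrow> real" where
  "dgreen \<kappa> t x = (exp (- \<kappa> * \<bar>t - x\<bar>) - exp (- \<kappa> * (t + x))) / (2 * \<kappa>)"

text \<open>The Laplace transform in time of the wave propagator is Green's function of the
stationary equation; every identity for decaying solutions below is the transform of an identity for waves.\<close>

lemma has_integral_dwave_laplace:
  assumes "\<kappa> > 0" "0 \<le> t" "0 \<le> x"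
  shows "has_bochner_integral lborel (\<lambda>s. exp (- \<kappa> * s) * dwave t x (s - y))
           (exp (- \<kappa> * y) * dgreen \<kappa> t x)"
proof -
  have le: "\<bar>t - x\<bar> + y \<le> t + x + y" using assms by simp
  have "has_bochner_integral lborel
      (\<lambda>s. (exp (- \<kappa> * s) / 2) * indicator {\<bar>t - x\<bar> + y .. t + x + y} s)
      (- exp (- \<kappa> * (t + x + y)) / (2 * \<kappa>) - (- exp (- \<kappa> * (\<bar>t - x\<bar> + y)) / (2 * \<kappa>)))"
    using assms
    by (intro has_bochner_integral_FTC_Icc_real[OF le, where F="\<lambda>s. - exp (- \<kappa> * s) / (2 * \<kappa>)"])
       (auto intro!: derivative_eq_intros continuous_intros)
  also have "(\<lambda>s. (exp (- \<kappa> * s) / 2) * indicator {\<bar>t - x\<bar> + y .. t + x + y} s)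
     = (\<lambda>s. exp (- \<kappa> * s) * dwave t x (s - y))"
    by (auto simp: fun_eq_iff dwave_def indicator_def)
  also have "- exp (- \<kappa> * (t + x + y)) / (2 * \<kappa>) - (- exp (- \<kappa> * (\<bar>t - x\<bar> + y)) / (2 * \<kappa>))
     = exp (- \<kappa> * y) * dgreen \<kappa> t x"
    using assms by (simp add: dgreen_def exp_add[symmetric] ring_distribs diff_divide_distrib)
  finally show ?thesis .
qed

text \<open>Potentials on the half-line, extended by 0, whose L^1 norms on windows of unit length are
uniformly bounded. The exponential weight expresses this in the form in which the bound is used.\<close>

definition unif_loc :: "(real \<Rightarrow> real) \<Rightarrow> real \<Rightarrow> bool" where
  "unif_loc Q B \<longleftrightarrow> Q \<in> borel_measurable borel \<and> (\<forall>x<0. Q x = 0) \<and> 0 \<le> B \<and>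
     (\<forall>t. (\<integral>\<^sup>+x. ennreal (\<bar>Q x\<bar> * exp (- \<bar>t - x\<bar>)) \<partial>lborel) \<le> ennreal B)"

text \<open>Write the solution of U_ss = U_tt - Q U with boundary values U(0, s) = delta(s) as
delta(s - t) + K(t, s). In Duhamel's formula for K this is the contribution of the pulse
delta(s - t); \<open>wave_step\<close> is the contribution of a function H in place of K.\<close>

definition wave0 :: "(real \<Rightarrow> real) \<Rightarrow> real \<Rightarrow> real \<Rightarrow> real" where
  "wave0 Q t s = - (\<integral>x. Q x * dwave t x (s - x) \<partial>lborel)"

definition wave_step :: "(real \<Rightarrow> real) \<Rightarrow> (real \<Rightarrow> real \<Rightarrow> real) \<Rightarrow> real \<Rightarrow> real \<Rightarrow> real" where
  "wave_step Q H t s =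
     - (\<integral>w. Q (fst w) * H (fst w) (snd w) * dwave t (fst w) (s - snd w) \<partial>lborel)"

lemma nn_integral_lborel_pair:
  assumes [measurable]: "f \<in> borel_measurable borel"
  shows "(\<integral>\<^sup>+w. f w \<partial>(lborel :: (real \<times> real) measure))
       = (\<integral>\<^sup>+x. \<integral>\<^sup>+y. f (x, y) \<partial>lborel \<partial>lborel)"
proof -
  have "f \<in> borel_measurable (lborel \<Otimes>\<^sub>M lborel)" by (simp add: lborel_prod)
  from lborel.nn_integral_fst[OF this] show ?thesis by (simp add: lborel_prod)
qed

lemma integral_abs_le_nn_bound:
  fixes f :: "'a \<Rightarrow> real"
  assumes "f \<in> borel_measurable M" "(\<integral>\<^sup>+x. ennreal \<bar>f x\<bar> \<partial>M) \<le> ennreal c" "0 \<le> c"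
  shows "integrable M f" "\<bar>integral\<^sup>L M f\<bar> \<le> c" "(\<integral>x. \<bar>f x\<bar> \<partial>M) \<le> c"
proof -
  show i: "integrable M f"
    using assms by (intro integrableI_bounded) (auto intro: le_less_trans)
  have e: "ennreal (\<integral>x. \<bar>f x\<bar> \<partial>M) = (\<integral>\<^sup>+x. ennreal \<bar>f x\<bar> \<partial>M)"
    using i by (intro nn_integral_eq_integral[symmetric]) auto
  then show j: "(\<integral>x. \<bar>f x\<bar> \<partial>M) \<le> c"
    using assms by (metis ennreal_le_iff)
  have "\<bar>integral\<^sup>L M f\<bar> \<le> (\<integral>x. \<bar>f x\<bar> \<partial>M)" by simp
  with j show "\<bar>integral\<^sup>L M f\<bar> \<le> c" by linarith
qed

abbreviation borel2 :: "(real \<Rightarrow> real \<Rightarrow> real) \<Rightarrow> bool" where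
  "borel2 H \<equiv> (\<lambda>z. H (fst z) (snd z)) \<in> borel_measurable borel"

lemma fst_snd_borel_measurable [measurable]:
  "fst \<in> measurable (borel :: (real \<times> real) measure) borel"
  "snd \<in> measurable (borel :: (real \<times> real) measure) borel"
  by (simp_all add: borel_prod[symmetric])

lemma measurable_curried:
  fixes H :: "real \<Rightarrow> real \<Rightarrow> real"
  assumes "borel2 H"
    and [measurable]: "f \<in> borel_measurable M" "g \<in> borel_measurable M"
  shows "(\<lambda>z. H (f z) (g z)) \<in> borel_measurable M"
proof -
  have "(\<lambda>z. (f z, g z)) \<in> measurable M borel" by measurable
  from measurable_compose[OF this assms(1)] show ?thesis by simp
qed

lemma wave_measurable:
  assumes [measurable]: "Q \<in> borel_measurable borel"
  shows "(\<lambda>z. wave0 Q (fst z) (snd z)) \<in> borel_measurable borel"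
  and "borel2 H \<Longrightarrow>
     (\<lambda>z. wave_step Q H (fst z) (snd z)) \<in> borel_measurable borel"
proof -
  show "(\<lambda>z. wave0 Q (fst z) (snd z)) \<in> borel_measurable borel"
    unfolding wave0_def by measurable
  assume H: "borel2 H"
  note [measurable] = measurable_curried[OF H]
  show "(\<lambda>z. wave_step Q H (fst z) (snd z)) \<in> borel_measurable borel"
    unfolding wave_step_def by measurable
qed

text \<open>Duhamel's operator with the weight e^(c s) has norm at most 1 / (2 c) times the integral of the potential
against e^(-c |t - x|), so it is a contraction for large c. The majorant R is either |Q| or |Q| cut off to
an interval.\<close>

lemma nn_integral_wave_step:
  assumes Qm [measurable]: "Q \<in> borel_measurable borel" and Rm [measurable]: "R \<in> borel_measurable borel"
    and H: "borel2 H"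
    and R: "\<And>x. 0 \<le> R x" and c: "0 < c" and m: "0 \<le> m"
    and bd: "\<And>x y. dwave t x (s - y) \<noteq> 0 \<Longrightarrow> \<bar>Q x * H x y\<bar> \<le> m * R x * exp (c * y)"
  shows "(\<integral>\<^sup>+w. ennreal \<bar>Q (fst w) * H (fst w) (snd w) * dwave t (fst w) (s - snd w)\<bar> \<partial>lborel)
     \<le> ennreal (m * exp (c * s) / (2 * c)) * (\<integral>\<^sup>+x. ennreal (R x * exp (- (c * \<bar>t - x\<bar>))) \<partial>lborel)"
proof -
  note [measurable] = measurable_curried[OF H]
  have "(\<integral>\<^sup>+w. ennreal \<bar>Q (fst w) * H (fst w) (snd w) * dwave t (fst w) (s - snd w)\<bar> \<partial>lborel)
     = (\<integral>\<^sup>+x. \<integral>\<^sup>+y. ennreal \<bar>Q x * H x y * dwave t x (s - y)\<bar> \<partial>lborel \<partial>lborel)"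
    by (subst nn_integral_lborel_pair) auto
  also have "\<dots> \<le> (\<integral>\<^sup>+x. ennreal (m * exp (c * s) / (2 * c)) * ennreal (R x * exp (- (c * \<bar>t - x\<bar>))) \<partial>lborel)"
  proof (intro nn_integral_mono)
    fix x :: real
    have "(\<integral>\<^sup>+y. ennreal \<bar>Q x * H x y * dwave t x (s - y)\<bar> \<partial>lborel)
       \<le> (\<integral>\<^sup>+y. ennreal (m * R x) * ennreal (exp (c * y) * dwave t x (s - y)) \<partial>lborel)"
    proof (intro nn_integral_mono)
      fix y :: real
      have "\<bar>Q x * H x y\<bar> * dwave t x (s - y) \<le> m * R x * exp (c * y) * dwave t x (s - y)"
        using bd[of x y] by (cases "dwave t x (s - y) = 0") (auto intro!: mult_right_mono)
      then show "ennreal \<bar>Q x * H x y * dwave t x (s - y)\<bar>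
          \<le> ennreal (m * R x) * ennreal (exp (c * y) * dwave t x (s - y))"
        using m R by (simp add: ennreal_mult'[symmetric] abs_mult mult_ac)
    qed
    also have "\<dots> \<le> ennreal (m * R x) * ennreal (exp (c * (s - \<bar>t - x\<bar>)) / (2 * c))"
      using c by (subst nn_integral_cmult) (auto intro!: mult_left_mono nn_integral_dwave_source_time)
    also have "\<dots> = ennreal (m * exp (c * s) / (2 * c)) * ennreal (R x * exp (- (c * \<bar>t - x\<bar>)))"
    proof -
      have "exp (c * (s - \<bar>t - x\<bar>)) = exp (c * s) * exp (- (c * \<bar>t - x\<bar>))"
        by (simp add: exp_add[symmetric] ring_distribs)
      then have "m * R x * (exp (c * (s - \<bar>t - x\<bar>)) / (2 * c))
          = m * exp (c * s) / (2 * c) * (R x * exp (- (c * \<bar>t - x\<bar>)))" by simp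
      then show ?thesis using m c R by (simp only: ennreal_mult[symmetric] mult_nonneg_nonneg
            divide_nonneg_pos exp_ge_zero mult_pos_pos zero_less_numeral)
    qed
    finally show "(\<integral>\<^sup>+y. ennreal \<bar>Q x * H x y * dwave t x (s - y)\<bar> \<partial>lborel)
       \<le> ennreal (m * exp (c * s) / (2 * c)) * ennreal (R x * exp (- (c * \<bar>t - x\<bar>)))" .
  qed
  also have "\<dots> = ennreal (m * exp (c * s) / (2 * c)) * (\<integral>\<^sup>+x. ennreal (R x * exp (- (c * \<bar>t - x\<bar>))) \<partial>lborel)"
    by (rule nn_integral_cmult) measurable
  finally show ?thesis .
qed

lemma wave_step_integrable:
  assumes Q: "unif_loc Q B" and c: "1 \<le> c" and m: "0 \<le> m"
    and H: "borel2 H"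
    and bd: "\<And>x y. \<bar>H x y\<bar> \<le> m * exp (c * y)"
  shows "integrable lborel (\<lambda>w. Q (fst w) * H (fst w) (snd w) * dwave t (fst w) (s - snd w))"
    and "\<bar>wave_step Q H t s\<bar> \<le> m * B / (2 * c) * exp (c * s)"
    and "(\<integral>w. \<bar>Q (fst w) * H (fst w) (snd w) * dwave t (fst w) (s - snd w)\<bar> \<partial>lborel)
           \<le> m * B / (2 * c) * exp (c * s)"
proof -
  have Qm[measurable]: "Q \<in> borel_measurable borel" and B: "0 \<le> B"
    using Q by (simp_all add: unif_loc_def)
  note [measurable] = measurable_curried[OF H]
  have *: "(\<lambda>w. Q (fst w) * H (fst w) (snd w) * dwave t (fst w) (s - snd w)) \<in> borel_measurable lborel"
    by measurable
  have nn: "0 \<le> m * B / (2 * c) * exp (c * s)" using B m c by simp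
  have dom: "\<bar>Q x * H x y\<bar> \<le> m * \<bar>Q x\<bar> * exp (c * y)" for x y
    using mult_left_mono[OF bd[of x y], of "\<bar>Q x\<bar>"] by (simp add: abs_mult mult_ac)
  have "(\<integral>\<^sup>+w. ennreal \<bar>Q (fst w) * H (fst w) (snd w) * dwave t (fst w) (s - snd w)\<bar> \<partial>lborel)
     \<le> ennreal (m * exp (c * s) / (2 * c)) * (\<integral>\<^sup>+x. ennreal (\<bar>Q x\<bar> * exp (- (c * \<bar>t - x\<bar>))) \<partial>lborel)"
    by (rule nn_integral_wave_step[OF Qm _ H _ _ m dom]) (use c in auto)
  also have "\<dots> \<le> ennreal (m * exp (c * s) / (2 * c)) * (\<integral>\<^sup>+x. ennreal (\<bar>Q x\<bar> * exp (- \<bar>t - x\<bar>)) \<partial>lborel)"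
  proof (intro mult_left_mono nn_integral_mono ennreal_leI)
    fix x
    have "\<bar>t - x\<bar> \<le> c * \<bar>t - x\<bar>" using mult_right_mono[OF c, of "\<bar>t - x\<bar>"] by simp
    then show "exp (- (c * \<bar>t - x\<bar>)) \<le> exp (- \<bar>t - x\<bar>)" by simp
  qed auto
  also have "\<dots> \<le> ennreal (m * exp (c * s) / (2 * c)) * ennreal B"
    using Q unfolding unif_loc_def by (intro mult_left_mono) auto
  also have "\<dots> = ennreal (m * B / (2 * c) * exp (c * s))"
    using B m c by (simp add: ennreal_mult'[symmetric] mult_ac)
  finally have "(\<integral>\<^sup>+w. ennreal \<bar>Q (fst w) * H (fst w) (snd w) * dwave t (fst w) (s - snd w)\<bar> \<partial>lborel)
     \<le> ennreal (m * B / (2 * c) * exp (c * s))" .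
  note bds = integral_abs_le_nn_bound[OF * this nn]
  show "integrable lborel (\<lambda>w. Q (fst w) * H (fst w) (snd w) * dwave t (fst w) (s - snd w))"
    by (rule bds)
  show "(\<integral>w. \<bar>Q (fst w) * H (fst w) (snd w) * dwave t (fst w) (s - snd w)\<bar> \<partial>lborel)
           \<le> m * B / (2 * c) * exp (c * s)" by (rule bds)
  show "\<bar>wave_step Q H t s\<bar> \<le> m * B / (2 * c) * exp (c * s)"
    using bds(2) by (simp add: wave_step_def)
qed

text \<open>The sources that contribute at (t, s) lie in [0, s], where e^(-x) is at least e^(-s).\<close>

lemma wave0_bound:
  assumes Q: "unif_loc Q B" and c: "1 \<le> c"
  shows "\<bar>wave0 Q t s\<bar> \<le> B / 2 * exp (c * s)"
    and "integrable lborel (\<lambda>x. Q x * dwave t x (s - x))"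
proof -
  have Qm[measurable]: "Q \<in> borel_measurable borel" and B: "0 \<le> B" and Q0: "\<And>x. x < 0 \<Longrightarrow> Q x = 0"
    and QB: "(\<integral>\<^sup>+x. ennreal (\<bar>Q x\<bar> * exp (- \<bar>0 - x\<bar>)) \<partial>lborel) \<le> ennreal B"
    using Q unfolding unif_loc_def by blast+
  have "(\<integral>\<^sup>+x. ennreal \<bar>Q x * dwave t x (s - x)\<bar> \<partial>lborel)
     \<le> (\<integral>\<^sup>+x. ennreal (exp (c * s) / 2) * ennreal (\<bar>Q x\<bar> * exp (- \<bar>0 - x\<bar>)) \<partial>lborel)"
  proof (intro nn_integral_mono)
    fix x :: real
    show "ennreal \<bar>Q x * dwave t x (s - x)\<bar>
        \<le> ennreal (exp (c * s) / 2) * ennreal (\<bar>Q x\<bar> * exp (- \<bar>0 - x\<bar>))"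
    proof (cases "0 \<le> x \<and> dwave t x (s - x) \<noteq> 0")
      case True
      then have "\<bar>t - x\<bar> \<le> s - x" by (auto dest: dwave_nonzeroD)
      with True have s: "x \<le> s" "0 \<le> s" by auto
      have "s \<le> c * s" using mult_right_mono[OF c s(2)] by simp
      with s True have "1 \<le> exp (c * s) * exp (- \<bar>0 - x\<bar>)"
        by (auto simp: exp_add[symmetric])
      then have "\<bar>Q x\<bar> * (1/2) \<le> \<bar>Q x\<bar> * (exp (c * s) * exp (- \<bar>0 - x\<bar>) / 2)"
        by (intro mult_left_mono) auto
      moreover have "dwave t x (s - x) = 1/2" using True by (auto simp: dwave_def split: if_splits)
      ultimately show ?thesis
        by (simp add: abs_mult ennreal_mult'[symmetric] mult_ac)
    next
      case False
      then have "Q x * dwave t x (s - x) = 0" using Q0[of x] by auto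
      then show ?thesis by (simp only: abs_zero ennreal_0 zero_le)
    qed
  qed
  also have "\<dots> \<le> ennreal (exp (c * s) / 2) * ennreal B"
    using QB by (subst nn_integral_cmult) (auto intro!: mult_left_mono)
  also have "\<dots> = ennreal (B / 2 * exp (c * s))"
    using B by (simp add: ennreal_mult'[symmetric] mult_ac)
  finally have *: "(\<integral>\<^sup>+x. ennreal \<bar>Q x * dwave t x (s - x)\<bar> \<partial>lborel) \<le> ennreal (B / 2 * exp (c * s))" .
  have nn: "0 \<le> B / 2 * exp (c * s)" using B by simp
  note bds = integral_abs_le_nn_bound[OF _ * nn]
  show "\<bar>wave0 Q t s\<bar> \<le> B / 2 * exp (c * s)" using bds(2) by (simp add: wave0_def)
  show "integrable lborel (\<lambda>x. Q x * dwave t x (s - x))" by (rule bds(1)) measurable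
qed

definition wave_kernel :: "(real \<Rightarrow> real) \<Rightarrow> (real \<Rightarrow> real \<Rightarrow> real) \<Rightarrow> bool" where
  "wave_kernel Q K \<longleftrightarrow>
     borel2 K \<and>
     (\<forall>t s. K t s \<noteq> 0 \<longrightarrow> 0 \<le> t \<and> t \<le> s) \<and>
     (\<forall>t s. K t s = wave0 Q t s + wave_step Q K t s)"

lemma wave_support:
  assumes "\<And>x. x < 0 \<Longrightarrow> Q x = 0"
  shows "wave0 Q t s \<noteq> 0 \<Longrightarrow> 0 \<le> t \<and> t \<le> s"
    and "(\<And>x y. H x y \<noteq> 0 \<Longrightarrow> 0 \<le> x \<and> x \<le> y) \<Longrightarrow> wave_step Q H t s \<noteq> 0 \<Longrightarrow> 0 \<le> t \<and> t \<le> s"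
proof -
  assume "wave0 Q t s \<noteq> 0"
  then have "(\<lambda>x. Q x * dwave t x (s - x)) \<noteq> (\<lambda>x. 0)"
    unfolding wave0_def by (intro notI) (simp only: integral_zero)
  then obtain x where "Q x \<noteq> 0" "dwave t x (s - x) \<noteq> 0" by (auto simp: fun_eq_iff)
  then have "0 \<le> x" "\<bar>t - x\<bar> \<le> s - x" "s - x \<le> t + x"
    using assms[of x] by (auto dest: dwave_nonzeroD simp: not_less[symmetric])
  then show "0 \<le> t \<and> t \<le> s" by auto
next
  assume H: "\<And>x y. H x y \<noteq> 0 \<Longrightarrow> 0 \<le> x \<and> x \<le> y" and "wave_step Q H t s \<noteq> 0"
  then have "(\<lambda>w. Q (fst w) * H (fst w) (snd w) * dwave t (fst w) (s - snd w)) \<noteq> (\<lambda>w. 0)"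
    unfolding wave_step_def by (intro notI) (simp only: integral_zero)
  then obtain x y where "H x y \<noteq> 0" "dwave t x (s - y) \<noteq> 0" by (auto simp: fun_eq_iff)
  then have "0 \<le> x" "x \<le> y" "\<bar>t - x\<bar> \<le> s - y" "s - y \<le> t + x"
    using H[of x y] by (auto dest: dwave_nonzeroD)
  then show "0 \<le> t \<and> t \<le> s" by auto
qed

text \<open>Neumann series. Since B \<le> c, every application of Duhamel's operator halves the norm with
weight e^(c s), and the first term has norm at most B / 2.\<close>

lemma wave_kernel_exists:
  assumes Q: "unif_loc Q B" and c: "1 \<le> c" "B \<le> c"
  shows "\<exists>K. wave_kernel Q K \<and> (\<forall>t s. \<bar>K t s\<bar> \<le> B * exp (c * s))"
proof -
  have Qm[measurable]: "Q \<in> borel_measurable borel" and B: "0 \<le> B" and Q0: "\<And>x. x < 0 \<Longrightarrow> Q x = 0"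
    using Q unfolding unif_loc_def by blast+
  define H where "H n = ((wave_step Q) ^^ n) (wave0 Q)" for n
  have H0: "H 0 = wave0 Q" and HS: "H (Suc n) = wave_step Q (H n)" for n
    by (simp_all add: H_def)
  have Hm[measurable]: "(\<lambda>z. H n (fst z) (snd z)) \<in> borel_measurable borel" for n
    by (induction n) (auto simp: H0 HS wave_measurable)
  have Hs: "H n t s \<noteq> 0 \<Longrightarrow> 0 \<le> t \<and> t \<le> s" for n t s
  proof (induction n arbitrary: t s)
    case 0 then show ?case using wave_support(1)[of Q t s] Q0 by (simp add: H0)
  next
    case (Suc n)
    then show ?case using wave_support(2)[of Q "H n" t s] Q0 by (auto simp: HS)
  qed
  define m where "m n = B / 2 * (1/2) ^ n" for n
  have m0: "0 \<le> m n" for n using B by (simp add: m_def)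
  have half: "m n * B / (2 * c) * e \<le> m (Suc n) * e" if "0 \<le> e" for n e
  proof -
    have "B / (2 * c) \<le> 1 / 2" using B c by (simp add: field_simps)
    from mult_left_mono[OF this m0[of n]] have "m n * B / (2 * c) \<le> m (Suc n)" by (simp add: m_def)
    then show ?thesis using that by (rule mult_right_mono)
  qed
  have Hb: "\<bar>H n t s\<bar> \<le> m n * exp (c * s)" for n t s
  proof (induction n arbitrary: t s)
    case 0 show ?case using wave0_bound[OF Q c(1)] by (simp add: H0 m_def)
  next
    case (Suc n)
    have "\<bar>H (Suc n) t s\<bar> \<le> m n * B / (2 * c) * exp (c * s)"
      unfolding HS using Suc by (intro wave_step_integrable[OF Q c(1) m0 Hm])
    also have "\<dots> \<le> m (Suc n) * exp (c * s)" by (rule half) simp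
    finally show ?case .
  qed
  have msum: "m sums B"
    unfolding m_def using sums_mult[OF power_half_series, of B] by (simp add: field_simps)
  define K where "K t s = (\<Sum>n. H n t s)" for t s
  have mes: "(\<lambda>n. m n * exp (c * s)) sums (B * exp (c * s))" for s
    using sums_mult2[OF msum] .
  have Habs: "summable (\<lambda>n. \<bar>H n t s\<bar>)" for t s
  proof (rule summable_comparison_test')
    show "summable (\<lambda>n. m n * exp (c * s))" using mes by (rule sums_summable)
    show "norm \<bar>H n t s\<bar> \<le> m n * exp (c * s)" if "0 \<le> n" for n using Hb by simp
  qed
  have HK: "(\<lambda>n. H n t s) sums K t s" for t s
    unfolding K_def by (rule summable_sums[OF summable_rabs_cancel[OF Habs]])
  have Kb: "\<bar>K t s\<bar> \<le> B * exp (c * s)" for t s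
    unfolding K_def
    using suminf_le[OF Hb[of _ t s] Habs sums_summable[OF mes[of s]]]
    by (intro order_trans[OF summable_rabs[OF Habs]]) (simp add: sums_unique[OF mes, symmetric])
  have Km[measurable]: "borel2 K"
    unfolding K_def by measurable
  have step: "(\<lambda>n. wave_step Q (H n) t s) sums wave_step Q K t s" for t s
  proof -
    let ?f = "\<lambda>n w. Q (fst w) * H n (fst w) (snd w) * dwave t (fst w) (s - snd w)"
    have "(\<lambda>n. integral\<^sup>L lborel (?f n)) sums (\<integral>w. (\<Sum>n. ?f n w) \<partial>lborel)"
    proof (rule sums_integral)
      show "integrable lborel (?f n)" for n by (rule wave_step_integrable[OF Q c(1) m0 Hm Hb])
      show "AE w in lborel. summable (\<lambda>n. norm (?f n w))"
        using summable_mult2[OF summable_mult[OF Habs]] by (auto simp: abs_mult)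
      show "summable (\<lambda>n. \<integral>w. norm (?f n w) \<partial>lborel)"
      proof (rule summable_comparison_test[OF _ summable_Suc_iff[THEN iffD2, OF sums_summable[OF mes[of s]]]], intro exI allI impI)
        fix n :: nat
        have "(\<integral>w. \<bar>?f n w\<bar> \<partial>lborel) \<le> m n * B / (2 * c) * exp (c * s)"
          by (rule wave_step_integrable(3)[OF Q c(1) m0 Hm Hb])
        also have "\<dots> \<le> m (Suc n) * exp (c * s)" by (rule half) simp
        finally show "norm (\<integral>w. norm (?f n w) \<partial>lborel) \<le> m (Suc n) * exp (c * s)" by simp
      qed
    qed
    moreover have "(\<Sum>n. ?f n w) = Q (fst w) * K (fst w) (snd w) * dwave t (fst w) (s - snd w)" for w
      using sums_unique[OF sums_mult2[OF sums_mult[OF HK]]] by simp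
    ultimately show ?thesis
      unfolding wave_step_def by (intro sums_minus) simp
  qed
  have "K t s = wave0 Q t s + wave_step Q K t s" for t s
  proof -
    have "(\<lambda>n. H (Suc n) t s) sums (K t s - H 0 t s)"
      using HK[of t s] by (subst sums_Suc_iff) simp
    then have "K t s - H 0 t s = wave_step Q K t s"
      using step[of t s] unfolding HS by (rule sums_unique2)
    then show ?thesis by (simp add: H0)
  qed
  moreover have "0 \<le> t \<and> t \<le> s" if "K t s \<noteq> 0" for t s
  proof -
    have "\<exists>n. H n t s \<noteq> 0"
    proof (rule ccontr)
      assume "\<nexists>n. H n t s \<noteq> 0"
      then have "(\<lambda>n. H n t s) = (\<lambda>n. 0)" by auto
      then show False using that unfolding K_def by simp
    qed
    then show ?thesis using Hs by blast
  qed
  ultimately show ?thesis using Km Kb unfolding wave_kernel_def by blast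
qed

section \<open>The Weyl solution and the response function\<close>

lemma lborel_Fubini:
  fixes F :: "'a::euclidean_space \<Rightarrow> 'b::euclidean_space \<Rightarrow> real"
  assumes m: "case_prod F \<in> borel_measurable (borel \<Otimes>\<^sub>M borel)"
    and fin: "(\<integral>\<^sup>+x. \<integral>\<^sup>+y. ennreal \<bar>F x y\<bar> \<partial>lborel \<partial>lborel) \<le> ennreal c"
  shows "integrable (lborel \<Otimes>\<^sub>M lborel) (case_prod F)"
    and "integrable lborel (\<lambda>x. \<integral>y. F x y \<partial>lborel)"
    and "integrable lborel (\<lambda>y. \<integral>x. F x y \<partial>lborel)"
    and "(\<integral>y. \<integral>x. F x y \<partial>lborel \<partial>lborel) = (\<integral>x. \<integral>y. F x y \<partial>lborel \<partial>lborel)"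
proof -
  have m'[measurable]: "case_prod F \<in> borel_measurable (lborel \<Otimes>\<^sub>M lborel)"
    using m by (simp cong: measurable_cong_sets add: sets_pair_measure_cong[OF sets_lborel sets_lborel])
  have "(\<integral>\<^sup>+w. ennreal (norm (case_prod F w)) \<partial>(lborel \<Otimes>\<^sub>M lborel))
      = (\<integral>\<^sup>+x. \<integral>\<^sup>+y. ennreal \<bar>F x y\<bar> \<partial>lborel \<partial>lborel)"
    by (subst lborel.nn_integral_fst[symmetric]) (auto simp: case_prod_beta)
  also have "\<dots> < \<infinity>" using fin by (auto intro: le_less_trans)
  finally show i: "integrable (lborel \<Otimes>\<^sub>M lborel) (case_prod F)"
    by (intro integrableI_bounded) auto
  show "integrable lborel (\<lambda>x. \<integral>y. F x y \<partial>lborel)"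
    using lborel_pair.integrable_fst[OF i] by simp
  show "integrable lborel (\<lambda>y. \<integral>x. F x y \<partial>lborel)"
    using lborel_pair.integrable_snd[OF i] by simp
  show "(\<integral>y. \<integral>x. F x y \<partial>lborel \<partial>lborel) = (\<integral>x. \<integral>y. F x y \<partial>lborel \<partial>lborel)"
    using lborel_pair.Fubini_integral[OF i] by simp
qed

lemma dgreen_bounds:
  assumes "1 \<le> \<kappa>" "0 \<le> t" "0 \<le> x"
  shows "0 \<le> dgreen \<kappa> t x" "dgreen \<kappa> t x \<le> exp (- \<bar>t - x\<bar>)"
proof -
  have "\<kappa> * \<bar>t - x\<bar> \<le> \<kappa> * (t + x)" using assms by (intro mult_left_mono) auto
  then show "0 \<le> dgreen \<kappa> t x" using assms unfolding dgreen_def by (intro divide_nonneg_pos) auto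
  have "exp (- \<kappa> * \<bar>t - x\<bar>) \<le> exp (- \<bar>t - x\<bar>)"
    using mult_right_mono[OF assms(1), of "\<bar>t - x\<bar>"] by simp
  moreover have "exp (- \<kappa> * \<bar>t - x\<bar>) - exp (- \<kappa> * (t + x)) \<le> exp (- \<kappa> * \<bar>t - x\<bar>)" by simp
  moreover have "dgreen \<kappa> t x \<le> exp (- \<kappa> * \<bar>t - x\<bar>) / (2 * \<kappa>)"
    using assms unfolding dgreen_def by (intro divide_right_mono) auto
  moreover have "exp (- \<kappa> * \<bar>t - x\<bar>) / (2 * \<kappa>) \<le> exp (- \<kappa> * \<bar>t - x\<bar>)"
    using assms by (simp add: field_simps)
  ultimately show "dgreen \<kappa> t x \<le> exp (- \<bar>t - x\<bar>)" by linarith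
qed

lemma nn_integral_dwave_laplace:
  assumes "\<kappa> \<ge> 1" "0 \<le> t" "0 \<le> x"
  shows "(\<integral>\<^sup>+s. ennreal \<bar>a * dwave t x (s - y) * exp (- \<kappa> * s)\<bar> \<partial>lborel)
        = ennreal (\<bar>a\<bar> * (exp (- \<kappa> * y) * dgreen \<kappa> t x))"
proof -
  have h: "has_bochner_integral lborel (\<lambda>s. exp (- \<kappa> * s) * dwave t x (s - y))
           (exp (- \<kappa> * y) * dgreen \<kappa> t x)"
    using assms by (intro has_integral_dwave_laplace) auto
  have "(\<integral>\<^sup>+s. ennreal \<bar>a * dwave t x (s - y) * exp (- \<kappa> * s)\<bar> \<partial>lborel)
      = (\<integral>\<^sup>+s. ennreal (\<bar>a\<bar> * (exp (- \<kappa> * s) * dwave t x (s - y))) \<partial>lborel)"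
    by (intro nn_integral_cong) (simp add: abs_mult mult_ac)
  also have "\<dots> = ennreal (\<integral>s. \<bar>a\<bar> * (exp (- \<kappa> * s) * dwave t x (s - y)) \<partial>lborel)"
    using h by (intro nn_integral_eq_integral) (auto intro: has_bochner_integral_integrable simp: has_bochner_integral_iff)
  also have "\<dots> = ennreal (\<bar>a\<bar> * (exp (- \<kappa> * y) * dgreen \<kappa> t x))"
    using h by (simp add: has_bochner_integral_iff)
  finally show ?thesis .
qed

lemma integral_dwave_laplace:
  assumes "\<kappa> \<ge> 1" "0 \<le> t" "0 \<le> x"
  shows "(\<integral>s. a * dwave t x (s - y) * exp (- \<kappa> * s) \<partial>lborel) = a * (exp (- \<kappa> * y) * dgreen \<kappa> t x)"
proof -
  have "(\<integral>s. a * dwave t x (s - y) * exp (- \<kappa> * s) \<partial>lborel)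
     = (\<integral>s. a * (exp (- \<kappa> * s) * dwave t x (s - y)) \<partial>lborel)"
    by (simp add: mult_ac)
  then show ?thesis
    using has_integral_dwave_laplace[of \<kappa> t x y] assms by (simp add: has_bochner_integral_iff)
qed

text \<open>The Laplace transform in s of delta(s - t) + K(t, s).\<close>

definition weyl :: "(real \<Rightarrow> real \<Rightarrow> real) \<Rightarrow> real \<Rightarrow> real \<Rightarrow> real" where
  "weyl K \<kappa> t = exp (- \<kappa> * t) + (\<integral>s. K t s * exp (- \<kappa> * s) \<partial>lborel)"

text \<open>Up to the factor -2, the regular part of the normal derivative at t = 0 and time 2 \<sigma> of the wave sent
out by a pulse. In inverse spectral theory it is known as Simon's A-function.\<close>

definition response :: "(real \<Rightarrow> real) \<Rightarrow> (real \<Rightarrow> real \<Rightarrow> real) \<Rightarrow> real \<Rightarrow> real" where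
  "response Q K \<sigma> = Q \<sigma> + 2 * (\<integral>x. Q x * K x (2 * \<sigma> - x) \<partial>lborel)"

locale bounded_wave_kernel =
  fixes Q :: "real \<Rightarrow> real" and B :: real and K :: "real \<Rightarrow> real \<Rightarrow> real" and c :: real
  assumes Q: "unif_loc Q B" and K: "wave_kernel Q K" and Kb: "\<bar>K t s\<bar> \<le> B * exp (c * s)" and c: "1 \<le> c"
begin

lemma Q_measurable [measurable]: "Q \<in> borel_measurable borel"
  and B_nonneg: "0 \<le> B"
  and Q_neg: "x < 0 \<Longrightarrow> Q x = 0"
  and Q_bound: "(\<integral>\<^sup>+x. ennreal (\<bar>Q x\<bar> * exp (- \<bar>t - x\<bar>)) \<partial>lborel) \<le> ennreal B"
  using Q by (auto simp: unif_loc_def)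

lemma K_measurable: "borel2 K"
  and K_support: "K t s \<noteq> 0 \<Longrightarrow> 0 \<le> t \<and> t \<le> s"
  and K_eq: "K t s = wave0 Q t s + wave_step Q K t s"
  using K unfolding wave_kernel_def by blast+

lemmas K_measurable' [measurable] = measurable_curried[OF K_measurable]

lemma nn_integral_K_laplace:
  assumes \<kappa>: "c + 1 \<le> \<kappa>" and x: "0 \<le> x"
  shows "(\<integral>\<^sup>+y. ennreal (\<bar>K x y\<bar> * exp (- \<kappa> * y)) \<partial>lborel) \<le> ennreal (B * exp (- (\<kappa> - c) * x))"
proof -
  have "(\<integral>\<^sup>+y. ennreal (\<bar>K x y\<bar> * exp (- \<kappa> * y)) \<partial>lborel)
      \<le> (\<integral>\<^sup>+y. ennreal B * (ennreal (exp (- (\<kappa> - c) * y)) * indicator {x..} y) \<partial>lborel)"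
  proof (intro nn_integral_mono)
    fix y
    show "ennreal (\<bar>K x y\<bar> * exp (- \<kappa> * y)) \<le> ennreal B * (ennreal (exp (- (\<kappa> - c) * y)) * indicator {x..} y)"
    proof (cases "K x y = 0")
      case False
      then have "x \<le> y" using K_support by blast
      moreover have "\<bar>K x y\<bar> * exp (- \<kappa> * y) \<le> B * exp (c * y) * exp (- \<kappa> * y)"
        using Kb by (intro mult_right_mono) auto
      then have "\<bar>K x y\<bar> * exp (- \<kappa> * y) \<le> B * exp (- (\<kappa> - c) * y)"
        by (simp add: exp_add[symmetric] algebra_simps exp_diff exp_minus field_simps)
      ultimately show ?thesis using B_nonneg by (simp add: ennreal_mult'[symmetric] ennreal_leI)
    qed simp
  qed
  also have "\<dots> = ennreal B * ennreal (exp (- (\<kappa> - c) * x) / (\<kappa> - c))"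
    using \<kappa> c nn_integral_exp_atLeast[of "\<kappa> - c" x] by (subst nn_integral_cmult) auto
  also have "\<dots> \<le> ennreal B * ennreal (exp (- (\<kappa> - c) * x))"
  proof -
    have "exp (- (\<kappa> - c) * x) / (\<kappa> - c) \<le> exp (- (\<kappa> - c) * x)"
      using \<kappa> by (simp add: divide_le_eq mult_le_cancel_left1)
    then show ?thesis by (intro mult_left_mono ennreal_leI) auto
  qed
  finally show ?thesis using B_nonneg by (simp add: ennreal_mult'[symmetric])
qed

lemma K_laplace:
  assumes \<kappa>: "c + 1 \<le> \<kappa>" and x: "0 \<le> x"
  shows "integrable lborel (\<lambda>y. K x y * exp (- \<kappa> * y))"
    and "\<bar>\<integral>y. K x y * exp (- \<kappa> * y) \<partial>lborel\<bar> \<le> B * exp (- (\<kappa> - c) * x)"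
proof -
  have "(\<integral>\<^sup>+y. ennreal \<bar>K x y * exp (- \<kappa> * y)\<bar> \<partial>lborel) \<le> ennreal (B * exp (- (\<kappa> - c) * x))"
    using nn_integral_K_laplace[OF assms] by (simp add: abs_mult)
  from integral_abs_le_nn_bound[OF _ this]
  show "integrable lborel (\<lambda>y. K x y * exp (- \<kappa> * y))"
    and "\<bar>\<integral>y. K x y * exp (- \<kappa> * y) \<partial>lborel\<bar> \<le> B * exp (- (\<kappa> - c) * x)"
    using B_nonneg by auto
qed

lemma weyl_measurable [measurable]: "weyl K \<kappa> \<in> borel_measurable borel"
  unfolding weyl_def by measurable

lemma weyl_bound:
  assumes \<kappa>: "c + 1 \<le> \<kappa>" and t: "0 \<le> t"
  shows "\<bar>weyl K \<kappa> t\<bar> \<le> (1 + B) * exp (- (\<kappa> - c) * t)"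
proof -
  have "exp (- \<kappa> * t) \<le> exp (- (\<kappa> - c) * t)" using t c by (simp add: algebra_simps)
  moreover have "0 < exp (- \<kappa> * t)" by simp
  moreover note K_laplace(2)[OF assms]
  ultimately show ?thesis unfolding weyl_def ring_distribs mult_1 by linarith
qed

text \<open>The uniformly local bound in use: a function that decays exponentially away from some point is
integrable against Q, with a bound that does not depend on the point.\<close>

lemma integrable_Q_exp:
  assumes "g \<in> borel_measurable borel" "\<And>x. 0 \<le> x \<Longrightarrow> \<bar>g x\<bar> \<le> m * exp (- \<bar>t - x\<bar>)" "0 \<le> m"
  shows "integrable lborel (\<lambda>x. Q x * g x)" "\<bar>\<integral>x. Q x * g x \<partial>lborel\<bar> \<le> m * B"
    "(\<integral>\<^sup>+x. ennreal \<bar>Q x * g x\<bar> \<partial>lborel) \<le> ennreal (m * B)"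
proof -
  have "(\<integral>\<^sup>+x. ennreal \<bar>Q x * g x\<bar> \<partial>lborel) \<le> (\<integral>\<^sup>+x. ennreal m * ennreal (\<bar>Q x\<bar> * exp (- \<bar>t - x\<bar>)) \<partial>lborel)"
  proof (intro nn_integral_mono)
    fix x
    show "ennreal \<bar>Q x * g x\<bar> \<le> ennreal m * ennreal (\<bar>Q x\<bar> * exp (- \<bar>t - x\<bar>))"
    proof (cases "x < 0")
      case False
      then have "\<bar>Q x\<bar> * \<bar>g x\<bar> \<le> \<bar>Q x\<bar> * (m * exp (- \<bar>t - x\<bar>))"
        using assms by (intro mult_left_mono) auto
      then show ?thesis using assms(3) by (simp add: abs_mult ennreal_mult'[symmetric] mult_ac)
    qed (simp add: Q_neg)
  qed
  also have "\<dots> \<le> ennreal m * ennreal B"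
    using Q_bound by (subst nn_integral_cmult) (auto intro!: mult_left_mono)
  finally show *: "(\<integral>\<^sup>+x. ennreal \<bar>Q x * g x\<bar> \<partial>lborel) \<le> ennreal (m * B)"
    using assms(3) B_nonneg by (simp add: ennreal_mult'[symmetric])
  have "(\<lambda>x. Q x * g x) \<in> borel_measurable lborel" using assms(1) by measurable
  from integral_abs_le_nn_bound[OF this *] show "integrable lborel (\<lambda>x. Q x * g x)" "\<bar>\<integral>x. Q x * g x \<partial>lborel\<bar> \<le> m * B"
    using assms(3) B_nonneg by auto
qed

lemma dgreen_measurable [measurable]:
  assumes [measurable]: "f \<in> borel_measurable M"
  shows "(\<lambda>x. dgreen \<kappa> t (f x)) \<in> borel_measurable M"
  unfolding dgreen_def by measurable

text \<open>The Laplace transform of Duhamel's formula. Fubini applies because \<kappa> exceeds the exponential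
growth rate c of K.\<close>

lemma weyl_green:
  assumes \<kappa>: "c + 2 \<le> \<kappa>" and t: "0 \<le> t"
  shows "weyl K \<kappa> t = exp (- \<kappa> * t) - (\<integral>x. Q x * (dgreen \<kappa> t x * weyl K \<kappa> x) \<partial>lborel)"
proof -
  have \<kappa>1: "1 \<le> \<kappa>" "c + 1 \<le> \<kappa>" using \<kappa> c by auto
  let ?F0 = "\<lambda>x s. Q x * dwave t x (s - x) * exp (- \<kappa> * s)"
  have F0s: "(\<integral>\<^sup>+s. ennreal \<bar>?F0 x s\<bar> \<partial>lborel) = ennreal \<bar>Q x * (exp (- \<kappa> * x) * dgreen \<kappa> t x)\<bar>" for x
  proof (cases "x < 0")
    case False
    then show ?thesis using nn_integral_dwave_laplace[OF \<kappa>1(1) t, of x "Q x" x] dgreen_bounds[OF \<kappa>1(1) t, of x]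
      by (simp add: abs_mult)
  qed (simp add: Q_neg)
  have g0: "\<bar>exp (- \<kappa> * x) * dgreen \<kappa> t x\<bar> \<le> 1 * exp (- \<bar>t - x\<bar>)" if "0 \<le> x" for x
  proof -
    have "exp (- \<kappa> * x) \<le> 1" using that \<kappa>1 by simp
    then have "exp (- \<kappa> * x) * dgreen \<kappa> t x \<le> 1 * exp (- \<bar>t - x\<bar>)"
      using dgreen_bounds[OF \<kappa>1(1) t that] by (intro mult_mono) auto
    then show ?thesis using dgreen_bounds[OF \<kappa>1(1) t that] by simp
  qed
  have Q0: "integrable lborel (\<lambda>x. Q x * (exp (- \<kappa> * x) * dgreen \<kappa> t x))"
     "(\<integral>\<^sup>+x. ennreal \<bar>Q x * (exp (- \<kappa> * x) * dgreen \<kappa> t x)\<bar> \<partial>lborel) \<le> ennreal (1 * B)"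
    by (rule integrable_Q_exp[OF _ g0]; (simp; fail)?; measurable)+
  have F0m: "case_prod ?F0 \<in> borel_measurable (borel \<Otimes>\<^sub>M borel)" by measurable
  note fub0 = lborel_Fubini[OF F0m, unfolded F0s, OF Q0(2)]
  let ?F1 = "\<lambda>w s. Q (fst w) * K (fst w) (snd w) * dwave t (fst w) (s - snd w) * exp (- \<kappa> * s)"
  let ?H = "\<lambda>x y. Q x * dgreen \<kappa> t x * (K x y * exp (- \<kappa> * y))"
  have F1s: "(\<integral>\<^sup>+s. ennreal \<bar>?F1 w s\<bar> \<partial>lborel) = ennreal \<bar>?H (fst w) (snd w)\<bar>" for w
  proof (cases "fst w < 0")
    case False
    then show ?thesis
      using nn_integral_dwave_laplace[OF \<kappa>1(1) t, of "fst w" "Q (fst w) * K (fst w) (snd w)" "snd w"]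
        dgreen_bounds[OF \<kappa>1(1) t, of "fst w"]
      by (simp add: abs_mult mult_ac)
  qed (simp add: Q_neg)
  have Hb: "(\<integral>\<^sup>+x. \<integral>\<^sup>+y. ennreal \<bar>?H x y\<bar> \<partial>lborel \<partial>lborel) \<le> ennreal (B * B)"
  proof -
    have "(\<integral>\<^sup>+y. ennreal \<bar>?H x y\<bar> \<partial>lborel) \<le> ennreal \<bar>Q x * (B * exp (- \<bar>t - x\<bar>))\<bar>" for x
    proof (cases "x < 0")
      case False
      then have x: "0 \<le> x" by simp
      have "(\<integral>\<^sup>+y. ennreal \<bar>?H x y\<bar> \<partial>lborel)
         = (\<integral>\<^sup>+y. ennreal (\<bar>Q x\<bar> * dgreen \<kappa> t x) * ennreal (\<bar>K x y\<bar> * exp (- \<kappa> * y)) \<partial>lborel)"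
        using dgreen_bounds[OF \<kappa>1(1) t x]
        by (intro nn_integral_cong) (simp add: abs_mult ennreal_mult'[symmetric] mult_ac)
      also have "\<dots> \<le> ennreal (\<bar>Q x\<bar> * exp (- \<bar>t - x\<bar>)) * ennreal (B * exp (- (\<kappa> - c) * x))"
        using dgreen_bounds[OF \<kappa>1(1) t x] nn_integral_K_laplace[OF \<kappa>1(2) x]
        by (subst nn_integral_cmult) (auto intro!: mult_mono ennreal_leI mult_left_mono)
      also have "\<dots> \<le> ennreal (\<bar>Q x\<bar> * exp (- \<bar>t - x\<bar>)) * ennreal (B * 1)"
        using \<kappa> x B_nonneg by (intro mult_left_mono ennreal_leI) (auto intro: mult_nonpos_nonneg)
      also have "\<dots> = ennreal \<bar>Q x * (B * exp (- \<bar>t - x\<bar>))\<bar>"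
        using B_nonneg by (simp add: abs_mult ennreal_mult'[symmetric] mult_ac)
      finally show ?thesis .
    qed (simp add: Q_neg)
    then have "(\<integral>\<^sup>+x. \<integral>\<^sup>+y. ennreal \<bar>?H x y\<bar> \<partial>lborel \<partial>lborel) \<le> (\<integral>\<^sup>+x. ennreal \<bar>Q x * (B * exp (- \<bar>t - x\<bar>))\<bar> \<partial>lborel)"
      by (intro nn_integral_mono) auto
    also have "\<dots> \<le> ennreal (B * B)"
      using B_nonneg by (intro integrable_Q_exp(3)[where t=t]) auto
    finally show ?thesis .
  qed
  have Hm: "case_prod ?H \<in> borel_measurable (borel \<Otimes>\<^sub>M borel)" by measurable
  note fubH = lborel_Fubini[OF Hm Hb]
  have F1m: "case_prod ?F1 \<in> borel_measurable (borel \<Otimes>\<^sub>M borel)" by measurable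
  have "(\<integral>\<^sup>+w. ennreal \<bar>?H (fst w) (snd w)\<bar> \<partial>lborel) \<le> ennreal (B * B)"
    using Hb by (subst nn_integral_lborel_pair) auto
  note fub1 = lborel_Fubini[OF F1m, unfolded F1s, OF this]
  have i0: "(\<integral>x. \<integral>s. ?F0 x s \<partial>lborel \<partial>lborel) = (\<integral>x. Q x * (exp (- \<kappa> * x) * dgreen \<kappa> t x) \<partial>lborel)"
  proof (intro Bochner_Integration.integral_cong refl)
    fix x show "(\<integral>s. ?F0 x s \<partial>lborel) = Q x * (exp (- \<kappa> * x) * dgreen \<kappa> t x)"
    proof (cases "x < 0")
      case False
      then show ?thesis using integral_dwave_laplace[OF \<kappa>1(1) t, of x "Q x" x] by (simp only: not_less)
    qed (simp add: Q_neg)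
  qed
  have "(\<integral>w. \<integral>s. ?F1 w s \<partial>lborel \<partial>lborel) = (\<integral>w. ?H (fst w) (snd w) \<partial>lborel)"
  proof (intro Bochner_Integration.integral_cong refl)
    fix w show "(\<integral>s. ?F1 w s \<partial>lborel) = ?H (fst w) (snd w)"
    proof (cases "fst w < 0")
      case False
      then have "(\<integral>s. ?F1 w s \<partial>lborel)
          = Q (fst w) * K (fst w) (snd w) * (exp (- \<kappa> * snd w) * dgreen \<kappa> t (fst w))"
        by (intro integral_dwave_laplace[OF \<kappa>1(1) t]) simp
      then show ?thesis by (simp only: mult_ac)
    qed (simp add: Q_neg)
  qed
  also have "\<dots> = (\<integral>x. \<integral>y. ?H x y \<partial>lborel \<partial>lborel)"
    using lborel_pair.integral_fst'[OF fubH(1)] by (simp add: lborel_prod case_prod_unfold)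
  also have "\<dots> = (\<integral>x. Q x * dgreen \<kappa> t x * (\<integral>y. K x y * exp (- \<kappa> * y) \<partial>lborel) \<partial>lborel)"
    by simp
  finally have i1: "(\<integral>w. \<integral>s. ?F1 w s \<partial>lborel \<partial>lborel)
      = (\<integral>x. Q x * dgreen \<kappa> t x * (\<integral>y. K x y * exp (- \<kappa> * y) \<partial>lborel) \<partial>lborel)" .
  have "(\<integral>s. K t s * exp (- \<kappa> * s) \<partial>lborel)
      = (\<integral>s. - (\<integral>x. ?F0 x s \<partial>lborel) + - (\<integral>w. ?F1 w s \<partial>lborel) \<partial>lborel)"
  proof (intro Bochner_Integration.integral_cong refl)
    fix s
    have "K t s * exp (- \<kappa> * s) = - ((\<integral>x. Q x * dwave t x (s - x) \<partial>lborel) * exp (- \<kappa> * s))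
      + - ((\<integral>w. Q (fst w) * K (fst w) (snd w) * dwave t (fst w) (s - snd w) \<partial>lborel) * exp (- \<kappa> * s))"
      by (subst K_eq) (simp add: wave0_def wave_step_def ring_distribs)
    then show "K t s * exp (- \<kappa> * s) = - (\<integral>x. ?F0 x s \<partial>lborel) + - (\<integral>w. ?F1 w s \<partial>lborel)"
      by simp
  qed
  also have "\<dots> = - (\<integral>s. \<integral>x. ?F0 x s \<partial>lborel \<partial>lborel) + - (\<integral>s. \<integral>w. ?F1 w s \<partial>lborel \<partial>lborel)"
    using fub0(3) fub1(3) by (subst Bochner_Integration.integral_add) auto
  also have "\<dots> = - (\<integral>x. Q x * (exp (- \<kappa> * x) * dgreen \<kappa> t x) \<partial>lborel)
     - (\<integral>x. Q x * dgreen \<kappa> t x * (\<integral>y. K x y * exp (- \<kappa> * y) \<partial>lborel) \<partial>lborel)"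
    unfolding fub0(4) fub1(4) i0 i1 by simp
  also have "\<dots> = - (\<integral>x. Q x * (dgreen \<kappa> t x * weyl K \<kappa> x) \<partial>lborel)"
  proof -
    have "integrable lborel (\<lambda>x. Q x * dgreen \<kappa> t x * (\<integral>y. K x y * exp (- \<kappa> * y) \<partial>lborel))"
      using fubH(2) by simp
    then have "(\<integral>x. Q x * (exp (- \<kappa> * x) * dgreen \<kappa> t x) \<partial>lborel)
       + (\<integral>x. Q x * dgreen \<kappa> t x * (\<integral>y. K x y * exp (- \<kappa> * y) \<partial>lborel) \<partial>lborel)
       = (\<integral>x. Q x * (exp (- \<kappa> * x) * dgreen \<kappa> t x)
            + Q x * dgreen \<kappa> t x * (\<integral>y. K x y * exp (- \<kappa> * y) \<partial>lborel) \<partial>lborel)"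
      using Q0(1) by (intro Bochner_Integration.integral_add[symmetric])
    also have "\<dots> = (\<integral>x. Q x * (dgreen \<kappa> t x * weyl K \<kappa> x) \<partial>lborel)"
      by (intro Bochner_Integration.integral_cong refl) (simp add: weyl_def ring_distribs mult_ac)
    finally show ?thesis by linarith
  qed
  finally show ?thesis by (simp add: weyl_def)
qed

text \<open>The product e^(-\<kappa> x) K(x, y) e^(-\<kappa> y) depends on \<kappa> only through x + y = 2 \<sigma>, so the
integral over y becomes one over \<sigma>.\<close>

lemma response_laplace:
  assumes \<kappa>: "c + 2 \<le> \<kappa>"
  shows "integrable lborel (\<lambda>\<sigma>. response Q K \<sigma> * exp (- 2 * \<kappa> * \<sigma>))"
    and "(\<integral>\<sigma>. response Q K \<sigma> * exp (- 2 * \<kappa> * \<sigma>) \<partial>lborel) = (\<integral>x. Q x * (exp (- \<kappa> * x) * weyl K \<kappa> x) \<partial>lborel)"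
proof -
  have \<kappa>1: "1 \<le> \<kappa>" "c + 1 \<le> \<kappa>" using \<kappa> c by auto
  let ?F = "\<lambda>x \<sigma>. 2 * (Q x * K x (2 * \<sigma> - x)) * exp (- 2 * \<kappa> * \<sigma>)"
  have "(\<integral>\<^sup>+\<sigma>. ennreal \<bar>?F x \<sigma>\<bar> \<partial>lborel) \<le> ennreal \<bar>Q x * (B * exp (- \<bar>0 - x\<bar>))\<bar>" for x
  proof (cases "x < 0")
    case False
    then have x: "0 \<le> x" by simp
    have "(\<integral>\<^sup>+\<sigma>. ennreal \<bar>?F x \<sigma>\<bar> \<partial>lborel)
      = (\<integral>\<^sup>+\<sigma>. ennreal (2 * \<bar>Q x\<bar> * exp (- \<kappa> * x)) * ennreal (\<bar>K x (- x + 2 * \<sigma>)\<bar> * exp (- \<kappa> * (- x + 2 * \<sigma>))) \<partial>lborel)"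
    proof (intro nn_integral_cong)
      fix \<sigma>
      have "exp (- 2 * \<kappa> * \<sigma>) = exp (- \<kappa> * x) * exp (- \<kappa> * (- x + 2 * \<sigma>))"
        by (simp add: exp_add[symmetric] algebra_simps)
      then show "ennreal \<bar>?F x \<sigma>\<bar> = ennreal (2 * \<bar>Q x\<bar> * exp (- \<kappa> * x)) * ennreal (\<bar>K x (- x + 2 * \<sigma>)\<bar> * exp (- \<kappa> * (- x + 2 * \<sigma>)))"
        by (simp add: abs_mult ennreal_mult'[symmetric] mult_ac del: mult_minus_left)
    qed
    also have "\<dots> = ennreal (2 * \<bar>Q x\<bar> * exp (- \<kappa> * x)) * (\<integral>\<^sup>+\<sigma>. ennreal (\<bar>K x (- x + 2 * \<sigma>)\<bar> * exp (- \<kappa> * (- x + 2 * \<sigma>))) \<partial>lborel)"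
      by (subst nn_integral_cmult) auto
    also have "\<dots> = ennreal (\<bar>Q x\<bar> * exp (- \<kappa> * x)) * (ennreal 2 * (\<integral>\<^sup>+\<sigma>. ennreal (\<bar>K x (- x + 2 * \<sigma>)\<bar> * exp (- \<kappa> * (- x + 2 * \<sigma>))) \<partial>lborel))"
    proof -
      have "2 * \<bar>Q x\<bar> * exp (- \<kappa> * x) = (\<bar>Q x\<bar> * exp (- \<kappa> * x)) * 2" by simp
      then have "ennreal (2 * \<bar>Q x\<bar> * exp (- \<kappa> * x)) = ennreal (\<bar>Q x\<bar> * exp (- \<kappa> * x)) * ennreal 2"
        by (simp only: ennreal_mult'' zero_le_numeral)
      then show ?thesis by (simp only: mult.assoc)
    qed
    also have "ennreal 2 * (\<integral>\<^sup>+\<sigma>. ennreal (\<bar>K x (- x + 2 * \<sigma>)\<bar> * exp (- \<kappa> * (- x + 2 * \<sigma>))) \<partial>lborel)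
        = (\<integral>\<^sup>+y. ennreal (\<bar>K x y\<bar> * exp (- \<kappa> * y)) \<partial>lborel)"
      by (subst nn_integral_real_affine[where c=2 and t="-x"]) auto
    also have "ennreal (\<bar>Q x\<bar> * exp (- \<kappa> * x)) * (\<integral>\<^sup>+y. ennreal (\<bar>K x y\<bar> * exp (- \<kappa> * y)) \<partial>lborel)
        \<le> ennreal (\<bar>Q x\<bar> * exp (- x)) * ennreal (B * 1)"
    proof (intro mult_mono ennreal_leI mult_left_mono)
      show "exp (- \<kappa> * x) \<le> exp (- x)" using mult_right_mono[OF \<kappa>1(1) x] by simp
      show "(\<integral>\<^sup>+y. ennreal (\<bar>K x y\<bar> * exp (- \<kappa> * y)) \<partial>lborel) \<le> ennreal (B * 1)"
        using \<kappa> x B_nonneg by (intro order_trans[OF nn_integral_K_laplace[OF \<kappa>1(2) x]] ennreal_leI mult_left_mono) (auto intro: mult_nonpos_nonneg)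
    qed auto
    also have "\<dots> = ennreal \<bar>Q x * (B * exp (- \<bar>0 - x\<bar>))\<bar>"
      using B_nonneg x by (simp add: abs_mult ennreal_mult'[symmetric] mult_ac)
    finally show ?thesis .
  qed (simp add: Q_neg)
  then have "(\<integral>\<^sup>+x. \<integral>\<^sup>+\<sigma>. ennreal \<bar>?F x \<sigma>\<bar> \<partial>lborel \<partial>lborel) \<le> (\<integral>\<^sup>+x. ennreal \<bar>Q x * (B * exp (- \<bar>0 - x\<bar>))\<bar> \<partial>lborel)"
    by (intro nn_integral_mono) auto
  also have "\<dots> \<le> ennreal (B * B)"
    using B_nonneg by (intro integrable_Q_exp(3)[where t=0]) auto
  finally have fb: "(\<integral>\<^sup>+x. \<integral>\<^sup>+\<sigma>. ennreal \<bar>?F x \<sigma>\<bar> \<partial>lborel \<partial>lborel) \<le> ennreal (B * B)" .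
  have Fm: "case_prod ?F \<in> borel_measurable (borel \<Otimes>\<^sub>M borel)" by measurable
  note fub = lborel_Fubini[OF Fm fb]
  have iQ: "integrable lborel (\<lambda>x. Q x * exp (- 2 * \<kappa> * x))"
  proof (rule integrable_Q_exp(1)[where m=1 and t=0])
    show "\<bar>exp (- 2 * \<kappa> * x)\<bar> \<le> 1 * exp (- \<bar>0 - x\<bar>)" if "0 \<le> x" for x
      using mult_right_mono[OF \<kappa>1(1) that] that by simp
  qed auto
  have r: "response Q K \<sigma> * exp (- 2 * \<kappa> * \<sigma>) = Q \<sigma> * exp (- 2 * \<kappa> * \<sigma>) + (\<integral>x. ?F x \<sigma> \<partial>lborel)" for \<sigma>
    by (simp add: response_def ring_distribs)
  show "integrable lborel (\<lambda>\<sigma>. response Q K \<sigma> * exp (- 2 * \<kappa> * \<sigma>))"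
    unfolding r using iQ fub(3) by (rule Bochner_Integration.integrable_add)
  have inner: "(\<integral>\<sigma>. ?F x \<sigma> \<partial>lborel) = Q x * (exp (- \<kappa> * x) * (\<integral>y. K x y * exp (- \<kappa> * y) \<partial>lborel))" for x
  proof -
    have "(\<integral>\<sigma>. ?F x \<sigma> \<partial>lborel) = (\<integral>\<sigma>. (2 * Q x * exp (- \<kappa> * x)) * (K x (- x + 2 * \<sigma>) * exp (- \<kappa> * (- x + 2 * \<sigma>))) \<partial>lborel)"
    proof (intro Bochner_Integration.integral_cong refl)
      fix \<sigma>
      have "exp (- 2 * \<kappa> * \<sigma>) = exp (- \<kappa> * x) * exp (- \<kappa> * (- x + 2 * \<sigma>))"
        by (simp add: exp_add[symmetric] algebra_simps)
      then show "?F x \<sigma> = (2 * Q x * exp (- \<kappa> * x)) * (K x (- x + 2 * \<sigma>) * exp (- \<kappa> * (- x + 2 * \<sigma>)))"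
        by (simp add: mult_ac del: mult_minus_left)
    qed
    also have "\<dots> = (Q x * exp (- \<kappa> * x)) * (2 * (\<integral>\<sigma>. K x (- x + 2 * \<sigma>) * exp (- \<kappa> * (- x + 2 * \<sigma>)) \<partial>lborel))"
      by simp
    also have "2 * (\<integral>\<sigma>. K x (- x + 2 * \<sigma>) * exp (- \<kappa> * (- x + 2 * \<sigma>)) \<partial>lborel) = (\<integral>y. K x y * exp (- \<kappa> * y) \<partial>lborel)"
      by (subst (2) lborel_integral_real_affine[where c=2 and t="-x"]) auto
    finally show ?thesis by (simp only: mult.assoc)
  qed
  have i2: "integrable lborel (\<lambda>x. Q x * (exp (- \<kappa> * x) * (\<integral>y. K x y * exp (- \<kappa> * y) \<partial>lborel)))"
    using fub(2) unfolding inner .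
  have "(\<integral>\<sigma>. response Q K \<sigma> * exp (- 2 * \<kappa> * \<sigma>) \<partial>lborel)
     = (\<integral>\<sigma>. Q \<sigma> * exp (- 2 * \<kappa> * \<sigma>) \<partial>lborel) + (\<integral>\<sigma>. \<integral>x. ?F x \<sigma> \<partial>lborel \<partial>lborel)"
    unfolding r using iQ fub(3) by (rule Bochner_Integration.integral_add)
  also have "\<dots> = (\<integral>x. Q x * exp (- 2 * \<kappa> * x) + Q x * (exp (- \<kappa> * x) * (\<integral>y. K x y * exp (- \<kappa> * y) \<partial>lborel)) \<partial>lborel)"
    unfolding fub(4) inner using iQ i2 by (rule Bochner_Integration.integral_add[symmetric])
  also have "\<dots> = (\<integral>x. Q x * (exp (- \<kappa> * x) * weyl K \<kappa> x) \<partial>lborel)"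
  proof (intro Bochner_Integration.integral_cong refl)
    fix x
    have "exp (- 2 * \<kappa> * x) = exp (- \<kappa> * x) * exp (- \<kappa> * x)" by (simp add: exp_add[symmetric])
    then show "Q x * exp (- 2 * \<kappa> * x) + Q x * (exp (- \<kappa> * x) * (\<integral>y. K x y * exp (- \<kappa> * y) \<partial>lborel))
      = Q x * (exp (- \<kappa> * x) * weyl K \<kappa> x)"
      by (simp add: weyl_def ring_distribs)
  qed
  finally show "(\<integral>\<sigma>. response Q K \<sigma> * exp (- 2 * \<kappa> * \<sigma>) \<partial>lborel) = (\<integral>x. Q x * (exp (- \<kappa> * x) * weyl K \<kappa> x) \<partial>lborel)" .
qed

end

section \<open>Absolutely continuous functions and uniqueness of decaying solutions\<close>

text \<open>F is absolutely continuous on the half-line with derivative f almost everywhere. As Q is only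
locally integrable, second derivatives of solutions exist in this sense only.\<close>

definition primitive :: "(real \<Rightarrow> real) \<Rightarrow> (real \<Rightarrow> real) \<Rightarrow> bool" where
  "primitive F f \<longleftrightarrow> (\<forall>t\<ge>0. set_integrable lborel {0..t} f \<and> F t = F 0 + (LBINT x:{0..t}. f x))"

lemma primitiveD:
  assumes "primitive F f" "0 \<le> t"
  shows "set_integrable lborel {0..t} f" "F t = F 0 + (LBINT x:{0..t}. f x)"
  using assms unfolding primitive_def by blast+

lemma primitive_cong:
  assumes "primitive F f" "\<And>t. 0 \<le> t \<Longrightarrow> F t = G t" "\<And>t. 0 \<le> t \<Longrightarrow> f t = g t"
  shows "primitive G g"
  unfolding primitive_def
proof (intro allI impI)
  fix t :: real assume t: "0 \<le> t"
  have "set_integrable lborel {0..t} f \<longleftrightarrow> set_integrable lborel {0..t} g"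
    using assms(3) by (intro set_integrable_cong) auto
  moreover have "(LBINT x:{0..t}. f x) = (LBINT x:{0..t}. g x)"
    using assms(3) by (intro set_lebesgue_integral_cong) auto
  ultimately show "set_integrable lborel {0..t} g \<and> G t = G 0 + (LBINT x:{0..t}. g x)"
    using primitiveD[OF assms(1) t] assms(2) t by simp
qed

lemma primitive_add:
  assumes "primitive F f" "primitive G g"
  shows "primitive (\<lambda>t. F t + G t) (\<lambda>t. f t + g t)"
  unfolding primitive_def
proof (intro allI impI)
  fix t :: real assume t: "0 \<le> t"
  note a = primitiveD[OF assms(1) t] and b = primitiveD[OF assms(2) t]
  show "set_integrable lborel {0..t} (\<lambda>t. f t + g t) \<and> F t + G t = F 0 + G 0 + (LBINT x:{0..t}. f x + g x)"
    using a b set_integral_add[OF a(1) b(1)] by simp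
qed

lemma primitive_cmult:
  assumes "primitive F f"
  shows "primitive (\<lambda>t. a * F t) (\<lambda>t. a * f t)"
  unfolding primitive_def
proof (intro allI impI)
  fix t :: real assume t: "0 \<le> t"
  note a = primitiveD[OF assms(1) t]
  show "set_integrable lborel {0..t} (\<lambda>t. a * f t) \<and> a * F t = a * F 0 + (LBINT x:{0..t}. a * f x)"
    using a by (simp add: ring_distribs)
qed

lemma primitive_diff:
  assumes "primitive F f" "primitive G g"
  shows "primitive (\<lambda>t. F t - G t) (\<lambda>t. f t - g t)"
  using primitive_add[OF assms(1) primitive_cmult[OF assms(2), of "-1"]] by simp

lemma primitive_C1:
  assumes "\<And>t. 0 \<le> t \<Longrightarrow> (F has_real_derivative f t) (at t within {0..})" "continuous_on {0..} f"
  shows "primitive F f"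
  unfolding primitive_def
proof (intro allI impI)
  fix t :: real assume t: "0 \<le> t"
  have c: "continuous_on {0..t} f" by (rule continuous_on_subset[OF assms(2)]) auto
  have d: "(F has_vector_derivative f x) (at x within {0..t})" if "0 \<le> x" "x \<le> t" for x
    using assms(1)[of x] that unfolding has_real_derivative_iff_has_vector_derivative
    by (auto intro: has_vector_derivative_within_subset)
  have "has_bochner_integral lborel (\<lambda>x. indicator {0..t} x *\<^sub>R f x) (F t - F 0)"
    by (rule has_bochner_integral_FTC_Icc[OF t d c])
  then show "set_integrable lborel {0..t} f \<and> F t = F 0 + (LBINT x:{0..t}. f x)"
    by (simp add: has_bochner_integral_iff set_integrable_def set_lebesgue_integral_def)
qed

lemma primitive_const: "primitive (\<lambda>t. a) (\<lambda>t. 0)"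
  by (rule primitive_C1) (auto intro!: derivative_eq_intros)

text \<open>The product of the two increments is the integral of f(x) g(y) over a square; the triangles below and
above the diagonal give the two terms of the product rule.\<close>

lemma primitive_mult:
  assumes F: "primitive F f" and G: "primitive G g"
  shows "primitive (\<lambda>t. F t * G t) (\<lambda>t. f t * G t + F t * g t)"
  unfolding primitive_def
proof (intro allI impI)
  fix T :: real assume T: "0 \<le> T"
  define f' where "f' x = indicator {0..T} x * f x" for x
  define g' where "g' x = indicator {0..T} x * g x" for x
  have if': "integrable lborel f'" and ig': "integrable lborel g'"
    using primitiveD(1)[OF F T] primitiveD(1)[OF G T]
    by (simp_all add: set_integrable_def f'_def[abs_def] g'_def[abs_def])
  have [measurable]: "f' \<in> borel_measurable borel" "g' \<in> borel_measurable borel"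
    using borel_measurable_integrable[OF if'] borel_measurable_integrable[OF ig'] by simp_all
  have IF: "(\<integral>x. f' x \<partial>lborel) = F T - F 0" and IG: "(\<integral>x. g' x \<partial>lborel) = G T - G 0"
    using primitiveD(2)[OF F T] primitiveD(2)[OF G T]
    by (simp_all add: set_lebesgue_integral_def f'_def g'_def)
  define P where "P x y = (if y \<le> x then f' x * g' y else 0)" for x y
  define R where "R x y = (if x < y then f' x * g' y else 0)" for x y
  have fin: "(\<integral>\<^sup>+x. \<integral>\<^sup>+y. ennreal \<bar>f' x * g' y\<bar> \<partial>lborel \<partial>lborel)
      \<le> ennreal ((\<integral>x. \<bar>f' x\<bar> \<partial>lborel) * (\<integral>x. \<bar>g' x\<bar> \<partial>lborel))"
  proof -
    have e: "(\<integral>\<^sup>+x. ennreal \<bar>f' x\<bar> \<partial>lborel) = ennreal (\<integral>x. \<bar>f' x\<bar> \<partial>lborel)"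
      "(\<integral>\<^sup>+x. ennreal \<bar>g' x\<bar> \<partial>lborel) = ennreal (\<integral>x. \<bar>g' x\<bar> \<partial>lborel)"
      using if' ig' by (intro nn_integral_eq_integral; simp)+
    have "(\<integral>\<^sup>+x. \<integral>\<^sup>+y. ennreal \<bar>f' x * g' y\<bar> \<partial>lborel \<partial>lborel)
       = (\<integral>\<^sup>+x. ennreal \<bar>f' x\<bar> \<partial>lborel) * (\<integral>\<^sup>+x. ennreal \<bar>g' x\<bar> \<partial>lborel)"
      by (simp add: abs_mult ennreal_mult nn_integral_cmult nn_integral_multc)
    then show ?thesis unfolding e by (simp add: ennreal_mult)
  qed
  have finP: "(\<integral>\<^sup>+x. \<integral>\<^sup>+y. ennreal \<bar>P x y\<bar> \<partial>lborel \<partial>lborel)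
      \<le> ennreal ((\<integral>x. \<bar>f' x\<bar> \<partial>lborel) * (\<integral>x. \<bar>g' x\<bar> \<partial>lborel))"
    by (rule order_trans[OF _ fin]) (intro nn_integral_mono, auto simp: P_def)
  have finR: "(\<integral>\<^sup>+x. \<integral>\<^sup>+y. ennreal \<bar>R x y\<bar> \<partial>lborel \<partial>lborel)
      \<le> ennreal ((\<integral>x. \<bar>f' x\<bar> \<partial>lborel) * (\<integral>x. \<bar>g' x\<bar> \<partial>lborel))"
    by (rule order_trans[OF _ fin]) (intro nn_integral_mono, auto simp: R_def)
  have mP: "case_prod P \<in> borel_measurable (borel \<Otimes>\<^sub>M borel)"
    unfolding P_def by measurable
  have mR: "case_prod R \<in> borel_measurable (borel \<Otimes>\<^sub>M borel)"
    unfolding R_def by measurable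
  note fubP = lborel_Fubini[OF mP finP] and fubR = lborel_Fubini[OF mR finR]
  have Pi: "(\<integral>y. P x y \<partial>lborel) = f' x * (G x - G 0)" for x
  proof (cases "0 \<le> x \<and> x \<le> T")
    case True
    have "(\<integral>y. P x y \<partial>lborel) = (\<integral>y. f' x * (indicator {0..x} y * g y) \<partial>lborel)"
      using True by (intro Bochner_Integration.integral_cong refl) (auto simp: P_def g'_def indicator_def)
    also have "\<dots> = f' x * (LBINT y:{0..x}. g y)"
      by (simp add: set_lebesgue_integral_def)
    also have "\<dots> = f' x * (G x - G 0)"
      using primitiveD(2)[OF G, of x] True by simp
    finally show ?thesis .
  next
    case False
    then have "f' x = 0" by (auto simp: f'_def)
    then show ?thesis by (simp add: P_def cong: if_cong)
  qed
  have Ri: "(\<integral>x. R x y \<partial>lborel) = g' y * (F y - F 0)" for y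
  proof (cases "0 \<le> y \<and> y \<le> T")
    case True
    have "(\<integral>x. R x y \<partial>lborel) = (\<integral>x. g' y * (indicator {0..y} x * f' x) \<partial>lborel)"
    proof (intro integral_cong_AE)
      show "AE x in lborel. R x y = g' y * (indicator {0..y} x * f' x)"
        using AE_lborel_singleton[of y] by eventually_elim (auto simp: R_def f'_def indicator_def)
    qed (auto simp: R_def)
    also have "\<dots> = (\<integral>x. g' y * (indicator {0..y} x * f x) \<partial>lborel)"
      using True by (intro Bochner_Integration.integral_cong refl) (auto simp: f'_def indicator_def)
    also have "\<dots> = g' y * (LBINT x:{0..y}. f x)"
      by (simp add: set_lebesgue_integral_def)
    also have "\<dots> = g' y * (F y - F 0)"
      using primitiveD(2)[OF F, of y] True by simp
    finally show ?thesis .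
  next
    case False
    then have "g' y = 0" by (auto simp: g'_def)
    then show ?thesis by (simp add: R_def cong: if_cong)
  qed
  have int1: "integrable lborel (\<lambda>x. f' x * (G x - G 0))"
    using fubP(2) by (simp only: Pi)
  have int2: "integrable lborel (\<lambda>x. g' x * (F x - F 0))"
    using fubR(3) by (simp only: Ri)
  have PR: "(\<integral>y. P x y \<partial>lborel) + (\<integral>y. R x y \<partial>lborel) = f' x * (\<integral>y. g' y \<partial>lborel)" for x
  proof -
    have "integrable lborel (\<lambda>y. P x y)" "integrable lborel (\<lambda>y. R x y)"
      by (rule Bochner_Integration.integrable_bound[OF integrable_mult_right[OF ig', of "f' x"]];
          auto simp: P_def R_def)+
    then have "(\<integral>y. P x y \<partial>lborel) + (\<integral>y. R x y \<partial>lborel) = (\<integral>y. P x y + R x y \<partial>lborel)"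
      by (rule Bochner_Integration.integral_add[symmetric])
    also have "\<dots> = (\<integral>y. f' x * g' y \<partial>lborel)"
      by (intro Bochner_Integration.integral_cong refl) (auto simp: P_def R_def)
    finally show ?thesis by simp
  qed
  have "(\<integral>x. f' x * (G x - G 0) \<partial>lborel) + (\<integral>x. g' x * (F x - F 0) \<partial>lborel)
     = (\<integral>x. \<integral>y. P x y \<partial>lborel \<partial>lborel) + (\<integral>x. \<integral>y. R x y \<partial>lborel \<partial>lborel)"
    by (simp only: Pi fubR(4)[symmetric] Ri)
  also have "\<dots> = (\<integral>x. f' x * (\<integral>y. g' y \<partial>lborel) \<partial>lborel)"
    by (subst Bochner_Integration.integral_add[symmetric, OF fubP(2) fubR(2)]) (simp only: PR)
  also have "\<dots> = (F T - F 0) * (G T - G 0)" by (simp add: IF IG)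
  finally have main: "(\<integral>x. f' x * (G x - G 0) \<partial>lborel) + (\<integral>x. g' x * (F x - F 0) \<partial>lborel)
     = (F T - F 0) * (G T - G 0)" .
  have eq: "indicator {0..T} x *\<^sub>R (f x * G x + F x * g x)
    = (f' x * (G x - G 0) + g' x * (F x - F 0)) + (G 0 * f' x + F 0 * g' x)" for x
    by (auto simp: f'_def g'_def indicator_def algebra_simps)
  have "integrable lborel (\<lambda>x. indicator {0..T} x *\<^sub>R (f x * G x + F x * g x))"
    unfolding eq using int1 int2 if' ig' by (intro Bochner_Integration.integrable_add integrable_mult_right)
  moreover have "(\<integral>x. indicator {0..T} x *\<^sub>R (f x * G x + F x * g x) \<partial>lborel)
    = (F T - F 0) * (G T - G 0) + (G 0 * (F T - F 0) + F 0 * (G T - G 0))"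
    unfolding eq using int1 int2 if' ig' by (simp add: main[symmetric] IF IG)
  ultimately show "set_integrable lborel {0..T} (\<lambda>t. f t * G t + F t * g t) \<and>
      F T * G T = F 0 * G 0 + (LBINT x:{0..T}. f x * G x + F x * g x)"
    by (simp add: set_integrable_def set_lebesgue_integral_def algebra_simps)
qed

lemma primitive_continuous:
  assumes "primitive F f"
  shows "continuous_on {0..} F"
proof -
  have "continuous_on {0..T} F" if T: "0 \<le> T" for T
  proof -
    have i: "set_integrable lborel {0..T} f" by (rule primitiveD(1)[OF assms T])
    have "f integrable_on {0..T}" using set_borel_integral_eq_integral(1)[OF i] .
    then have "continuous_on {0..T} (\<lambda>x. F 0 + integral {0..x} f)"
      by (intro continuous_intros indefinite_integral_continuous_1)
    moreover have "F 0 + integral {0..x} f = F x" if "x \<in> {0..T}" for x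
      using primitiveD[OF assms, of x] that set_borel_integral_eq_integral(2)[of "{0..x}" f] by auto
    ultimately show ?thesis by (rule continuous_on_eq)
  qed
  then have "isCont (\<lambda>t. F (max 0 t)) t" for t
  proof -
    have "continuous_on {..<\<bar>t\<bar> + 1} (\<lambda>t. F (max 0 t))"
      by (rule continuous_on_compose2[OF \<open>\<And>T. 0 \<le> T \<Longrightarrow> continuous_on {0..T} F\<close>[of "\<bar>t\<bar> + 1"]])
         (auto intro!: continuous_intros)
    then show ?thesis
      by (auto simp: continuous_on_eq_continuous_at)
  qed
  then have "continuous_on {0..} (\<lambda>t. F (max 0 t))" by (intro continuous_at_imp_continuous_on) auto
  then show ?thesis by (rule continuous_on_eq) auto
qed

lemma primitive_has_derivative:
  assumes "primitive F f" "continuous_on {0..} f" "0 \<le> t"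
  shows "(F has_real_derivative f t) (at t within {0..})"
proof -
  have c: "continuous_on {0..t+1} f" using assms(2) by (rule continuous_on_subset) auto
  have "((\<lambda>x. F 0 + integral {0..x} f) has_real_derivative f t) (at t within {0..t+1})"
    using integral_has_real_derivative[OF c, of t] assms(3) by (auto intro!: derivative_eq_intros)
  moreover have "F 0 + integral {0..x} f = F x" if "x \<in> {0..t+1}" for x
    using primitiveD[OF assms(1), of x] that set_borel_integral_eq_integral(2)[of "{0..x}" f] by auto
  ultimately have "(F has_real_derivative f t) (at t within {0..t+1})"
    using assms(3) by (subst has_field_derivative_cong_eventually[where g="\<lambda>x. F 0 + integral {0..x} f"])
      (auto simp: eventually_at_filter)
  moreover have "at t within {0..t+1} = at t within {0..}"
    by (rule at_within_nhd[of t "{..<t+1}"]) auto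
  ultimately show ?thesis by simp
qed

lemma primitive_zero_const:
  assumes "primitive F (\<lambda>t. 0)" "0 \<le> t" shows "F t = F 0"
  using primitiveD(2)[OF assms] by simp

lemma set_borel_measurable_halfline:
  fixes F :: "real \<Rightarrow> real"
  assumes "continuous_on {0..} F"
  shows "(\<lambda>t. indicator {0..} t * F t) \<in> borel_measurable borel"
  using borel_measurable_continuous_on_indicator[OF _ assms] by simp

lemma set_integrable_exp_halfline:
  assumes "a > 0"
  shows "set_integrable lborel {0..} (\<lambda>t. m * exp (- a * t) :: real)"
proof -
  have "integrable lborel (\<lambda>t. indicator {0..} t * exp (- a * t) :: real)"
  proof (rule integrableI_bounded)
    have "(\<integral>\<^sup>+ t. ennreal (norm (indicator {0..} t * exp (- a * t) :: real)) \<partial>lborel)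
      = (\<integral>\<^sup>+ t. ennreal (exp (- a * t)) * indicator {0..} t \<partial>lborel)"
      by (intro nn_integral_cong) (auto simp: indicator_def)
    also have "\<dots> < \<infinity>" using nn_integral_exp_atLeast[OF assms] by simp
    finally show "(\<integral>\<^sup>+ t. ennreal (norm (indicator {0..} t * exp (- a * t) :: real)) \<partial>lborel) < \<infinity>" .
  qed auto
  from integrable_mult_right[OF this, of m] show ?thesis
    by (simp add: set_integrable_def mult_ac)
qed

lemma set_integrable_const_Icc: "set_integrable lborel {a..b::real} (\<lambda>x. w :: real)"
proof -
  have "integrable lborel (indicat_real {a..b})"
    by (intro integrable_real_indicator) (auto simp: emeasure_lborel_Icc_eq)
  then show ?thesis by (simp add: set_integrable_def)
qed

lemma set_integral_le_superset:
  fixes f :: "real \<Rightarrow> real"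
  assumes "set_integrable lborel B f" "\<And>x. 0 \<le> f x" "A \<subseteq> B" "A \<in> sets borel"
  shows "(LBINT x:A. f x) \<le> (LBINT x:B. f x)"
proof -
  have "set_integrable lborel A f" using assms by (intro set_integrable_subset[OF assms(1)]) auto
  then show ?thesis
    using assms unfolding set_integrable_def set_lebesgue_integral_def
    by (intro integral_mono) (auto simp: indicator_def)
qed

text \<open>The Wronskian of the two solutions is a constant w. The derivative of f \<phi> is
2 h \<phi> + w with h \<phi> integrable, hence f \<phi> stays within a bounded distance of w t. As f \<phi>
itself is integrable, w = 0.\<close>

lemma decaying_solution_unique:
  assumes f: "primitive f h" and h: "primitive h (\<lambda>t. v t * f t)"
    and \<phi>: "primitive \<phi> \<psi>" and \<psi>: "primitive \<psi> (\<lambda>t. v t * \<phi> t)"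
    and fb: "\<And>t. 0 \<le> t \<Longrightarrow> \<bar>f t\<bar> \<le> M * exp (- t)" and hb: "\<And>t. 0 \<le> t \<Longrightarrow> \<bar>h t\<bar> \<le> M * exp (- t)"
    and L2: "set_integrable lborel {0..} (\<lambda>t. (\<phi> t)\<^sup>2)"
    and init: "f 0 = 1" "\<phi> 0 = 1"
  shows "\<psi> 0 = h 0"
proof -
  define w where "w = \<psi> 0 - h 0"
  have "primitive (\<lambda>t. f t * \<psi> t - h t * \<phi> t) (\<lambda>t. 0)"
    by (rule primitive_cong[OF primitive_diff[OF primitive_mult[OF f \<psi>] primitive_mult[OF h \<phi>]]])
       (auto simp: algebra_simps)
  from primitive_zero_const[OF this] have W: "f t * \<psi> t - h t * \<phi> t = w" if "0 \<le> t" for t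
    using that init by (simp add: w_def)
  have [measurable]: "(\<lambda>t. indicator {0..} t * f t) \<in> borel_measurable borel"
    "(\<lambda>t. indicator {0..} t * h t) \<in> borel_measurable borel"
    "(\<lambda>t. indicator {0..} t * \<phi> t) \<in> borel_measurable borel"
    using primitive_continuous[OF f] primitive_continuous[OF h] primitive_continuous[OF \<phi>]
    by (auto intro: set_borel_measurable_halfline)
  have prod: "set_integrable lborel {0..} (\<lambda>t. g t * \<phi> t)"
    if gm[measurable]: "(\<lambda>t. indicator {0..} t * g t) \<in> borel_measurable borel"
      and gb: "\<And>t. 0 \<le> t \<Longrightarrow> \<bar>g t\<bar> \<le> M * exp (- t)" for g
  proof -
    have "set_integrable lborel {0..} (\<lambda>t. M\<^sup>2 * exp (- 2 * t) + (\<phi> t)\<^sup>2)"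
      using set_integral_add(1)[OF set_integrable_exp_halfline[of 2 "M\<^sup>2"] L2] by simp
    then show ?thesis unfolding set_integrable_def
    proof (rule Bochner_Integration.integrable_bound)
      have "(\<lambda>t. (indicator {0..} t * g t) * (indicator {0..} t * \<phi> t)) \<in> borel_measurable lborel" by measurable
      also have "(\<lambda>t. (indicator {0..} t * g t) * (indicator {0..} t * \<phi> t)) = (\<lambda>t. indicat_real {0..} t *\<^sub>R (g t * \<phi> t))"
        by (auto simp: indicator_def fun_eq_iff)
      finally show "(\<lambda>t. indicat_real {0..} t *\<^sub>R (g t * \<phi> t)) \<in> borel_measurable lborel" .
      have "\<bar>g t * \<phi> t\<bar> \<le> M\<^sup>2 * exp (- 2 * t) + (\<phi> t)\<^sup>2" if "0 \<le> t" for t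
      proof -
        have "2 * (\<bar>g t\<bar> * \<bar>\<phi> t\<bar>) \<le> \<bar>g t\<bar>\<^sup>2 + (\<phi> t)\<^sup>2"
          using sum_squares_bound[of "\<bar>g t\<bar>" "\<bar>\<phi> t\<bar>"] by simp
        moreover have "\<bar>g t\<bar>\<^sup>2 \<le> (M * exp (- t))\<^sup>2" by (rule power_mono[OF gb[OF that]]) simp
        moreover have "(M * exp (- t))\<^sup>2 = M\<^sup>2 * exp (- 2 * t)"
          by (simp add: power_mult_distrib power2_eq_square exp_add[symmetric])
        moreover have "0 \<le> \<bar>g t\<bar> * \<bar>\<phi> t\<bar>" by simp
        ultimately show ?thesis unfolding abs_mult by linarith
      qed
      then show "AE t in lborel. norm (indicat_real {0..} t *\<^sub>R (g t * \<phi> t))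
          \<le> norm (indicat_real {0..} t *\<^sub>R (M\<^sup>2 * exp (- 2 * t) + (\<phi> t)\<^sup>2))"
        by (intro always_eventually allI) (auto simp: indicator_def)
    qed
  qed
  have hi: "set_integrable lborel {0..} (\<lambda>t. h t * \<phi> t)" and fi: "set_integrable lborel {0..} (\<lambda>t. f t * \<phi> t)"
    using hb fb by (auto intro: prod)
  \<comment> \<open>The distance of f \<phi> from w t.\<close>
  define R where "R = \<bar>f 0 * \<phi> 0\<bar> + 2 * (LBINT t:{0..}. \<bar>h t * \<phi> t\<bar>)"
  have S: "\<bar>f t * \<phi> t - w * t\<bar> \<le> R" if t: "0 \<le> t" for t
  proof -
    have hit: "set_integrable lborel {0..t} (\<lambda>t. h t * \<phi> t)"
      by (rule set_integrable_subset[OF hi]) auto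
    have "f t * \<phi> t = f 0 * \<phi> 0 + (LBINT x:{0..t}. h x * \<phi> x + f x * \<psi> x)"
      by (rule primitiveD(2)[OF primitive_mult[OF f \<phi>] t])
    also have "(LBINT x:{0..t}. h x * \<phi> x + f x * \<psi> x) = (LBINT x:{0..t}. 2 * (h x * \<phi> x) + w)"
    proof (rule set_lebesgue_integral_cong)
      show "\<forall>x. x \<in> {0..t} \<longrightarrow> h x * \<phi> x + f x * \<psi> x = 2 * (h x * \<phi> x) + w"
      proof (intro allI impI)
        fix x assume "x \<in> {0..t}"
        then show "h x * \<phi> x + f x * \<psi> x = 2 * (h x * \<phi> x) + w" using W[of x] by (simp add: algebra_simps)
      qed
    qed simp
    also have "\<dots> = 2 * (LBINT x:{0..t}. h x * \<phi> x) + w * t"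
    proof -
      have "(LBINT x:{0..t}. w) = w * t" using t by (simp add: set_lebesgue_integral_def)
      moreover have "set_integrable lborel {0..t} (\<lambda>x. w)" by (rule set_integrable_const_Icc)
      ultimately show ?thesis using hit by (subst set_integral_add) auto
    qed
    finally have "f t * \<phi> t - w * t = f 0 * \<phi> 0 + 2 * (LBINT x:{0..t}. h x * \<phi> x)" by simp
    moreover have "\<bar>LBINT x:{0..t}. h x * \<phi> x\<bar> \<le> (LBINT t:{0..}. \<bar>h t * \<phi> t\<bar>)"
    proof -
      have "\<bar>LBINT x:{0..t}. h x * \<phi> x\<bar> \<le> (LBINT x:{0..t}. \<bar>h x * \<phi> x\<bar>)"
        using set_integral_norm_bound[OF hit] by simp
      also have "\<dots> \<le> (LBINT t:{0..}. \<bar>h t * \<phi> t\<bar>)"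
        using set_integrable_abs[OF hi] by (intro set_integral_le_superset) auto
      finally show ?thesis .
    qed
    ultimately show ?thesis unfolding R_def by linarith
  qed
  show ?thesis
  proof (rule ccontr)
    assume "\<psi> 0 \<noteq> h 0"
    then have w: "\<bar>w\<bar> > 0" by (simp add: w_def)
    have R0: "0 \<le> R" using S[of 0] by linarith
    define t0 where "t0 = (R + 1) / \<bar>w\<bar>"
    have t0: "0 \<le> t0" using w R0 by (simp add: t0_def)
    have big: "1 \<le> \<bar>f t * \<phi> t\<bar>" if "t0 \<le> t" for t
    proof -
      have "R + 1 \<le> \<bar>w\<bar> * t" using that w by (simp add: t0_def field_simps)
      moreover have "\<bar>w * t\<bar> = \<bar>w\<bar> * t" using that t0 by (simp add: abs_mult)
      ultimately show ?thesis using S[of t] that t0 by linarith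
    qed
    define J where "J = (LBINT t:{0..}. \<bar>f t * \<phi> t\<bar>)"
    have J0: "0 \<le> J" unfolding J_def set_lebesgue_integral_def by (intro Bochner_Integration.integral_nonneg) auto
    have "J + 1 = (LBINT t:{t0..t0 + (J + 1)}. 1)" using J0 by (simp add: set_lebesgue_integral_def)
    also have "\<dots> \<le> (LBINT t:{t0..t0 + (J + 1)}. \<bar>f t * \<phi> t\<bar>)"
      using big t0 by (intro set_integral_mono set_integrable_const_Icc
          set_integrable_subset[OF set_integrable_abs[OF fi]]) auto
    also have "\<dots> \<le> J" unfolding J_def
      using set_integrable_abs[OF fi] t0 by (intro set_integral_le_superset) auto
    finally show False by simp
  qed
qed

section \<open>The differential equation for the Weyl solution\<close>

lemma set_integral_singleton [simp]: "(LBINT x:{a::real}. g x :: real) = 0"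
  unfolding set_lebesgue_integral_def
proof (rule integral_eq_zero_AE)
  show "AE x in lborel. indicat_real {a} x *\<^sub>R g x = 0"
    using AE_lborel_singleton[of a] by eventually_elim simp
qed

context bounded_wave_kernel
begin

text \<open>Splitting Green's function at x = t writes the Weyl solution as a combination of e^(-\<kappa> t) and
sinh(\<kappa> t) / \<kappa>, as in the method of variation of constants; \<open>weyl_inner\<close> and
\<open>weyl_outer\<close> are the coefficients.\<close>

definition weyl_inner :: "real \<Rightarrow> real \<Rightarrow> real" where
  "weyl_inner \<kappa> t = (LBINT x:{0..t}. Q x * (sinh (\<kappa> * x) / \<kappa> * weyl K \<kappa> x))"

definition weyl_outer :: "real \<Rightarrow> real \<Rightarrow> real" where
  "weyl_outer \<kappa> t = (\<integral>x. Q x * (exp (- \<kappa> * x) * weyl K \<kappa> x) \<partial>lborel)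
     - (LBINT x:{0..t}. Q x * (exp (- \<kappa> * x) * weyl K \<kappa> x))"

definition weyl_deriv :: "real \<Rightarrow> real \<Rightarrow> real" where
  "weyl_deriv \<kappa> t = - \<kappa> * exp (- \<kappa> * t) * (1 - weyl_inner \<kappa> t) - cosh (\<kappa> * t) * weyl_outer \<kappa> t"

lemma sinh_measurable [measurable]:
  assumes [measurable]: "f \<in> borel_measurable M"
  shows "(\<lambda>x. sinh (f x) :: real) \<in> borel_measurable M"
  unfolding sinh_field_def by measurable

lemma sinh_le_exp: "0 \<le> x \<Longrightarrow> sinh x \<le> exp (x::real)" "0 \<le> x \<Longrightarrow> 0 \<le> sinh (x::real)"
  using exp_ge_zero[of x] exp_ge_zero[of "-x"] unfolding sinh_field_def
  by (simp_all del: exp_ge_zero)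

lemma weyl_inner_props:
  assumes \<kappa>: "c + 2 \<le> \<kappa>" and t: "0 \<le> t"
  shows "set_integrable lborel {0..t} (\<lambda>x. Q x * (sinh (\<kappa> * x) / \<kappa> * weyl K \<kappa> x))"
    and "\<bar>weyl_inner \<kappa> t\<bar> \<le> (1 + B) * exp (c * t) * B"
proof -
  have \<kappa>1: "1 \<le> \<kappa>" "c + 1 \<le> \<kappa>" using \<kappa> c by auto
  have b: "\<bar>indicator {0..t} x * (sinh (\<kappa> * x) / \<kappa> * weyl K \<kappa> x)\<bar> \<le> (1 + B) * exp (c * t) * exp (- \<bar>t - x\<bar>)"
    if x: "0 \<le> x" for x
  proof (cases "x \<le> t")
    case True
    have "\<bar>sinh (\<kappa> * x) / \<kappa>\<bar> \<le> exp (\<kappa> * x)"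
      using sinh_le_exp[of "\<kappa> * x"] \<kappa>1 x by (simp add: divide_le_eq) (smt (verit) exp_ge_zero mult_right_mono mult_le_cancel_left1)
    then have "\<bar>sinh (\<kappa> * x) / \<kappa>\<bar> * \<bar>weyl K \<kappa> x\<bar> \<le> exp (\<kappa> * x) * ((1 + B) * exp (- (\<kappa> - c) * x))"
      using weyl_bound[OF \<kappa>1(2) x] by (intro mult_mono) auto
    also have "\<dots> = (1 + B) * exp (c * x)" by (simp add: exp_add[symmetric] algebra_simps)
    also have "\<dots> \<le> (1 + B) * (exp (c * t) * exp (- \<bar>t - x\<bar>))"
    proof -
      have "t - x \<le> c * (t - x)" using c True by (simp add: mult_le_cancel_right1)
      then show ?thesis using B_nonneg True by (intro mult_left_mono) (auto simp: exp_add[symmetric] algebra_simps)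
    qed
    finally show ?thesis using x True by (simp add: abs_mult mult_ac)
  qed (use B_nonneg in simp)
  have i: "integrable lborel (\<lambda>x. Q x * (indicator {0..t} x * (sinh (\<kappa> * x) / \<kappa> * weyl K \<kappa> x)))"
    "\<bar>\<integral>x. Q x * (indicator {0..t} x * (sinh (\<kappa> * x) / \<kappa> * weyl K \<kappa> x)) \<partial>lborel\<bar> \<le> (1 + B) * exp (c * t) * B"
    by (rule integrable_Q_exp[where t=t and m="(1 + B) * exp (c * t)"]; (use b B_nonneg in \<open>simp; fail\<close>)?; measurable)+
  then show "set_integrable lborel {0..t} (\<lambda>x. Q x * (sinh (\<kappa> * x) / \<kappa> * weyl K \<kappa> x))"
    "\<bar>weyl_inner \<kappa> t\<bar> \<le> (1 + B) * exp (c * t) * B"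
    by (simp_all add: set_integrable_def weyl_inner_def set_lebesgue_integral_def mult_ac)
qed

lemma weyl_exp_bound:
  assumes \<kappa>: "c + 2 \<le> \<kappa>" and t: "0 \<le> t" "t \<le> x"
  shows "\<bar>exp (- \<kappa> * x) * weyl K \<kappa> x\<bar> \<le> (1 + B) * exp (- (2 * \<kappa> - c) * t) * exp (- \<bar>t - x\<bar>)"
proof -
  have \<kappa>1: "1 \<le> \<kappa>" "c + 1 \<le> \<kappa>" using \<kappa> c by auto
  have "exp (- \<kappa> * x) * \<bar>weyl K \<kappa> x\<bar> \<le> exp (- \<kappa> * x) * ((1 + B) * exp (- (\<kappa> - c) * x))"
    using weyl_bound[OF \<kappa>1(2), of x] t by (intro mult_left_mono) auto
  also have "\<dots> = (1 + B) * exp (- (2 * \<kappa> - c) * x)" by (simp add: exp_add[symmetric] algebra_simps)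
  also have "\<dots> \<le> (1 + B) * (exp (- (2 * \<kappa> - c) * t) * exp (- \<bar>t - x\<bar>))"
  proof -
    have "x - t \<le> (2 * \<kappa> - c) * (x - t)" using \<kappa> c t by (simp add: mult_le_cancel_right1)
    then show ?thesis using B_nonneg t by (intro mult_left_mono) (auto simp: exp_add[symmetric] algebra_simps)
  qed
  finally show ?thesis by (simp add: abs_mult mult_ac)
qed

lemma weyl_outer_props:
  assumes \<kappa>: "c + 2 \<le> \<kappa>" and t: "0 \<le> t"
  shows "integrable lborel (\<lambda>x. Q x * (exp (- \<kappa> * x) * weyl K \<kappa> x))"
    and "weyl_outer \<kappa> t = (LBINT x:{t<..}. Q x * (exp (- \<kappa> * x) * weyl K \<kappa> x))"
    and "\<bar>weyl_outer \<kappa> t\<bar> \<le> (1 + B) * exp (- (2 * \<kappa> - c) * t) * B"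
proof -
  show i: "integrable lborel (\<lambda>x. Q x * (exp (- \<kappa> * x) * weyl K \<kappa> x))"
    by (rule integrable_Q_exp(1)[where t=0 and m="1 + B"])
       (use weyl_exp_bound[OF \<kappa>, of 0] B_nonneg in auto)
  have s: "set_integrable lborel A (\<lambda>x. Q x * (exp (- \<kappa> * x) * weyl K \<kappa> x))" if "A \<in> sets borel" for A
    using that unfolding set_integrable_def by (intro integrable_mult_indicator i) auto
  have "(\<integral>x. Q x * (exp (- \<kappa> * x) * weyl K \<kappa> x) \<partial>lborel) = (LBINT x:{0..}. Q x * (exp (- \<kappa> * x) * weyl K \<kappa> x))"
    unfolding set_lebesgue_integral_def
    by (intro Bochner_Integration.integral_cong refl) (auto simp: indicator_def Q_neg)
  also have "{0..} = {0..t} \<union> {t<..}" using t by auto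
  also have "(LBINT x:{0..t} \<union> {t<..}. Q x * (exp (- \<kappa> * x) * weyl K \<kappa> x))
     = (LBINT x:{0..t}. Q x * (exp (- \<kappa> * x) * weyl K \<kappa> x)) + (LBINT x:{t<..}. Q x * (exp (- \<kappa> * x) * weyl K \<kappa> x))"
    by (intro set_integral_Un s) auto
  finally show e: "weyl_outer \<kappa> t = (LBINT x:{t<..}. Q x * (exp (- \<kappa> * x) * weyl K \<kappa> x))"
    by (simp add: weyl_outer_def)
  have "\<bar>\<integral>x. Q x * (indicator {t<..} x * (exp (- \<kappa> * x) * weyl K \<kappa> x)) \<partial>lborel\<bar> \<le> (1 + B) * exp (- (2 * \<kappa> - c) * t) * B"
  proof (rule integrable_Q_exp(2)[where t=t])
    show "\<bar>indicator {t<..} x * (exp (- \<kappa> * x) * weyl K \<kappa> x)\<bar> \<le> (1 + B) * exp (- (2 * \<kappa> - c) * t) * exp (- \<bar>t - x\<bar>)" for x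
      using weyl_exp_bound[OF \<kappa> t, of x] B_nonneg by (cases "t < x") auto
  qed (use B_nonneg in auto)
  then show "\<bar>weyl_outer \<kappa> t\<bar> \<le> (1 + B) * exp (- (2 * \<kappa> - c) * t) * B"
    unfolding e by (simp add: set_lebesgue_integral_def mult_ac)
qed

lemma weyl_formula:
  assumes \<kappa>: "c + 2 \<le> \<kappa>" and t: "0 \<le> t"
  shows "weyl K \<kappa> t = exp (- \<kappa> * t) * (1 - weyl_inner \<kappa> t) - sinh (\<kappa> * t) / \<kappa> * weyl_outer \<kappa> t"
proof -
  have \<kappa>0: "0 < \<kappa>" using \<kappa> c by auto
  have i2: "set_integrable lborel {t<..} (\<lambda>x. Q x * (exp (- \<kappa> * x) * weyl K \<kappa> x))"
    unfolding set_integrable_def by (intro integrable_mult_indicator weyl_outer_props(1)[OF \<kappa> t]) auto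
  note i1 = weyl_inner_props(1)[OF \<kappa> t]
  have "Q x * (dgreen \<kappa> t x * weyl K \<kappa> x) = exp (- \<kappa> * t) * (indicator {0..t} x *\<^sub>R (Q x * (sinh (\<kappa> * x) / \<kappa> * weyl K \<kappa> x)))
      + sinh (\<kappa> * t) / \<kappa> * (indicator {t<..} x *\<^sub>R (Q x * (exp (- \<kappa> * x) * weyl K \<kappa> x)))" for x
  proof (cases "x < 0")
    case False
    have "dgreen \<kappa> t x = exp (- \<kappa> * t) * (sinh (\<kappa> * x) / \<kappa>)" if "x \<le> t"
      using that \<kappa>0 by (simp add: dgreen_def sinh_field_def exp_add[symmetric] algebra_simps diff_divide_distrib)
    moreover have "dgreen \<kappa> t x = exp (- \<kappa> * x) * (sinh (\<kappa> * t) / \<kappa>)" if "t < x"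
      using that \<kappa>0 by (simp add: dgreen_def sinh_field_def exp_add[symmetric] algebra_simps diff_divide_distrib)
    ultimately show ?thesis using False by (cases "x \<le> t") (auto simp: indicator_def)
  qed (simp add: Q_neg)
  then have "(\<integral>x. Q x * (dgreen \<kappa> t x * weyl K \<kappa> x) \<partial>lborel) =
     exp (- \<kappa> * t) * weyl_inner \<kappa> t + sinh (\<kappa> * t) / \<kappa> * weyl_outer \<kappa> t"
    using i1 i2 unfolding weyl_outer_props(2)[OF \<kappa> t] weyl_inner_def set_integrable_def set_lebesgue_integral_def
    by (simp only: Bochner_Integration.integral_add integrable_mult_right integral_mult_right_zero)
  then show ?thesis using weyl_green[OF \<kappa> t] by (simp add: algebra_simps)
qed

text \<open>Variation of constants: in the first derivative the terms with Q cancel, and in the second they add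
up to Q times the solution because sinh + cosh = exp.\<close>

lemma primitive_weyl:
  assumes \<kappa>: "c + 2 \<le> \<kappa>"
  shows "primitive (weyl K \<kappa>) (weyl_deriv \<kappa>)"
    and "primitive (weyl_deriv \<kappa>) (\<lambda>t. (\<kappa>\<^sup>2 + Q t) * weyl K \<kappa> t)"
proof -
  have \<kappa>0: "0 < \<kappa>" using \<kappa> c by auto
  let ?f = "weyl K \<kappa>"
  have X: "primitive (weyl_inner \<kappa>) (\<lambda>x. Q x * (sinh (\<kappa> * x) / \<kappa> * ?f x))"
    unfolding primitive_def
    using weyl_inner_props(1)[OF \<kappa>] by (auto simp: weyl_inner_def set_integral_singleton)
  have Y: "primitive (weyl_outer \<kappa>) (\<lambda>x. - 1 * (Q x * (exp (- \<kappa> * x) * ?f x)))"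
    unfolding primitive_def
  proof (intro allI impI conjI)
    fix t :: real assume "0 \<le> t"
    show "set_integrable lborel {0..t} (\<lambda>x. - 1 * (Q x * (exp (- \<kappa> * x) * ?f x)))"
      unfolding set_integrable_def
      by (intro integrable_mult_indicator integrable_mult_right weyl_outer_props(1)[OF \<kappa>, of 0]) auto
    show "weyl_outer \<kappa> t = weyl_outer \<kappa> 0 + (LBINT x:{0..t}. - 1 * (Q x * (exp (- \<kappa> * x) * ?f x)))"
      by (simp add: weyl_outer_def) (simp add: set_lebesgue_integral_def)
  qed
  have E: "primitive (\<lambda>t. exp (- \<kappa> * t)) (\<lambda>t. - \<kappa> * exp (- \<kappa> * t))"
    by (rule primitive_C1) (auto intro!: derivative_eq_intros continuous_intros)
  have S: "primitive (\<lambda>t. sinh (\<kappa> * t) / \<kappa>) (\<lambda>t. cosh (\<kappa> * t))"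
    by (rule primitive_C1) (use \<kappa>0 in \<open>auto intro!: derivative_eq_intros continuous_intros\<close>)
  have C: "primitive (\<lambda>t. cosh (\<kappa> * t)) (\<lambda>t. \<kappa> * sinh (\<kappa> * t))"
    by (rule primitive_C1) (auto intro!: derivative_eq_intros continuous_intros)
  have X1: "primitive (\<lambda>t. 1 - weyl_inner \<kappa> t) (\<lambda>x. 0 - Q x * (sinh (\<kappa> * x) / \<kappa> * ?f x))"
    by (rule primitive_diff[OF primitive_const X])
  have es: "exp (- \<kappa> * t) * (sinh (\<kappa> * t) / \<kappa> * y) * \<kappa> + cosh (\<kappa> * t) * (exp (- \<kappa> * t) * y) = y" for t y
  proof -
    have "exp (- \<kappa> * t) * (sinh (\<kappa> * t) / \<kappa> * y) * \<kappa> + cosh (\<kappa> * t) * (exp (- \<kappa> * t) * y)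
       = exp (- \<kappa> * t) * (sinh (\<kappa> * t) + cosh (\<kappa> * t)) * y"
      using \<kappa>0 by (simp add: field_simps)
    also have "sinh (\<kappa> * t) + cosh (\<kappa> * t) = exp (\<kappa> * t)"
      by (simp add: sinh_plus_cosh)
    finally show ?thesis by (simp add: exp_add[symmetric])
  qed
  show 1: "primitive ?f (weyl_deriv \<kappa>)"
    by (rule primitive_cong[OF primitive_diff[OF primitive_mult[OF E X1] primitive_mult[OF S Y]]])
       (simp_all add: weyl_formula[OF \<kappa>] weyl_deriv_def algebra_simps)
  have "primitive (weyl_deriv \<kappa>) (\<lambda>t. (- \<kappa>) * (- \<kappa> * exp (- \<kappa> * t) * (1 - weyl_inner \<kappa> t)
       + exp (- \<kappa> * t) * (0 - Q t * (sinh (\<kappa> * t) / \<kappa> * ?f t)))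
       - (\<kappa> * sinh (\<kappa> * t) * weyl_outer \<kappa> t + cosh (\<kappa> * t) * (- 1 * (Q t * (exp (- \<kappa> * t) * ?f t)))))"
    by (rule primitive_cong[OF primitive_diff[OF primitive_cmult[OF primitive_mult[OF E X1], of "-\<kappa>"] primitive_mult[OF C Y]]])
       (simp_all add: weyl_deriv_def)
  then show "primitive (weyl_deriv \<kappa>) (\<lambda>t. (\<kappa>\<^sup>2 + Q t) * ?f t)"
  proof (rule primitive_cong)
    fix t :: real assume t: "0 \<le> t"
    have "\<kappa>\<^sup>2 * ?f t = \<kappa>\<^sup>2 * (exp (- \<kappa> * t) * (1 - weyl_inner \<kappa> t)) - \<kappa> * sinh (\<kappa> * t) * weyl_outer \<kappa> t"
      unfolding weyl_formula[OF \<kappa> t] using \<kappa>0 by (simp add: power2_eq_square field_simps)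
    moreover have "Q t * ?f t = exp (- \<kappa> * t) * (sinh (\<kappa> * t) / \<kappa> * (Q t * ?f t)) * \<kappa>
        + cosh (\<kappa> * t) * (exp (- \<kappa> * t) * (Q t * ?f t))"
      using es[of t "Q t * ?f t"] by simp
    ultimately show "(- \<kappa>) * (- \<kappa> * exp (- \<kappa> * t) * (1 - weyl_inner \<kappa> t)
       + exp (- \<kappa> * t) * (0 - Q t * (sinh (\<kappa> * t) / \<kappa> * ?f t)))
       - (\<kappa> * sinh (\<kappa> * t) * weyl_outer \<kappa> t + cosh (\<kappa> * t) * (- 1 * (Q t * (exp (- \<kappa> * t) * ?f t))))
       = (\<kappa>\<^sup>2 + Q t) * ?f t"
      by (simp add: algebra_simps power2_eq_square)
  qed simp
qed

lemma weyl_initial: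
  assumes \<kappa>: "c + 2 \<le> \<kappa>"
  shows "weyl K \<kappa> 0 = 1"
    and "weyl_deriv \<kappa> 0 = - \<kappa> - (\<integral>\<sigma>. response Q K \<sigma> * exp (- 2 * \<kappa> * \<sigma>) \<partial>lborel)"
proof -
  have z: "weyl_inner \<kappa> 0 = 0" "weyl_outer \<kappa> 0 = (\<integral>x. Q x * (exp (- \<kappa> * x) * weyl K \<kappa> x) \<partial>lborel)"
    by (simp_all add: weyl_inner_def weyl_outer_def set_integral_singleton)
  show "weyl K \<kappa> 0 = 1" using weyl_formula[OF \<kappa>, of 0] z by simp
  show "weyl_deriv \<kappa> 0 = - \<kappa> - (\<integral>\<sigma>. response Q K \<sigma> * exp (- 2 * \<kappa> * \<sigma>) \<partial>lborel)"
    unfolding response_laplace(2)[OF \<kappa>] by (simp add: weyl_deriv_def z)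
qed

lemma weyl_decay:
  assumes \<kappa>: "c + 2 \<le> \<kappa>"
  shows "\<exists>M. \<forall>t\<ge>0. \<bar>weyl K \<kappa> t\<bar> \<le> M * exp (- t) \<and> \<bar>weyl_deriv \<kappa> t\<bar> \<le> M * exp (- t)"
proof (intro exI allI impI conjI)
  fix t :: real assume t: "0 \<le> t"
  define D where "D = (1 + B) * B"
  define M where "M = \<kappa> * (1 + D) + D + (1 + B)"
  have \<kappa>1: "1 \<le> \<kappa>" "c + 1 \<le> \<kappa>" using \<kappa> c by auto
  have D: "0 \<le> D" using B_nonneg by (simp add: D_def)
  have e1: "exp (- (\<kappa> - c) * t) \<le> exp (- t)" using \<kappa> t mult_right_mono[of 1 "\<kappa> - c" t] by (simp add: algebra_simps)
  have "\<bar>weyl K \<kappa> t\<bar> \<le> (1 + B) * exp (- t)"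
    using weyl_bound[OF \<kappa>1(2) t] mult_left_mono[OF e1, of "1 + B"] B_nonneg by linarith
  also have "\<dots> \<le> M * exp (- t)" using \<kappa>1 D by (intro mult_right_mono) (auto simp: M_def)
  finally show "\<bar>weyl K \<kappa> t\<bar> \<le> M * exp (- t)" .
  have a: "\<bar>- \<kappa> * exp (- \<kappa> * t) * (1 - weyl_inner \<kappa> t)\<bar> \<le> \<kappa> * (1 + D) * exp (- t)"
  proof -
    have ec: "1 \<le> exp (c * t)" using c t by simp
    have "\<bar>1 - weyl_inner \<kappa> t\<bar> \<le> 1 + D * exp (c * t)"
      using weyl_inner_props(2)[OF \<kappa> t] by (simp add: D_def mult_ac)
    also have "\<dots> \<le> (1 + D) * exp (c * t)" using ec by (simp add: ring_distribs)
    finally have "\<kappa> * exp (- \<kappa> * t) * \<bar>1 - weyl_inner \<kappa> t\<bar> \<le> \<kappa> * exp (- \<kappa> * t) * ((1 + D) * exp (c * t))"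
      using \<kappa>1 by (intro mult_left_mono) auto
    also have "\<dots> = \<kappa> * (1 + D) * exp (- (\<kappa> - c) * t)" by (simp add: exp_add[symmetric] algebra_simps)
    also have "\<dots> \<le> \<kappa> * (1 + D) * exp (- t)" using e1 \<kappa>1 D by (intro mult_left_mono) auto
    finally show ?thesis using \<kappa>1 by (simp add: abs_mult)
  qed
  have b: "\<bar>cosh (\<kappa> * t) * weyl_outer \<kappa> t\<bar> \<le> D * exp (- t)"
  proof -
    have "\<bar>cosh (\<kappa> * t)\<bar> \<le> exp (\<kappa> * t)" using \<kappa>1 t by (simp add: cosh_field_def)
    then have "\<bar>cosh (\<kappa> * t)\<bar> * \<bar>weyl_outer \<kappa> t\<bar> \<le> exp (\<kappa> * t) * ((1 + B) * exp (- (2 * \<kappa> - c) * t) * B)"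
      using weyl_outer_props(3)[OF \<kappa> t] by (intro mult_mono) auto
    also have "\<dots> = D * exp (- (\<kappa> - c) * t)" by (simp add: D_def exp_add[symmetric] algebra_simps)
    also have "\<dots> \<le> D * exp (- t)" using e1 D by (intro mult_left_mono) auto
    finally show ?thesis by (simp add: abs_mult)
  qed
  have "\<bar>weyl_deriv \<kappa> t\<bar> \<le> (\<kappa> * (1 + D) + D) * exp (- t)"
    using a b unfolding weyl_deriv_def ring_distribs by linarith
  also have "\<dots> \<le> M * exp (- t)" using B_nonneg by (intro mult_right_mono) (auto simp: M_def)
  finally show "\<bar>weyl_deriv \<kappa> t\<bar> \<le> M * exp (- t)" .
qed

end

section \<open>Local stability of the potential in terms of its response function\<close>

abbreviation L1_upto :: "real \<Rightarrow> (real \<Rightarrow> real) \<Rightarrow> ennreal" where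
  "L1_upto \<sigma> f \<equiv> \<integral>\<^sup>+x. ennreal \<bar>f x\<bar> * indicator {0..\<sigma>} x \<partial>lborel"

text \<open>Finite speed of propagation: for t + s \<le> 2 \<sigma>, Duhamel's integral only involves sources
(x, y) with x + y \<le> 2 \<sigma> and 0 \<le> x \<le> \<sigma>.\<close>

lemma wave_step_local:
  assumes Qm[measurable]: "Q \<in> borel_measurable borel"
    and A: "L1_upto \<sigma> Q \<le> ennreal A" "0 \<le> A"
    and H: "borel2 H"
    and supp: "\<And>x y. H x y \<noteq> 0 \<Longrightarrow> 0 \<le> x \<and> x \<le> y"
    and bd: "\<And>x y. x + y \<le> 2 * \<sigma> \<Longrightarrow> \<bar>H x y\<bar> \<le> m * exp (c * y)"
    and m: "0 \<le> m" and c: "0 < c" and ts: "t + s \<le> 2 * \<sigma>"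
  shows "\<bar>wave_step Q H t s\<bar> \<le> m * A / (2 * c) * exp (c * s)"
proof -
  note [measurable] = measurable_curried[OF H]
  have dom: "\<bar>Q x * H x y\<bar> \<le> m * (\<bar>Q x\<bar> * indicator {0..\<sigma>} x) * exp (c * y)" if "dwave t x (s - y) \<noteq> 0" for x y
  proof (cases "H x y = 0")
    case False
    then have "0 \<le> x" "x \<le> y" "\<bar>t - x\<bar> \<le> s - y" using supp that by (auto dest: dwave_nonzeroD)
    then have "x + y \<le> 2 * \<sigma>" "x \<in> {0..\<sigma>}" using ts by auto
    then show ?thesis
      using mult_left_mono[OF bd[of x y], of "\<bar>Q x\<bar>"] by (simp add: abs_mult mult_ac)
  qed (use m in simp)
  have "(\<integral>\<^sup>+w. ennreal \<bar>Q (fst w) * H (fst w) (snd w) * dwave t (fst w) (s - snd w)\<bar> \<partial>lborel)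
     \<le> ennreal (m * exp (c * s) / (2 * c)) * (\<integral>\<^sup>+x. ennreal (\<bar>Q x\<bar> * indicator {0..\<sigma>} x * exp (- (c * \<bar>t - x\<bar>))) \<partial>lborel)"
    by (rule nn_integral_wave_step[OF Qm _ H _ c m dom]) auto
  also have "\<dots> \<le> ennreal (m * exp (c * s) / (2 * c)) * L1_upto \<sigma> Q"
  proof (intro mult_left_mono nn_integral_mono)
    fix x
    have "\<bar>Q x\<bar> * exp (- (c * \<bar>t - x\<bar>)) \<le> \<bar>Q x\<bar>" using c by (intro mult_left_le) auto
    then show "ennreal (\<bar>Q x\<bar> * indicator {0..\<sigma>} x * exp (- (c * \<bar>t - x\<bar>))) \<le> ennreal \<bar>Q x\<bar> * indicator {0..\<sigma>} x"
      by (cases "x \<in> {0..\<sigma>}") (auto intro: ennreal_leI)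
  qed auto
  also have "\<dots> \<le> ennreal (m * exp (c * s) / (2 * c)) * ennreal A"
    using A by (intro mult_left_mono) auto
  also have "\<dots> = ennreal (m * A / (2 * c) * exp (c * s))"
    using A m c by (simp add: ennreal_mult'[symmetric] mult_ac)
  finally have *: "(\<integral>\<^sup>+w. ennreal \<bar>Q (fst w) * H (fst w) (snd w) * dwave t (fst w) (s - snd w)\<bar> \<partial>lborel)
     \<le> ennreal (m * A / (2 * c) * exp (c * s))" .
  have "(\<lambda>w. Q (fst w) * H (fst w) (snd w) * dwave t (fst w) (s - snd w)) \<in> borel_measurable lborel"
    by measurable
  from integral_abs_le_nn_bound(2)[OF this *] show ?thesis
    using A m c by (simp add: wave_step_def)
qed

lemma wave0_local:
  assumes Qm[measurable]: "Q \<in> borel_measurable borel" and Q0: "\<And>x. x < 0 \<Longrightarrow> Q x = 0"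
    and A: "L1_upto \<sigma> Q \<le> ennreal A" "0 \<le> A"
    and ts: "t + s \<le> 2 * \<sigma>"
  shows "\<bar>wave0 Q t s\<bar> \<le> A / 2"
proof -
  have "(\<integral>\<^sup>+x. ennreal \<bar>Q x * dwave t x (s - x)\<bar> \<partial>lborel)
     \<le> (\<integral>\<^sup>+x. ennreal (1/2) * (ennreal \<bar>Q x\<bar> * indicator {0..\<sigma>} x) \<partial>lborel)"
  proof (intro nn_integral_mono)
    fix x
    show "ennreal \<bar>Q x * dwave t x (s - x)\<bar> \<le> ennreal (1/2) * (ennreal \<bar>Q x\<bar> * indicator {0..\<sigma>} x)"
    proof (cases "Q x = 0 \<or> dwave t x (s - x) = 0")
      case True
      then have "Q x * dwave t x (s - x) = 0" by auto
      then show ?thesis by (simp only: abs_zero ennreal_0 zero_le)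
    next
      case False
      then have "0 \<le> x" "\<bar>t - x\<bar> \<le> s - x" using Q0[of x] by (auto dest: dwave_nonzeroD simp: not_less[symmetric])
      then have "x \<in> {0..\<sigma>}" using ts by auto
      moreover have "\<bar>Q x * dwave t x (s - x)\<bar> \<le> 1/2 * \<bar>Q x\<bar>"
        using mult_left_mono[OF dwave_le_half[of t x "s - x"], of "\<bar>Q x\<bar>"] by (simp add: abs_mult)
      ultimately show ?thesis by (simp add: ennreal_mult'[symmetric] ennreal_leI del: ennreal_half)
    qed
  qed
  also have "\<dots> \<le> ennreal (1/2) * ennreal A"
    using A by (subst nn_integral_cmult) (auto intro!: mult_left_mono)
  also have "\<dots> = ennreal (A / 2)" using A by (simp add: ennreal_mult'[symmetric] del: ennreal_half)
  finally have *: "(\<integral>\<^sup>+x. ennreal \<bar>Q x * dwave t x (s - x)\<bar> \<partial>lborel) \<le> ennreal (A / 2)" .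
  show ?thesis using integral_abs_le_nn_bound(2)[OF _ *] A by (simp add: wave0_def)
qed

text \<open>Iterating the inequality from a bound m0 halves the influence of m0 every time, so that in the limit only
\<alpha> remains. This is what makes the constants of the stability estimate depend on Q only through its L^1 norm on a finite interval.\<close>

lemma wave_local_contraction:
  assumes Qm: "Q \<in> borel_measurable borel"
    and A: "L1_upto \<sigma> Q \<le> ennreal A" "0 \<le> A"
    and H: "borel2 H"
    and supp: "\<And>x y. H x y \<noteq> 0 \<Longrightarrow> 0 \<le> x \<and> x \<le> y"
    and bd0: "\<And>x y. x + y \<le> 2 * \<sigma> \<Longrightarrow> \<bar>H x y\<bar> \<le> m0"
    and \<alpha>: "0 \<le> \<alpha>" and c: "0 < c" "A \<le> c"
    and eq: "\<And>t s. 0 \<le> t \<Longrightarrow> t \<le> s \<Longrightarrow> t + s \<le> 2 * \<sigma> \<Longrightarrow>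
        \<bar>H t s\<bar> \<le> \<alpha> * exp (c * s) + \<bar>wave_step Q H t s\<bar>"
    and ts: "t + s \<le> 2 * \<sigma>"
  shows "\<bar>H t s\<bar> \<le> 2 * \<alpha> * exp (c * s)"
proof -
  define m where "m = max 0 m0"
  have m: "0 \<le> m" by (simp add: m_def)
  have bound: "\<bar>H t s\<bar> \<le> (2 * \<alpha> + m * (1/2) ^ n) * exp (c * s)" if "t + s \<le> 2 * \<sigma>" for n t s
    using that
  proof (induction n arbitrary: t s)
    case 0
    show ?case
    proof (cases "H t s = 0")
      case False
      then have "0 \<le> s" using supp[of t s] by linarith
      then have "1 \<le> exp (c * s)" using c by simp
      moreover have "\<bar>H t s\<bar> \<le> m" using bd0[OF 0] by (simp add: m_def)
      ultimately have "\<bar>H t s\<bar> \<le> m * exp (c * s)" using m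
        by (metis mult.right_neutral mult_left_mono order_trans)
      also have "\<dots> \<le> (2 * \<alpha> + m * (1/2) ^ 0) * exp (c * s)" using \<alpha> by (intro mult_right_mono) auto
      finally show ?thesis .
    qed (use \<alpha> m in simp)
  next
    case (Suc n)
    show ?case
    proof (cases "H t s = 0")
      case False
      let ?m = "2 * \<alpha> + m * (1/2) ^ n"
      have m': "0 \<le> ?m" using \<alpha> m by simp
      have "\<bar>wave_step Q H t s\<bar> \<le> ?m * A / (2 * c) * exp (c * s)"
        by (rule wave_step_local[OF Qm A H supp Suc.IH m' c(1) Suc.prems])
      also have "\<dots> \<le> ?m * (1/2) * exp (c * s)"
      proof -
        have "A / (2 * c) \<le> 1/2" using c by (simp add: field_simps)
        from mult_left_mono[OF this m'] show ?thesis by (intro mult_right_mono) auto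
      qed
      finally have "\<bar>H t s\<bar> \<le> \<alpha> * exp (c * s) + ?m * (1/2) * exp (c * s)"
        using eq[of t s] supp[OF False] Suc.prems by linarith
      also have "\<dots> = (2 * \<alpha> + m * (1/2) ^ Suc n) * exp (c * s)" by (simp add: algebra_simps)
      finally show ?thesis .
    qed (use \<alpha> m in simp)
  qed
  have "(\<lambda>n. (2 * \<alpha> + m * (1/2) ^ n) * exp (c * s)) \<longlonglongrightarrow> (2 * \<alpha> + m * 0) * exp (c * s)"
    by (intro tendsto_intros LIMSEQ_power_zero) auto
  then have "\<bar>H t s\<bar> \<le> (2 * \<alpha> + m * 0) * exp (c * s)"
    by (rule LIMSEQ_le_const) (use bound[OF ts] in blast)
  then show ?thesis by simp
qed

lemma (in bounded_wave_kernel) K_bounded_local: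
  assumes "0 \<le> \<sigma>" "t + s \<le> 2 * \<sigma>"
  shows "\<bar>K t s\<bar> \<le> B * exp (c * (2 * \<sigma>))"
proof (cases "K t s = 0")
  case False
  then have "s \<le> 2 * \<sigma>" using K_support[of t s] assms by auto
  then have "B * exp (c * s) \<le> B * exp (c * (2 * \<sigma>))"
    using B_nonneg c by (intro mult_left_mono) auto
  then show ?thesis using Kb[of t s] by linarith
qed (use B_nonneg in simp)

text \<open>The kernel satisfies Duhamel's equation, whose inhomogeneity is at most A / 2 in the triangle.\<close>

lemma (in bounded_wave_kernel) K_local:
  assumes A: "L1_upto \<sigma> Q \<le> ennreal A" "0 \<le> A"
    and \<gamma>: "0 < \<gamma>" "A \<le> \<gamma>" and \<sigma>: "0 \<le> \<sigma>" and ts: "t + s \<le> 2 * \<sigma>"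
  shows "\<bar>K t s\<bar> \<le> A * exp (\<gamma> * s)"
proof -
  have "\<bar>K t s\<bar> \<le> 2 * (A / 2) * exp (\<gamma> * s)"
  proof (rule wave_local_contraction[OF Q_measurable A K_measurable K_support K_bounded_local _ \<gamma> _ ts])
    fix t s :: real assume *: "0 \<le> t" "t \<le> s" "t + s \<le> 2 * \<sigma>"
    have "\<bar>wave0 Q t s\<bar> \<le> A / 2" by (rule wave0_local[OF Q_measurable Q_neg A *(3)])
    also have "\<dots> \<le> A / 2 * exp (\<gamma> * s)" using A(2) \<gamma> * by (simp add: mult_le_cancel_left1)
    finally show "\<bar>K t s\<bar> \<le> A / 2 * exp (\<gamma> * s) + \<bar>wave_step Q K t s\<bar>"
      using K_eq[of t s] by linarith
  qed (use A \<sigma> in auto)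
  then show ?thesis by simp
qed

text \<open>The difference of the kernels satisfies Duhamel's equation for Q1 with an inhomogeneity that is linear in
Q1 - Q2: the pulse and the kernel K2, both scattered by Q1 - Q2.\<close>

lemma two_kernel_difference:
  assumes k1: "bounded_wave_kernel Q1 B1 K1 c1" and k2: "bounded_wave_kernel Q2 B2 K2 c2"
    and A1: "L1_upto \<sigma> Q1 \<le> ennreal A"
    and A2: "L1_upto \<sigma> Q2 \<le> ennreal A" "0 \<le> A"
    and \<eta>: "L1_upto \<sigma> (\<lambda>x. Q1 x - Q2 x) \<le> ennreal \<eta>" "0 \<le> \<eta>"
    and \<gamma>: "0 < \<gamma>" "A \<le> \<gamma>" and \<sigma>: "0 \<le> \<sigma>" and ts: "t + s \<le> 2 * \<sigma>"
  shows "\<bar>K1 t s - K2 t s\<bar> \<le> 2 * \<eta> * exp (\<gamma> * s)"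
proof -
  interpret k1: bounded_wave_kernel Q1 B1 K1 c1 by fact
  interpret k2: bounded_wave_kernel Q2 B2 K2 c2 by fact
  have Dm: "(\<lambda>z. K1 (fst z) (snd z) - K2 (fst z) (snd z)) \<in> borel_measurable borel"
    using k1.K_measurable k2.K_measurable by measurable
  show ?thesis
  proof (rule wave_local_contraction[where Q=Q1 and H="\<lambda>t s. K1 t s - K2 t s", OF k1.Q_measurable A1 A2(2) Dm])
    show "0 \<le> x \<and> x \<le> y" if "K1 x y - K2 x y \<noteq> 0" for x y
      using that k1.K_support[of x y] k2.K_support[of x y] by (cases "K1 x y = 0") auto
    show "\<bar>K1 x y - K2 x y\<bar> \<le> B1 * exp (c1 * (2 * \<sigma>)) + B2 * exp (c2 * (2 * \<sigma>))" if "x + y \<le> 2 * \<sigma>" for x y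
      using k1.K_bounded_local[OF \<sigma> that] k2.K_bounded_local[OF \<sigma> that] by linarith
    fix t s :: real assume *: "0 \<le> t" "t \<le> s" "t + s \<le> 2 * \<sigma>"
    have i1: "integrable lborel (\<lambda>w. Q1 (fst w) * K1 (fst w) (snd w) * dwave t (fst w) (s - snd w))"
      by (rule wave_step_integrable(1)[OF k1.Q k1.c k1.B_nonneg k1.K_measurable k1.Kb])
    have i2: "integrable lborel (\<lambda>w. Q2 (fst w) * K2 (fst w) (snd w) * dwave t (fst w) (s - snd w))"
      by (rule wave_step_integrable(1)[OF k2.Q k2.c k2.B_nonneg k2.K_measurable k2.Kb])
    have i12: "integrable lborel (\<lambda>w. Q1 (fst w) * K2 (fst w) (snd w) * dwave t (fst w) (s - snd w))"
      by (rule wave_step_integrable(1)[OF k1.Q k2.c k2.B_nonneg k2.K_measurable k2.Kb])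
    have s1: "wave_step Q1 (\<lambda>t s. K1 t s - K2 t s) t s = wave_step Q1 K1 t s - wave_step Q1 K2 t s"
      unfolding wave_step_def using Bochner_Integration.integral_diff[OF i1 i12] by (simp add: algebra_simps)
    have s2: "wave_step (\<lambda>x. Q1 x - Q2 x) K2 t s = wave_step Q1 K2 t s - wave_step Q2 K2 t s"
      unfolding wave_step_def using Bochner_Integration.integral_diff[OF i12 i2] by (simp add: algebra_simps)
    have s0: "wave0 (\<lambda>x. Q1 x - Q2 x) t s = wave0 Q1 t s - wave0 Q2 t s"
      unfolding wave0_def
      using Bochner_Integration.integral_diff[OF wave0_bound(2)[OF k1.Q k1.c, of t s] wave0_bound(2)[OF k2.Q k2.c, of t s]]
      by (simp add: algebra_simps)
    have e1: "1 \<le> exp (\<gamma> * s)" using * \<gamma> by simp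
    have qm: "(\<lambda>x. Q1 x - Q2 x) \<in> borel_measurable borel" by measurable
    have b0: "\<bar>wave0 (\<lambda>x. Q1 x - Q2 x) t s\<bar> \<le> \<eta> / 2"
      by (rule wave0_local[OF qm _ \<eta> *(3)]) (simp add: k1.Q_neg k2.Q_neg)
    also have "\<dots> \<le> \<eta> / 2 * exp (\<gamma> * s)" using e1 \<eta>(2) by (simp add: mult_le_cancel_left1)
    finally have b0: "\<bar>wave0 (\<lambda>x. Q1 x - Q2 x) t s\<bar> \<le> \<eta> / 2 * exp (\<gamma> * s)" .
    have b1: "\<bar>wave_step (\<lambda>x. Q1 x - Q2 x) K2 t s\<bar> \<le> A * \<eta> / (2 * \<gamma>) * exp (\<gamma> * s)"
      by (rule wave_step_local[OF qm \<eta> k2.K_measurable k2.K_support k2.K_local[OF A2 \<gamma> \<sigma>] A2(2) \<gamma>(1) *(3)])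
    also have "\<dots> \<le> \<eta> / 2 * exp (\<gamma> * s)"
    proof (rule mult_right_mono)
      have "A / \<gamma> \<le> 1" using \<gamma> by (simp add: divide_le_eq)
      from mult_left_mono[OF this, of "\<eta> / 2"] \<eta>(2) show "A * \<eta> / (2 * \<gamma>) \<le> \<eta> / 2" by (simp add: mult_ac)
    qed simp
    finally have b1: "\<bar>wave_step (\<lambda>x. Q1 x - Q2 x) K2 t s\<bar> \<le> \<eta> / 2 * exp (\<gamma> * s)" .
    have "K1 t s - K2 t s = wave0 (\<lambda>x. Q1 x - Q2 x) t s + wave_step (\<lambda>x. Q1 x - Q2 x) K2 t s
        + wave_step Q1 (\<lambda>t s. K1 t s - K2 t s) t s"
      using k1.K_eq[of t s] k2.K_eq[of t s] s0 s1 s2 by linarith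
    then show "\<bar>K1 t s - K2 t s\<bar> \<le> \<eta> * exp (\<gamma> * s) + \<bar>wave_step Q1 (\<lambda>t s. K1 t s - K2 t s) t s\<bar>"
      using b0 b1 by linarith
  qed (use \<eta> \<gamma> ts in auto)
qed

lemma diagonal_integral_local:
  fixes H :: "real \<Rightarrow> real \<Rightarrow> real"
  assumes Qm[measurable]: "Q \<in> borel_measurable borel"
    and A: "L1_upto \<sigma> Q \<le> ennreal A" "0 \<le> A"
    and H: "borel2 H"
    and supp: "\<And>x y. H x y \<noteq> 0 \<Longrightarrow> 0 \<le> x \<and> x \<le> y"
    and bd: "\<And>x y. x + y \<le> 2 * \<sigma> \<Longrightarrow> \<bar>H x y\<bar> \<le> m" and m: "0 \<le> m"
  shows "integrable lborel (\<lambda>x. Q x * H x (2 * \<sigma> - x))" "\<bar>\<integral>x. Q x * H x (2 * \<sigma> - x) \<partial>lborel\<bar> \<le> m * A"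
proof -
  note [measurable] = measurable_curried[OF H]
  have "(\<integral>\<^sup>+x. ennreal \<bar>Q x * H x (2 * \<sigma> - x)\<bar> \<partial>lborel) \<le> (\<integral>\<^sup>+x. ennreal m * (ennreal \<bar>Q x\<bar> * indicator {0..\<sigma>} x) \<partial>lborel)"
  proof (intro nn_integral_mono)
    fix x
    show "ennreal \<bar>Q x * H x (2 * \<sigma> - x)\<bar> \<le> ennreal m * (ennreal \<bar>Q x\<bar> * indicator {0..\<sigma>} x)"
    proof (cases "H x (2 * \<sigma> - x) = 0")
      case False
      then have "x \<in> {0..\<sigma>}" using supp[of x "2 * \<sigma> - x"] by auto
      moreover have "\<bar>Q x * H x (2 * \<sigma> - x)\<bar> \<le> m * \<bar>Q x\<bar>"
        using mult_left_mono[OF bd[of x "2 * \<sigma> - x"], of "\<bar>Q x\<bar>"] by (simp add: abs_mult mult_ac)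
      ultimately show ?thesis using m by (simp add: ennreal_mult'[symmetric] ennreal_leI)
    qed simp
  qed
  also have "\<dots> \<le> ennreal m * ennreal A"
    using A by (subst nn_integral_cmult) (auto intro!: mult_left_mono)
  also have "\<dots> = ennreal (m * A)" using A m by (simp add: ennreal_mult'[symmetric])
  finally have *: "(\<integral>\<^sup>+x. ennreal \<bar>Q x * H x (2 * \<sigma> - x)\<bar> \<partial>lborel) \<le> ennreal (m * A)" .
  have "(\<lambda>x. Q x * H x (2 * \<sigma> - x)) \<in> borel_measurable lborel" by measurable
  from integral_abs_le_nn_bound[OF this *] A m
  show "integrable lborel (\<lambda>x. Q x * H x (2 * \<sigma> - x))" "\<bar>\<integral>x. Q x * H x (2 * \<sigma> - x) \<partial>lborel\<bar> \<le> m * A"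
    by auto
qed

text \<open>In the difference of the two response functions, Q1 K1 - Q2 K2 is split as
(Q1 - Q2) K1 + Q2 (K1 - K2); both terms are controlled by the L^1 norm of Q1 - Q2 on [0, \<sigma>].\<close>

lemma potential_response_pointwise:
  assumes k1: "bounded_wave_kernel Q1 B1 K1 c1" and k2: "bounded_wave_kernel Q2 B2 K2 c2"
    and A1: "L1_upto a Q1 \<le> ennreal A"
    and A2: "L1_upto a Q2 \<le> ennreal A" "0 \<le> A"
    and \<sigma>: "0 \<le> \<sigma>" "\<sigma> \<le> a"
    and \<eta>: "L1_upto \<sigma> (\<lambda>x. Q1 x - Q2 x) \<le> ennreal \<eta>" "0 \<le> \<eta>"
  shows "\<bar>Q1 \<sigma> - Q2 \<sigma>\<bar> \<le> \<bar>response Q1 K1 \<sigma> - response Q2 K2 \<sigma>\<bar> + 6 * A * exp ((A + 1) * (2 * a)) * \<eta>"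
proof -
  interpret k1: bounded_wave_kernel Q1 B1 K1 c1 by fact
  interpret k2: bounded_wave_kernel Q2 B2 K2 c2 by fact
  let ?D = "\<lambda>t s. K1 t s - K2 t s"
  define E where "E = exp ((A + 1) * (2 * a))"
  have sub: "L1_upto \<sigma> Q \<le> ennreal A"
    if "L1_upto a Q \<le> ennreal A" for Q
    using \<sigma> by (intro order_trans[OF nn_integral_mono that]) (auto simp: indicator_def)
  note A1' = sub[OF A1] and A2' = sub[OF A2(1)]
  \<comment> \<open>The weight exponent A + 1 is positive also when A = 0.\<close>
  have \<gamma>: "0 < A + 1" "A \<le> A + 1" using A2 by auto
  have e: "m * exp ((A + 1) * y) \<le> m * E" if "x + y \<le> 2 * \<sigma>" "0 \<le> x" "0 \<le> m" for x y m
    unfolding E_def using that \<sigma> A2 by (intro mult_left_mono exp_le_cancel_iff[THEN iffD2] mult_left_mono) auto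
  have Ds: "0 \<le> x \<and> x \<le> y" if "?D x y \<noteq> 0" for x y
    using that k1.K_support[of x y] k2.K_support[of x y] by (cases "K1 x y = 0") auto
  have E0: "0 \<le> E" by (simp add: E_def)
  have K1b: "\<bar>K1 x y\<bar> \<le> A * E" if "x + y \<le> 2 * \<sigma>" for x y
  proof (cases "K1 x y = 0")
    case False
    then show ?thesis using k1.K_local[OF A1' A2(2) \<gamma> \<sigma>(1) that] e[OF that _ A2(2)] k1.K_support[of x y] by linarith
  qed (use A2 E0 in simp)
  have K2b: "\<bar>K2 x y\<bar> \<le> A * E" if "x + y \<le> 2 * \<sigma>" for x y
  proof (cases "K2 x y = 0")
    case False
    then show ?thesis using k2.K_local[OF A2' A2(2) \<gamma> \<sigma>(1) that] e[OF that _ A2(2)] k2.K_support[of x y] by linarith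
  qed (use A2 E0 in simp)
  have Db: "\<bar>?D x y\<bar> \<le> 2 * \<eta> * E" if "x + y \<le> 2 * \<sigma>" for x y
  proof (cases "?D x y = 0")
    case False
    then show ?thesis
      using two_kernel_difference[OF k1 k2 A1' A2' A2(2) \<eta> \<gamma> \<sigma>(1) that] e[OF that, of "2 * \<eta>"] Ds[of x y] \<eta> by linarith
  qed (use \<eta> E0 in simp)
  have Dm: "(\<lambda>z. ?D (fst z) (snd z)) \<in> borel_measurable borel"
    using k1.K_measurable k2.K_measurable by measurable
  have qm: "(\<lambda>x. Q1 x - Q2 x) \<in> borel_measurable borel" by measurable
  have AE0: "0 \<le> A * E" "0 \<le> 2 * \<eta> * E" using A2 \<eta> E0 by auto
  note d1 = diagonal_integral_local[OF k1.Q_measurable A1' A2(2) k1.K_measurable k1.K_support K1b AE0(1)]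
  note d2 = diagonal_integral_local[OF k2.Q_measurable A2' A2(2) k2.K_measurable k2.K_support K2b AE0(1)]
  note d3 = diagonal_integral_local[OF qm \<eta> k1.K_measurable k1.K_support K1b AE0(1)]
  note d4 = diagonal_integral_local[OF k2.Q_measurable A2' A2(2) Dm Ds Db AE0(2)]
  have "(\<integral>x. Q1 x * K1 x (2 * \<sigma> - x) \<partial>lborel) - (\<integral>x. Q2 x * K2 x (2 * \<sigma> - x) \<partial>lborel)
    = (\<integral>x. Q1 x * K1 x (2 * \<sigma> - x) - Q2 x * K2 x (2 * \<sigma> - x) \<partial>lborel)"
    by (rule Bochner_Integration.integral_diff[symmetric, OF d1(1) d2(1)])
  also have "\<dots> = (\<integral>x. (Q1 x - Q2 x) * K1 x (2 * \<sigma> - x) + Q2 x * ?D x (2 * \<sigma> - x) \<partial>lborel)"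
    by (simp add: algebra_simps)
  also have "\<dots> = (\<integral>x. (Q1 x - Q2 x) * K1 x (2 * \<sigma> - x) \<partial>lborel) + (\<integral>x. Q2 x * ?D x (2 * \<sigma> - x) \<partial>lborel)"
    by (rule Bochner_Integration.integral_add[OF d3(1) d4(1)])
  finally have "\<bar>(\<integral>x. Q1 x * K1 x (2 * \<sigma> - x) \<partial>lborel) - (\<integral>x. Q2 x * K2 x (2 * \<sigma> - x) \<partial>lborel)\<bar>
     \<le> A * E * \<eta> + 2 * \<eta> * E * A" using d3(2) d4(2) by linarith
  then have S: "2 * \<bar>(\<integral>x. Q1 x * K1 x (2 * \<sigma> - x) \<partial>lborel) - (\<integral>x. Q2 x * K2 x (2 * \<sigma> - x) \<partial>lborel)\<bar>
     \<le> 2 * (A * E * \<eta> + 2 * \<eta> * E * A)" by (rule mult_left_mono) simp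
  have "\<bar>x - y\<bar> \<le> \<bar>x + 2 * p - (y + 2 * q)\<bar> + 2 * \<bar>p - q\<bar>" for x y p q :: real
    by (auto simp: abs_if)
  then have "\<bar>Q1 \<sigma> - Q2 \<sigma>\<bar> \<le> \<bar>response Q1 K1 \<sigma> - response Q2 K2 \<sigma>\<bar>
     + 2 * \<bar>(\<integral>x. Q1 x * K1 x (2 * \<sigma> - x) \<partial>lborel) - (\<integral>x. Q2 x * K2 x (2 * \<sigma> - x) \<partial>lborel)\<bar>"
    unfolding response_def .
  also have "\<dots> \<le> \<bar>response Q1 K1 \<sigma> - response Q2 K2 \<sigma>\<bar> + 2 * (A * E * \<eta> + 2 * \<eta> * E * A)"
    by (rule add_left_mono[OF S])
  finally have "\<bar>Q1 \<sigma> - Q2 \<sigma>\<bar> \<le> \<bar>response Q1 K1 \<sigma> - response Q2 K2 \<sigma>\<bar> + 2 * (A * E * \<eta> + 2 * \<eta> * E * A)" .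
  then show ?thesis by (simp add: E_def algebra_simps)
qed

text \<open>After integration against e^(-2 M \<sigma>) the Volterra term is at most half of the left-hand side, which is
finite and can absorb it.\<close>

lemma gronwall_L1:
  fixes u \<rho> :: "real \<Rightarrow> real"
  assumes [measurable]: "u \<in> borel_measurable borel" "\<rho> \<in> borel_measurable borel"
    and u0: "\<And>x. 0 \<le> u x" and \<rho>0: "\<And>x. 0 \<le> \<rho> x"
    and fin: "(\<integral>\<^sup>+x. ennreal (u x) * indicator {0..a} x \<partial>lborel) < \<infinity>" and M: "0 < M"
    and ineq: "\<And>\<sigma>. 0 \<le> \<sigma> \<Longrightarrow> \<sigma> \<le> a \<Longrightarrow>
       ennreal (u \<sigma>) \<le> ennreal (\<rho> \<sigma>) + ennreal M * (\<integral>\<^sup>+x. ennreal (u x) * indicator {0..\<sigma>} x \<partial>lborel)"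
  shows "(\<integral>\<^sup>+x. ennreal (u x) * indicator {0..a} x \<partial>lborel)
      \<le> ennreal (2 * exp (2 * M * a)) * (\<integral>\<^sup>+x. ennreal (\<rho> x) * indicator {0..a} x \<partial>lborel)"
proof -
  let ?i = "\<lambda>x. indicator {0..a} x :: ennreal"
  define U where "U = (\<integral>\<^sup>+x. ennreal (u x * exp (- (2 * M) * x)) * ?i x \<partial>lborel)"
  define P where "P = (\<integral>\<^sup>+x. ennreal (\<rho> x) * ?i x \<partial>lborel)"
  have "U \<le> (\<integral>\<^sup>+x. ennreal (u x) * ?i x \<partial>lborel)"
    unfolding U_def using u0 M
    by (intro nn_integral_mono) (auto simp: indicator_def mult_left_le intro!: ennreal_leI)
  then have Ufin: "U < \<infinity>" using fin by (rule le_less_trans)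
  have "U \<le> (\<integral>\<^sup>+\<sigma>. ennreal (\<rho> \<sigma>) * ?i \<sigma> + (\<integral>\<^sup>+x. ennreal M * (ennreal (u x) * ?i x * (ennreal (exp (- (2 * M) * \<sigma>)) * indicator {x..} \<sigma>)) \<partial>lborel) \<partial>lborel)"
    unfolding U_def
  proof (intro nn_integral_mono)
    fix \<sigma>
    show "ennreal (u \<sigma> * exp (- (2 * M) * \<sigma>)) * ?i \<sigma> \<le> ennreal (\<rho> \<sigma>) * ?i \<sigma>
        + (\<integral>\<^sup>+x. ennreal M * (ennreal (u x) * ?i x * (ennreal (exp (- (2 * M) * \<sigma>)) * indicator {x..} \<sigma>)) \<partial>lborel)"
    proof (cases "\<sigma> \<in> {0..a}")
      case True
      have e: "ennreal (exp (- (2 * M) * \<sigma>)) \<le> 1" using True M by (simp add: ennreal_leI flip: ennreal_1)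
      have "ennreal (u \<sigma> * exp (- (2 * M) * \<sigma>)) = ennreal (u \<sigma>) * ennreal (exp (- (2 * M) * \<sigma>))"
        using u0 by (simp add: ennreal_mult')
      also have "\<dots> \<le> (ennreal (\<rho> \<sigma>) + ennreal M * (\<integral>\<^sup>+x. ennreal (u x) * indicator {0..\<sigma>} x \<partial>lborel)) * ennreal (exp (- (2 * M) * \<sigma>))"
        using ineq[of \<sigma>] True by (intro mult_right_mono) auto
      also have "\<dots> = ennreal (\<rho> \<sigma>) * ennreal (exp (- (2 * M) * \<sigma>))
           + ennreal M * (\<integral>\<^sup>+x. ennreal (u x) * indicator {0..\<sigma>} x * ennreal (exp (- (2 * M) * \<sigma>)) \<partial>lborel)"
        by (subst nn_integral_multc) (simp_all add: distrib_right mult.assoc)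
      also have "\<dots> \<le> ennreal (\<rho> \<sigma>) * 1
           + (\<integral>\<^sup>+x. ennreal M * (ennreal (u x) * ?i x * (ennreal (exp (- (2 * M) * \<sigma>)) * indicator {x..} \<sigma>)) \<partial>lborel)"
      proof (intro add_mono mult_left_mono e)
        have "ennreal M * (\<integral>\<^sup>+x. ennreal (u x) * indicator {0..\<sigma>} x * ennreal (exp (- (2 * M) * \<sigma>)) \<partial>lborel)
           = (\<integral>\<^sup>+x. ennreal M * (ennreal (u x) * indicator {0..\<sigma>} x * ennreal (exp (- (2 * M) * \<sigma>))) \<partial>lborel)"
          by (rule nn_integral_cmult[symmetric]) measurable
        also have "\<dots> \<le> (\<integral>\<^sup>+x. ennreal M * (ennreal (u x) * ?i x * (ennreal (exp (- (2 * M) * \<sigma>)) * indicator {x..} \<sigma>)) \<partial>lborel)"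
          using True by (intro nn_integral_mono) (auto simp: indicator_def)
        finally show "ennreal M * (\<integral>\<^sup>+x. ennreal (u x) * indicator {0..\<sigma>} x * ennreal (exp (- (2 * M) * \<sigma>)) \<partial>lborel)
           \<le> (\<integral>\<^sup>+x. ennreal M * (ennreal (u x) * ?i x * (ennreal (exp (- (2 * M) * \<sigma>)) * indicator {x..} \<sigma>)) \<partial>lborel)" .
      qed auto
      finally show ?thesis using True by simp
    qed simp
  qed
  also have "\<dots> = P + (\<integral>\<^sup>+\<sigma>. \<integral>\<^sup>+x. ennreal M * (ennreal (u x) * ?i x * (ennreal (exp (- (2 * M) * \<sigma>)) * indicator {x..} \<sigma>)) \<partial>lborel \<partial>lborel)"
  proof -
    have *: "(\<lambda>\<sigma>. \<integral>\<^sup>+x. ennreal M * (ennreal (u x) * ?i x * (ennreal (exp (- (2 * M) * \<sigma>)) * indicator {x..} \<sigma>)) \<partial>lborel) \<in> borel_measurable lborel"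
      unfolding indicator_def atLeast_iff by measurable
    show ?thesis unfolding P_def by (rule nn_integral_add[OF _ *]) measurable
  qed
  also have "(\<integral>\<^sup>+\<sigma>. \<integral>\<^sup>+x. ennreal M * (ennreal (u x) * ?i x * (ennreal (exp (- (2 * M) * \<sigma>)) * indicator {x..} \<sigma>)) \<partial>lborel \<partial>lborel)
     = (\<integral>\<^sup>+x. \<integral>\<^sup>+\<sigma>. ennreal M * (ennreal (u x) * ?i x * (ennreal (exp (- (2 * M) * \<sigma>)) * indicator {x..} \<sigma>)) \<partial>lborel \<partial>lborel)"
    unfolding indicator_def atLeast_iff by (rule lborel_pair.Fubini') measurable
  also have "\<dots> = (\<integral>\<^sup>+x. ennreal M * (ennreal (u x) * ?i x * ennreal (exp (- (2 * M) * x) / (2 * M))) \<partial>lborel)"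
    using M nn_integral_exp_atLeast[of "2 * M"] by (intro nn_integral_cong) (simp add: nn_integral_cmult)
  also have "\<dots> = (\<integral>\<^sup>+x. ennreal (1/2) * (ennreal (u x * exp (- (2 * M) * x)) * ?i x) \<partial>lborel)"
  proof (intro nn_integral_cong)
    fix x
    have "M * (u x * (exp (- (2 * M) * x) / (2 * M))) = 1/2 * (u x * exp (- (2 * M) * x))" using M by simp
    then show "ennreal M * (ennreal (u x) * ?i x * ennreal (exp (- (2 * M) * x) / (2 * M))) = ennreal (1/2) * (ennreal (u x * exp (- (2 * M) * x)) * ?i x)"
      using M u0[of x] by (cases "x \<in> {0..a}") (auto simp: ennreal_mult'[symmetric] simp del: ennreal_half)
  qed
  also have "\<dots> = ennreal (1/2) * U" unfolding U_def by (subst nn_integral_cmult) auto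
  finally have "U \<le> P + ennreal (1/2) * U" .
  then have U2: "U \<le> 2 * P"
  proof (cases "P = \<infinity>")
    case False
    obtain r where r: "U = ennreal r" "0 \<le> r" using Ufin by (cases U) auto
    obtain q where q: "P = ennreal q" "0 \<le> q" using False by (cases P) auto
    have "ennreal r \<le> ennreal (q + 1/2 * r)"
      using \<open>U \<le> P + ennreal (1/2) * U\<close> r q by (simp add: ennreal_mult'[symmetric] ennreal_plus[symmetric] del: ennreal_plus ennreal_half)
    moreover have "0 \<le> q + 1/2 * r" using r q by simp
    ultimately have "r \<le> q + 1/2 * r" by (simp only: ennreal_le_iff)
    then have "r \<le> 2 * q" by simp
    then show ?thesis using r q by (simp add: ennreal_leI ennreal_mult'[symmetric] flip: ennreal_numeral)
  qed (simp add: ennreal_mult_top)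
  have "(\<integral>\<^sup>+x. ennreal (u x) * ?i x \<partial>lborel) \<le> (\<integral>\<^sup>+x. ennreal (exp (2 * M * a)) * (ennreal (u x * exp (- (2 * M) * x)) * ?i x) \<partial>lborel)"
  proof (intro nn_integral_mono)
    fix x
    show "ennreal (u x) * ?i x \<le> ennreal (exp (2 * M * a)) * (ennreal (u x * exp (- (2 * M) * x)) * ?i x)"
    proof (cases "x \<in> {0..a}")
      case True
      have "1 \<le> exp (2 * M * a) * exp (- (2 * M) * x)" using True M by (simp add: exp_add[symmetric])
      from mult_left_mono[OF this u0[of x]] True show ?thesis
        by (simp add: ennreal_mult'[symmetric] mult_ac ennreal_leI)
    qed simp
  qed
  also have "\<dots> = ennreal (exp (2 * M * a)) * U" unfolding U_def by (subst nn_integral_cmult) auto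
  also have "\<dots> \<le> ennreal (exp (2 * M * a)) * (2 * P)" using U2 by (intro mult_left_mono) auto
  also have "\<dots> = ennreal (2 * exp (2 * M * a)) * P" by (simp add: ennreal_mult' mult_ac)
  finally show ?thesis unfolding P_def .
qed

theorem halfline_stability:
  assumes k1: "bounded_wave_kernel Q1 B1 K1 c1" and k2: "bounded_wave_kernel Q2 B2 K2 c2"
    and A1: "L1_upto a Q1 \<le> ennreal A"
    and A2: "L1_upto a Q2 \<le> ennreal A" "0 \<le> A"
  shows "L1_upto a (\<lambda>x. Q1 x - Q2 x)
     \<le> ennreal (2 * exp (2 * (6 * A * exp ((A + 1) * (2 * a)) + 1) * a))
        * L1_upto a (\<lambda>x. response Q1 K1 x - response Q2 K2 x)"
proof -
  interpret k1: bounded_wave_kernel Q1 B1 K1 c1 by fact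
  interpret k2: bounded_wave_kernel Q2 B2 K2 c2 by fact
  define M where "M = 6 * A * exp ((A + 1) * (2 * a)) + 1"
  have M: "0 < M" using A2 by (simp add: M_def add_nonneg_pos)
  have [measurable]: "response Q1 K1 \<in> borel_measurable borel" "response Q2 K2 \<in> borel_measurable borel"
    unfolding response_def by measurable
  have fin: "L1_upto a (\<lambda>x. Q1 x - Q2 x) < \<infinity>"
  proof -
    have "L1_upto a (\<lambda>x. Q1 x - Q2 x)
       \<le> (\<integral>\<^sup>+x. ennreal \<bar>Q1 x\<bar> * indicator {0..a} x + ennreal \<bar>Q2 x\<bar> * indicator {0..a} x \<partial>lborel)"
      by (intro nn_integral_mono) (auto simp: indicator_def ennreal_plus[symmetric] simp del: ennreal_plus intro!: ennreal_leI)
    also have "\<dots> = L1_upto a Q1 + L1_upto a Q2"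
      by (intro nn_integral_add) auto
    also have "\<dots> \<le> ennreal A + ennreal A" by (intro add_mono A1 A2)
    also have "\<dots> < \<infinity>" by simp
    finally show ?thesis .
  qed
  show ?thesis unfolding M_def[symmetric]
  proof (rule gronwall_L1[OF _ _ _ _ fin M])
    fix \<sigma> assume \<sigma>: "0 \<le> \<sigma>" "\<sigma> \<le> a"
    let ?I = "\<integral>\<^sup>+x. ennreal \<bar>Q1 x - Q2 x\<bar> * indicator {0..\<sigma>} x \<partial>lborel"
    have "?I \<le> L1_upto a (\<lambda>x. Q1 x - Q2 x)"
      using \<sigma> by (intro nn_integral_mono) (auto simp: indicator_def)
    then have "?I < \<infinity>" using fin by (rule le_less_trans)
    then obtain \<eta> where \<eta>: "?I = ennreal \<eta>" "0 \<le> \<eta>" by (cases ?I) auto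
    have "\<bar>Q1 \<sigma> - Q2 \<sigma>\<bar> \<le> \<bar>response Q1 K1 \<sigma> - response Q2 K2 \<sigma>\<bar> + 6 * A * exp ((A + 1) * (2 * a)) * \<eta>"
      using \<eta> by (intro potential_response_pointwise[OF k1 k2 A1 A2 \<sigma>]) auto
    also have "\<dots> \<le> \<bar>response Q1 K1 \<sigma> - response Q2 K2 \<sigma>\<bar> + M * \<eta>"
      using \<eta> by (simp add: M_def ring_distribs)
    finally show "ennreal \<bar>Q1 \<sigma> - Q2 \<sigma>\<bar> \<le> ennreal \<bar>response Q1 K1 \<sigma> - response Q2 K2 \<sigma>\<bar> + ennreal M * ?I"
      unfolding \<eta>(1) using \<eta>(2) M by (simp add: ennreal_mult'[symmetric] ennreal_plus[symmetric] ennreal_leI del: ennreal_plus)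
  qed auto
qed

section \<open>Uniqueness of Laplace moments\<close>

text \<open>The Borel sets over which f has integral 0 form a Dynkin system.\<close>

lemma AE_zero_if_integral_atMost_zero:
  fixes f :: "real \<Rightarrow> real"
  assumes f: "integrable lborel f" and z: "\<And>x. (LBINT y:{..x}. f y) = 0"
  shows "AE x in lborel. f x = 0"
proof -
  have si: "set_integrable lborel A f" if "A \<in> sets borel" for A
    using that f unfolding set_integrable_def by (intro integrable_mult_indicator) auto
  have "(\<lambda>n::nat. LBINT y:{..real n}. f y) \<longlonglongrightarrow> (LBINT y:(\<Union>n::nat. {..real n}). f y)"
    by (rule set_integral_cont_up) (auto intro!: si simp: incseq_def intro: order_trans)
  moreover have "(\<Union>n::nat. {..real n}) = UNIV" using real_nat_ceiling_ge by blast
  ultimately have U: "(LBINT y:UNIV. f y) = 0" using z by (simp add: LIMSEQ_const_iff)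
  have all: "(LBINT y:A. f y) = 0" if "A \<in> sets borel" for A
  proof -
    have gen: "A \<in> sigma_sets UNIV (range (\<lambda>a::real. {..a}))"
      using that by (simp add: borel_eq_atMost)
    have "Int_stable (range (\<lambda>a::real. {..a}))" by (auto simp: Int_stable_def)
    moreover have "range (\<lambda>a::real. {..a}) \<subseteq> Pow UNIV" by simp
    moreover note gen
    ultimately show ?thesis
    proof (induction rule: sigma_sets_induct_disjoint)
      case (compl A)
      then have A: "A \<in> sets borel" by (simp add: borel_eq_atMost)
      have "(LBINT y:A \<union> (UNIV - A). f y) = (LBINT y:A. f y) + (LBINT y:UNIV - A. f y)"
        using A by (intro set_integral_Un si) auto
      then show ?case using compl U by simp
    next
      case (union A)
      then have A: "A i \<in> sets borel" for i using union(2) by (auto simp: borel_eq_atMost)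
      have "(LBINT y:(\<Union>i. A i). f y) = (\<Sum>i. (LBINT y:(A i). f y))"
        using A union(1) by (intro lebesgue_integral_countable_add si) (auto simp: disjoint_family_on_def)
      then show ?case using union(3) by simp
    qed (use z in \<open>auto simp: set_lebesgue_integral_def\<close>)
  qed
  show ?thesis
    using density_unique_real[OF f, of "\<lambda>x. 0"] all by simp
qed

text \<open>In the variable y = e^(-2x) all power moments vanish. By the Weierstrass theorem so do the integrals
against continuous functions of y, and ramp functions approximate the indicators of half-lines.\<close>

lemma laplace_moments_unique:
  fixes h :: "real \<Rightarrow> real"
  assumes h: "integrable lborel h" and neg: "\<And>x. x < 0 \<Longrightarrow> h x = 0"
    and mom: "\<And>n::nat. (\<integral>x. h x * exp (- 2 * real n * x) \<partial>lborel) = 0"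
  shows "AE x in lborel. h x = 0"
proof -
  let ?E = "\<lambda>x::real. exp (- 2 * max 0 x)"
  have hm[measurable]: "h \<in> borel_measurable borel" using borel_measurable_integrable[OF h] by simp
  have hE: "h x * (?E x) ^ n = h x * exp (- 2 * real n * x)" for n x
    using neg[of x] by (cases "x < 0") (auto simp: exp_of_nat_mult[symmetric] max_def mult_ac)
  have hEi: "integrable lborel (\<lambda>x. h x * (?E x) ^ n)" for n
    by (rule Bochner_Integration.integrable_bound[OF h])
       (auto intro!: always_eventually mult_left_le power_le_one simp: abs_mult power_abs)
  have E01: "?E x \<in> {0..1}" for x by auto
  have cont: "(\<integral>x. h x * g (?E x) \<partial>lborel) = 0" if g: "continuous_on {0..1} g"
    and gm: "(\<lambda>x. g (?E x)) \<in> borel_measurable borel" for g :: "real \<Rightarrow> real"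
  proof -
    note [measurable] = gm
    define J where "J = (\<integral>x. \<bar>h x\<bar> \<partial>lborel)"
    have J: "0 \<le> J" by (simp add: J_def)
    have small: "\<bar>\<integral>x. h x * g (?E x) \<partial>lborel\<bar> \<le> e * J" if e: "0 < e" for e
    proof -
      obtain p where p: "real_polynomial_function p" "\<And>x. x \<in> {0..1} \<Longrightarrow> \<bar>g x - p x\<bar> < e"
        using Stone_Weierstrass_real_polynomial_function[OF compact_Icc g e] by blast
      obtain a n where pa: "p = (\<lambda>x. \<Sum>i\<le>n. a i * x ^ i)"
        using p(1) real_polynomial_function_iff_sum by blast
      have hp: "h x * p (?E x) = (\<Sum>i\<le>n. a i * (h x * (?E x) ^ i))" for x
        by (simp add: pa sum_distrib_left mult_ac)
      have ip: "integrable lborel (\<lambda>x. h x * p (?E x))"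
        unfolding hp by (intro Bochner_Integration.integrable_sum integrable_mult_right hEi)
      have "(\<integral>x. h x * p (?E x) \<partial>lborel) = (\<Sum>i\<le>n. a i * (\<integral>x. h x * (?E x) ^ i \<partial>lborel))"
        unfolding hp
        by (subst Bochner_Integration.integral_sum) (intro integrable_mult_right hEi, simp only: integral_mult_right_zero)
      also have "\<dots> = 0" unfolding hE mom by simp
      finally have p0: "(\<integral>x. h x * p (?E x) \<partial>lborel) = 0" .
      have b: "\<bar>h x * (g (?E x) - p (?E x))\<bar> \<le> e * \<bar>h x\<bar>" for x
        using mult_right_mono[OF less_imp_le[OF p(2)[OF E01[of x]]], of "\<bar>h x\<bar>"] by (simp add: abs_mult mult_ac)
      have pm: "(\<lambda>x. p (?E x)) \<in> borel_measurable borel" unfolding pa by measurable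
      note [measurable] = pm
      have ie: "integrable lborel (\<lambda>x. e * \<bar>h x\<bar>)" using h by simp
      have id: "integrable lborel (\<lambda>x. h x * (g (?E x) - p (?E x)))"
      proof (rule Bochner_Integration.integrable_bound[OF ie])
        show "(\<lambda>x. h x * (g (?E x) - p (?E x))) \<in> borel_measurable lborel" by measurable
        show "AE x in lborel. norm (h x * (g (?E x) - p (?E x))) \<le> norm (e * \<bar>h x\<bar>)"
          using b e by (intro always_eventually allI) (simp only: real_norm_def, simp)
      qed
      have "(\<integral>x. h x * g (?E x) \<partial>lborel) = (\<integral>x. h x * (g (?E x) - p (?E x)) + h x * p (?E x) \<partial>lborel)"
        by (simp add: algebra_simps)
      also have "\<dots> = (\<integral>x. h x * (g (?E x) - p (?E x)) \<partial>lborel)"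
        using id ip p0 by (subst Bochner_Integration.integral_add) auto
      finally have eq: "(\<integral>x. h x * g (?E x) \<partial>lborel) = (\<integral>x. h x * (g (?E x) - p (?E x)) \<partial>lborel)" .
      have "\<bar>\<integral>x. h x * (g (?E x) - p (?E x)) \<partial>lborel\<bar> \<le> (\<integral>x. \<bar>h x * (g (?E x) - p (?E x))\<bar> \<partial>lborel)" by simp
      also have "\<dots> \<le> (\<integral>x. e * \<bar>h x\<bar> \<partial>lborel)"
        using id by (intro integral_mono ie b) simp
      finally show ?thesis unfolding eq by (simp add: J_def)
    qed
    show ?thesis
    proof (rule ccontr)
      assume n: "(\<integral>x. h x * g (?E x) \<partial>lborel) \<noteq> 0"
      let ?v = "\<bar>\<integral>x. h x * g (?E x) \<partial>lborel\<bar>"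
      have "?v \<le> ?v / (2 * (J + 1)) * J" using n J by (intro small) auto
      also have "\<dots> \<le> ?v / 2"
        using n J by (simp add: field_simps)
      finally show False using n by simp
    qed
  qed
  have "(LBINT y:{..x}. h y) = 0" for x
  proof (cases "x < 0")
    case True
    then have "(\<lambda>y. indicator {..x} y *\<^sub>R h y) = (\<lambda>y. 0)"
      using neg by (auto simp: fun_eq_iff indicator_def)
    then show ?thesis by (simp add: set_lebesgue_integral_def)
  next
    case False
    \<comment> \<open>y \<le> x means e^(-2y) \<ge> y0; g n is a ramp that rises from 0 to 1 on [y0 - 1/n, y0].\<close>
    define y0 where "y0 = exp (- 2 * x)"
    define g where "g n y = min 1 (max 0 (1 + real n * (y - y0)))" for n y
    have z: "(\<integral>y. h y * g n (?E y) \<partial>lborel) = 0" for n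
      unfolding g_def by (rule cont) (auto intro!: continuous_intros)
    have lim: "(\<lambda>n. g n (?E y)) \<longlonglongrightarrow> indicator {..x} y" for y
    proof (cases "y \<le> x")
      case True
      then have "y0 \<le> ?E y" using False by (auto simp: y0_def)
      then have "g n (?E y) = 1" for n by (simp add: g_def)
      then show ?thesis using True by simp
    next
      case y: False
      then have d: "?E y < y0" using False by (auto simp: y0_def max_def)
      obtain N :: nat where N: "1 / (y0 - ?E y) < real N" using reals_Archimedean2 by blast
      have "g n (?E y) = 0" if "N \<le> n" for n
      proof -
        have "1 < real n * (y0 - ?E y)"
        proof -
          have "1 / (y0 - ?E y) < real n" using N that by linarith
          then show ?thesis using d by (simp add: divide_less_eq)
        qed
        then show ?thesis by (simp add: g_def algebra_simps)
      qed
      then have "eventually (\<lambda>n. g n (?E y) = 0) sequentially" by (rule eventually_sequentiallyI)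
      then show ?thesis using y by (auto intro: tendsto_eventually simp: indicator_def)
    qed
    have "(\<lambda>n. \<integral>y. h y * g n (?E y) \<partial>lborel) \<longlonglongrightarrow> (\<integral>y. h y * indicator {..x} y \<partial>lborel)"
    proof (rule integral_dominated_convergence)
      show "integrable lborel (\<lambda>y. \<bar>h y\<bar>)" using h by simp
      show "AE y in lborel. (\<lambda>n. h y * g n (?E y)) \<longlonglongrightarrow> h y * indicator {..x} y"
        by (intro always_eventually allI tendsto_mult tendsto_const lim)
      show "AE y in lborel. norm (h y * g n (?E y)) \<le> \<bar>h y\<bar>" for n
        by (intro always_eventually allI) (auto simp: abs_mult g_def intro!: mult_left_le)
    qed (auto simp: g_def)
    then show ?thesis unfolding z by (simp add: LIMSEQ_const_iff set_lebesgue_integral_def mult_ac)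
  qed
  then show ?thesis by (rule AE_zero_if_integral_atMost_zero[OF h])
qed

section \<open>Logarithmic polar coordinates\<close>

definition logr :: "'a::euclidean_space \<Rightarrow> real" where
  "logr x = - ln (norm x)"

lemma logr_measurable [measurable]: "logr \<in> borel_measurable borel"
  unfolding logr_def by measurable

lemma exp_logr: "x \<noteq> 0 \<Longrightarrow> exp (- logr x) = norm x"
  by (simp add: logr_def)

lemma emeasure_cone_scale:
  fixes C :: "'a::euclidean_space set"
  assumes C[measurable]: "C \<in> sets borel" and cone: "\<forall>x. \<forall>r>0. r *\<^sub>R x \<in> C \<longleftrightarrow> x \<in> C" and R: "0 < R"
  shows "emeasure lborel (C \<inter> cball 0 R) = ennreal (R ^ DIM('a)) * emeasure lborel (C \<inter> cball 0 1)"
proof -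
  have "emeasure lborel (C \<inter> cball 0 R)
      = emeasure (density (distr lborel borel (\<lambda>x::'a. 0 + R *\<^sub>R x)) (\<lambda>_. ennreal (\<bar>R\<bar> ^ DIM('a)))) (C \<inter> cball 0 R)"
    using R by (subst lborel_affine[of R 0]) auto
  also have "\<dots> = ennreal (\<bar>R\<bar> ^ DIM('a)) * emeasure (distr lborel borel (\<lambda>x::'a. 0 + R *\<^sub>R x)) (C \<inter> cball 0 R)"
    by (subst emeasure_density_const) auto
  also have "emeasure (distr lborel borel (\<lambda>x::'a. 0 + R *\<^sub>R x)) (C \<inter> cball 0 R)
      = emeasure lborel ((\<lambda>x::'a. 0 + R *\<^sub>R x) -` (C \<inter> cball 0 R) \<inter> space lborel)"
    by (rule emeasure_distr) auto
  also have "(\<lambda>x::'a. 0 + R *\<^sub>R x) -` (C \<inter> cball 0 R) \<inter> space lborel = C \<inter> cball 0 1"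
    using R cone by (auto simp: mult_le_cancel_left1)
  finally show ?thesis using R by simp
qed

text \<open>The surface measure of the part of the unit sphere in the cone, expressed through a volume.\<close>

definition cone_const :: "'a::euclidean_space set \<Rightarrow> real" where
  "cone_const C = real DIM('a) * measure lborel (C \<inter> cball 0 1)"

lemma cone_const_nonneg [simp]: "0 \<le> cone_const C"
  by (simp add: cone_const_def)

lemma cone_const_full: "cone_const (- {0} :: 'a::euclidean_space set) = sphere_area DIM('a)"
proof -
  have "emeasure lborel (- {0} \<inter> cball (0::'a) 1) = emeasure lborel (cball (0::'a) 1 - {0})"
    by (rule arg_cong[where f="emeasure lborel"]) auto
  also have "\<dots> = emeasure lborel (cball (0::'a) 1)"
    by (rule emeasure_Diff_null_set) auto
  finally have "measure lborel (- {0} \<inter> cball (0::'a) 1) = unit_ball_vol DIM('a)"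
    by (simp add: measure_def emeasure_cball)
  then show ?thesis by (simp add: cone_const_def sphere_area_def)
qed

text \<open>Both measures give the half-line {a..} the volume of the part of the cone in the ball of radius
e^(-a), by scaling. Sectors other than the whole space serve to stay away from the zeros of a spherical
harmonic.\<close>

theorem polar_log_measure:
  fixes C :: "'a::euclidean_space set"
  assumes C[measurable]: "C \<in> sets borel" and cone: "\<forall>x. \<forall>r>0. r *\<^sub>R x \<in> C \<longleftrightarrow> x \<in> C"
    and C0: "0 \<notin> C"
  shows "distr (density lborel (indicator C)) borel logr
       = density lborel (\<lambda>t. ennreal (cone_const C * exp (- real DIM('a) * t)))" (is "?M = ?N")
proof -
  let ?\<gamma> = "measure lborel (C \<inter> cball 0 1)"
  have fin: "emeasure lborel (C \<inter> cball 0 1) = ennreal ?\<gamma>"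
  proof (rule emeasure_eq_ennreal_measure)
    have "emeasure lborel (C \<inter> cball 0 1) \<le> emeasure lborel (cball (0::'a) 1)"
      by (intro emeasure_mono) auto
    also have "\<dots> < \<infinity>" by (simp add: emeasure_cball)
    finally show "emeasure lborel (C \<inter> cball 0 1) \<noteq> top" by simp
  qed
  have M: "emeasure ?M {a..} = ennreal (?\<gamma> * exp (- real DIM('a) * a))" for a
  proof -
    have "emeasure ?M {a..} = emeasure (density lborel (indicator C)) (logr -` {a..} \<inter> space lborel)"
      by (subst emeasure_distr) auto
    also have "\<dots> = (\<integral>\<^sup>+x. indicator C x * indicator (logr -` {a..} \<inter> space lborel) x \<partial>lborel)"
      by (rule emeasure_density) measurable
    also have "\<dots> = (\<integral>\<^sup>+x. indicator (C \<inter> cball 0 (exp (- a))) x \<partial>lborel)"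
    proof (intro nn_integral_cong)
      fix x :: 'a
      show "indicator C x * indicator (logr -` {a..} \<inter> space lborel) x = (indicator (C \<inter> cball 0 (exp (- a))) x :: ennreal)"
      proof (cases "x \<in> C")
        case True
        then have "norm x = exp (- logr x)" using C0 by (intro exp_logr[symmetric]) auto
        then have "a \<le> logr x \<longleftrightarrow> norm x \<le> exp (- a)" by simp
        then show ?thesis by (auto simp: indicator_def)
      qed simp
    qed
    also have "\<dots> = emeasure lborel (C \<inter> cball 0 (exp (- a)))"
      by (rule nn_integral_indicator) auto
    also have "\<dots> = ennreal (exp (- a) ^ DIM('a)) * emeasure lborel (C \<inter> cball 0 1)"
      by (rule emeasure_cone_scale[OF C cone]) auto
    also have "\<dots> = ennreal (?\<gamma> * exp (- real DIM('a) * a))"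
      unfolding fin by (simp add: ennreal_mult'[symmetric] exp_of_nat_mult[symmetric] mult_ac)
    finally show ?thesis .
  qed
  have N: "emeasure ?N {a..} = ennreal (?\<gamma> * exp (- real DIM('a) * a))" for a
  proof -
    have "emeasure ?N {a..} = (\<integral>\<^sup>+t. ennreal (cone_const C) * (ennreal (exp (- real DIM('a) * t)) * indicator {a..} t) \<partial>lborel)"
      by (subst emeasure_density) (simp_all add: ennreal_mult mult.assoc)
    also have "\<dots> = ennreal (cone_const C) * ennreal (exp (- real DIM('a) * a) / real DIM('a))"
      using nn_integral_exp_atLeast[of "real DIM('a)" a] by (subst nn_integral_cmult) auto
    also have "\<dots> = ennreal (?\<gamma> * exp (- real DIM('a) * a))"
      by (subst ennreal_mult'[symmetric]) (auto simp: cone_const_def)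
    finally show ?thesis .
  qed
  show ?thesis
  proof (rule measure_eqI_generator_eq[where E="range (\<lambda>a::real. {a..})" and \<Omega>=UNIV and A="\<lambda>n::nat. {- real n..}"])
    show "Int_stable (range (\<lambda>a::real. {a..}))"
    proof (rule Int_stableI_image)
      fix a b :: real show "\<exists>c\<in>UNIV. {a..} \<inter> {b..} = {c..}" by (intro bexI[of _ "max a b"]) auto
    qed
    show "sets ?M = sigma_sets UNIV (range (\<lambda>a::real. {a..}))"
      by (simp add: borel_Ici)
    show "sets ?N = sigma_sets UNIV (range (\<lambda>a::real. {a..}))"
      by (simp add: borel_Ici)
    show "emeasure ?M X = emeasure ?N X" if "X \<in> range (\<lambda>a::real. {a..})" for X
      using that M N by auto
    show "(\<Union>n::nat. {- real n..}) = (UNIV :: real set)"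
    proof (intro set_eqI iffI UNIV_I)
      fix x :: real
      have "- x \<le> real (nat \<lceil>- x\<rceil>)" by (rule real_nat_ceiling_ge)
      then show "x \<in> (\<Union>n::nat. {- real n..})" by (intro UN_I[of "nat \<lceil>- x\<rceil>"]) auto
    qed
  qed (use M in auto)
qed

lemma polar_nn_integral:
  fixes C :: "'a::euclidean_space set"
  assumes C[measurable]: "C \<in> sets borel" and cone: "\<forall>x. \<forall>r>0. r *\<^sub>R x \<in> C \<longleftrightarrow> x \<in> C"
    and C0: "0 \<notin> C" and f[measurable]: "f \<in> borel_measurable borel"
  shows "(\<integral>\<^sup>+x. f (logr x) * indicator C x \<partial>lborel)
     = (\<integral>\<^sup>+t. ennreal (cone_const C * exp (- real DIM('a) * t)) * f t \<partial>lborel)"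
proof -
  have "(\<integral>\<^sup>+x. f (logr x) * indicator C x \<partial>lborel) = (\<integral>\<^sup>+x. f (logr x) \<partial>density lborel (indicator C))"
    by (subst nn_integral_density) (auto simp: mult.commute)
  also have "\<dots> = (\<integral>\<^sup>+t. f t \<partial>distr (density lborel (indicator C)) borel logr)"
    by (subst nn_integral_distr) auto
  also have "\<dots> = (\<integral>\<^sup>+t. ennreal (cone_const C * exp (- real DIM('a) * t)) * f t \<partial>lborel)"
    by (subst polar_log_measure[OF C cone C0], subst nn_integral_density) auto
  finally show ?thesis .
qed

lemma full_cone: "- {0} \<in> sets (borel :: 'a::euclidean_space measure)"
    "\<forall>x::'a. \<forall>r>0. r *\<^sub>R x \<in> - {0} \<longleftrightarrow> x \<in> - {0}" "(0::'a) \<notin> - {0}"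
  by auto

lemma polar_integral:
  fixes f :: "real \<Rightarrow> real"
  assumes f[measurable]: "f \<in> borel_measurable borel"
  shows "integrable lborel (\<lambda>x::'a::euclidean_space. f (logr x)) \<longleftrightarrow>
      integrable lborel (\<lambda>t. exp (- real DIM('a) * t) * f t)"
    and "(\<integral>x. f (logr (x::'a)) \<partial>lborel) = sphere_area DIM('a) * (\<integral>t. exp (- real DIM('a) * t) * f t \<partial>lborel)"
proof -
  let ?C = "- {0::'a}"
  let ?S = "sphere_area DIM('a)"
  have S: "0 < ?S" by (simp add: sphere_area_def)
  have ae: "AE x in lborel. x \<in> ?C" using AE_lborel_singleton[of "0::'a"] by simp
  have e: "density lborel (indicator ?C) = (lborel :: 'a measure)"
    by (subst density_cong[of _ _ "\<lambda>_. 1"]) (use ae in \<open>auto simp: density_1 indicator_def\<close>)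
  have M: "distr (lborel :: 'a measure) borel logr = density lborel (\<lambda>t. ennreal (?S * exp (- real DIM('a) * t)))"
    using polar_log_measure[of "- {0::'a}", OF full_cone] unfolding e cone_const_full .
  have "integrable lborel (\<lambda>x::'a. f (logr x)) \<longleftrightarrow> integrable (distr (lborel :: 'a measure) borel logr) f"
    by (rule integrable_distr_eq[symmetric]) auto
  also have "\<dots> \<longleftrightarrow> integrable lborel (\<lambda>t. (?S * exp (- real DIM('a) * t)) *\<^sub>R f t)"
    unfolding M using S by (intro integrable_density) auto
  also have "\<dots> \<longleftrightarrow> integrable lborel (\<lambda>t. ?S * (exp (- real DIM('a) * t) * f t))"
    by (simp add: mult.assoc)
  also have "\<dots> \<longleftrightarrow> integrable lborel (\<lambda>t. exp (- real DIM('a) * t) * f t)"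
    using S by (subst integrable_mult_left_iff) auto
  finally show "integrable lborel (\<lambda>x::'a. f (logr x)) \<longleftrightarrow> integrable lborel (\<lambda>t. exp (- real DIM('a) * t) * f t)" .
  have "(\<integral>x. f (logr (x::'a)) \<partial>lborel) = integral\<^sup>L (distr (lborel :: 'a measure) borel logr) f"
    by (rule integral_distr[symmetric]) auto
  also have "\<dots> = (\<integral>t. (?S * exp (- real DIM('a) * t)) *\<^sub>R f t \<partial>lborel)"
    unfolding M using S by (intro integral_density) auto
  finally show "(\<integral>x. f (logr (x::'a)) \<partial>lborel) = ?S * (\<integral>t. exp (- real DIM('a) * t) * f t \<partial>lborel)"
    by (simp add: mult.assoc)
qed

text \<open>The image of Lebesgue measure under - ln |x| has a density, so null sets pull back to null sets.\<close>

lemma AE_logr: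
  assumes "AE t in lborel. P t"
  shows "AE x::'a::euclidean_space in lborel. P (logr x)"
proof -
  have "AE t in density lborel (\<lambda>t. ennreal (cone_const (- {0::'a}) * exp (- real DIM('a) * t))). P t"
    by (subst AE_density) (measurable, rule eventually_mono[OF assms], simp)
  then have "AE x in density lborel (indicator (- {0::'a})). P (logr x)"
    unfolding polar_log_measure[of "- {0::'a}", OF full_cone, symmetric] by (rule AE_distrD[rotated]) simp
  then have "AE x::'a in lborel. 0 < (indicator (- {0}) x :: ennreal) \<longrightarrow> P (logr x)"
    by (subst (asm) AE_density) measurable
  then show ?thesis
    using AE_lborel_singleton[of "0::'a"] by eventually_elim auto
qed

section \<open>Radial functions on the ball\<close>

lemma profile_eq:
  fixes V :: "'a::euclidean_space \<Rightarrow> real"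
  assumes V: "radial V" and x: "x \<in> ball 0 1 - {0}"
  shows "profile V (norm x) = V x"
proof -
  obtain q where q: "\<And>x. x \<in> ball 0 1 - {0} \<Longrightarrow> V x = q (norm x)" using V by (auto simp: radial_def)
  have eq: "V y = V x" if "y \<in> sphere 0 (norm x)" for y
  proof -
    have "norm y = norm x" using that by simp
    moreover from this have "y \<in> ball 0 1 - {0}" using x by auto
    ultimately show ?thesis using q[OF x] q[of y] by simp
  qed
  show ?thesis unfolding profile_def
  proof (rule the_equality)
    show "\<forall>y\<in>sphere 0 (norm x). V y = V x" using eq by blast
    show "c = V x" if "\<forall>y\<in>sphere 0 (norm x). V y = c" for c using that by simp
  qed
qed

text \<open>V agrees almost everywhere with a Borel function V' that need not be radial. Every dilation maps the
exceptional null set to a null set, so by Fubini almost every ray meets it in a null set. Along one such ray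
V' is a Borel representative of the profile.\<close>

lemma radial_borel_log_profile:
  fixes V :: "'a::euclidean_space \<Rightarrow> real"
  assumes V: "radial V"
    and m: "(\<lambda>x. indicator (ball 0 1 - {0}) x * V x) \<in> borel_measurable lebesgue"
  shows "\<exists>q\<in>borel_measurable borel. AE t in lborel. 0 < t \<longrightarrow> profile V (exp (- t)) = q t"
proof -
  obtain V' where V'[measurable]: "V' \<in> borel_measurable lborel"
    and ae: "AE x in lborel. indicator (ball 0 1 - {0}) x * V x = V' x"
    using completion_ex_borel_measurable_real[OF m] by blast
  obtain N where N0: "\<And>x. x \<in> space lborel - N \<Longrightarrow> indicator (ball 0 1 - {0}) x * V x = V' x"
      and N1: "N \<in> null_sets lborel"
    by (rule AE_E3[OF ae]) blast
  have N: "N \<in> null_sets lborel" "\<And>x. x \<notin> N \<Longrightarrow> indicator (ball 0 1 - {0}) x * V x = V' x"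
    using N0 N1 by auto
  have Nm[measurable]: "N \<in> sets borel" using N(1) by auto
  have ray: "AE x in lborel. exp (- s) *\<^sub>R x \<notin> N" for s
  proof -
    have eq: "lborel = density (distr lborel borel (\<lambda>x::'a. 0 + exp s *\<^sub>R x)) (\<lambda>_. ennreal (\<bar>exp s\<bar> ^ DIM('a)))"
      by (rule lborel_affine) simp
    have "AE x::'a in density (distr lborel borel (\<lambda>x::'a. 0 + exp s *\<^sub>R x)) (\<lambda>_. ennreal (\<bar>exp s\<bar> ^ DIM('a))). exp (- s) *\<^sub>R x \<notin> N"
    proof -
      have "AE x::'a in distr lborel borel (\<lambda>x::'a. 0 + exp s *\<^sub>R x). exp (- s) *\<^sub>R x \<notin> N"
        using AE_not_in[OF N(1)] by (subst AE_distr_iff) (auto simp: exp_minus)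
      then show ?thesis by (subst AE_density) auto
    qed
    then show ?thesis by (rule ssubst[OF eq, where P="\<lambda>M. AE x in M. exp (- s) *\<^sub>R x \<notin> N"])
  qed
  have "AE x in lborel. AE s in lborel. exp (- s) *\<^sub>R (x::'a) \<notin> N"
  proof (subst lborel_pair.AE_commute)
    have "Measurable.pred (lborel \<Otimes>\<^sub>M lborel) (\<lambda>z. exp (- snd z) *\<^sub>R (fst z :: 'a) \<notin> N)"
      by measurable
    then show "{z \<in> space (lborel \<Otimes>\<^sub>M lborel). exp (- snd z) *\<^sub>R (fst z :: 'a) \<notin> N} \<in> sets (lborel \<Otimes>\<^sub>M lborel)"
      by (rule predE)
    show "AE s in lborel. AE x in lborel. exp (- s) *\<^sub>R (x::'a) \<notin> N"
      using ray by (intro always_eventually) blast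
  qed
  then have "AE x in lborel. x \<noteq> 0 \<and> (AE s in lborel. exp (- s) *\<^sub>R (x::'a) \<notin> N)"
    using AE_lborel_singleton[of "0::'a"] by eventually_elim auto
  then have "\<exists>x::'a. x \<noteq> 0 \<and> (AE s in lborel. exp (- s) *\<^sub>R x \<notin> N)"
  proof (rule contrapos_pp)
    assume n: "\<not> (\<exists>x::'a. x \<noteq> 0 \<and> (AE s in lborel. exp (- s) *\<^sub>R x \<notin> N))"
    show "\<not> (AE x in lborel. x \<noteq> 0 \<and> (AE s in lborel. exp (- s) *\<^sub>R (x::'a) \<notin> N))"
    proof
      assume "AE x in lborel. x \<noteq> 0 \<and> (AE s in lborel. exp (- s) *\<^sub>R (x::'a) \<notin> N)"
      then have "AE x::'a in lborel. False" by (rule AE_mp) (use n in auto)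
      then have "emeasure lborel (UNIV :: 'a set) = 0" by (simp add: AE_iff_null null_sets_def)
      then show False by simp
    qed
  qed
  then obtain x0 :: 'a where x0: "x0 \<noteq> 0" "AE s in lborel. exp (- s) *\<^sub>R x0 \<notin> N" by blast
  define \<rho> where "\<rho> = ln (norm x0)"
  have "AE t in lborel. exp (- (\<rho> + 1 * t)) *\<^sub>R x0 \<notin> N"
    by (rule AE_borel_affine[OF _ _ x0(2)]) auto
  then have "AE t in lborel. 0 < t \<longrightarrow> profile V (exp (- t)) = V' (exp (- (\<rho> + t)) *\<^sub>R x0)"
  proof eventually_elim
    case (elim t)
    show ?case
    proof
      assume t: "0 < t"
      let ?x = "exp (- (\<rho> + t)) *\<^sub>R x0"
      have nx: "norm ?x = exp (- t)" using x0(1) by (simp add: \<rho>_def exp_diff exp_minus divide_inverse)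
      then have b: "?x \<in> ball 0 1 - {0}" using t x0 by auto
      have "profile V (exp (- t)) = V ?x" using profile_eq[OF V b] nx by simp
      then show "profile V (exp (- t)) = V' ?x" using N(2)[of ?x] elim b by simp
    qed
  qed
  then show ?thesis by (intro bexI[of _ "\<lambda>t. V' (exp (- (\<rho> + t)) *\<^sub>R x0)"]) auto
qed

lemma radial_AE_profile:
  fixes V :: "'a::euclidean_space \<Rightarrow> real"
  assumes V: "radial V" and q: "AE t in lborel. 0 < t \<longrightarrow> profile V (exp (- t)) = q t"
  shows "AE x in lborel. x \<in> ball 0 1 \<longrightarrow> V x = q (logr x)"
  using AE_logr[OF q] AE_lborel_singleton[of "0::'a"]
proof eventually_elim
  case (elim x)
  show ?case
  proof
    assume x: "x \<in> ball 0 1"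
    then have "0 < logr x" using elim(2) by (simp add: logr_def)
    then show "V x = q (logr x)"
      using elim x profile_eq[OF V, of x] by (simp add: exp_logr)
  qed
qed

lemma shell_iff_logr:
  assumes "0 < r1" "0 < r2" "x \<noteq> (0::'a::euclidean_space)"
  shows "x \<in> shell r1 r2 \<longleftrightarrow> logr x \<in> {- ln r2<..<- ln r1}"
proof -
  have "norm x = exp (- logr x)" using exp_logr[OF assms(3)] by simp
  moreover have "r1 = exp (ln r1)" "r2 = exp (ln r2)" using assms by auto
  ultimately show ?thesis unfolding shell_def
    by (metis (no_types, lifting) exp_less_cancel_iff greaterThanLessThan_iff mem_Collect_eq minus_less_iff less_minus_iff)
qed

lemma shell_borel [measurable]: "shell r1 r2 \<in> sets borel"
  unfolding shell_def by measurable

lemma nn_integral_shell: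
  fixes f :: "'a::euclidean_space \<Rightarrow> ennreal"
  assumes g[measurable]: "g \<in> borel_measurable borel"
    and ae: "AE x in lborel. x \<in> ball 0 1 \<longrightarrow> f x = g (logr x)" and r: "0 < r1" "0 < r2" "r2 \<le> 1"
  shows "(\<integral>\<^sup>+x. f x \<partial>lebesgue_on (shell r1 r2))
     = (\<integral>\<^sup>+t. ennreal (sphere_area DIM('a) * exp (- real DIM('a) * t)) * (g t * indicator {- ln r2<..<- ln r1} t) \<partial>lborel)"
proof -
  have "(\<integral>\<^sup>+x. f x \<partial>lebesgue_on (shell r1 r2)) = (\<integral>\<^sup>+x. f x * indicator (shell r1 r2) x \<partial>lebesgue)"
    by (intro nn_integral_restrict_space) auto
  also have "\<dots> = (\<integral>\<^sup>+x. (g (logr x) * indicator {- ln r2<..<- ln r1} (logr x)) * indicator (- {0::'a}) x \<partial>lebesgue)"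
  proof (rule nn_integral_cong_AE)
    have "AE x in lborel. f x * indicator (shell r1 r2) x
        = (g (logr x) * indicator {- ln r2<..<- ln r1} (logr x)) * indicator (- {0}) x"
      using ae AE_lborel_singleton[of "0::'a"]
    proof eventually_elim
      case (elim x)
      have "x \<in> shell r1 r2 \<Longrightarrow> x \<in> ball 0 1" using r by (auto simp: shell_def)
      then show ?case using elim shell_iff_logr[OF r(1,2) elim(2)] by (auto simp: indicator_def)
    qed
    then show "AE x in lebesgue. f x * indicator (shell r1 r2) x
        = (g (logr x) * indicator {- ln r2<..<- ln r1} (logr x)) * indicator (- {0}) x"
      by (rule AE_completion)
  qed
  also have "\<dots> = (\<integral>\<^sup>+x. (g (logr x) * indicator {- ln r2<..<- ln r1} (logr x)) * indicator (- {0::'a}) x \<partial>lborel)"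
    by (rule nn_integral_completion) measurable
  also have "\<dots> = (\<integral>\<^sup>+t. ennreal (sphere_area DIM('a) * exp (- real DIM('a) * t)) * (g t * indicator {- ln r2<..<- ln r1} t) \<partial>lborel)"
    using polar_nn_integral[of "- {0::'a}", OF full_cone, of "\<lambda>t. g t * indicator {- ln r2<..<- ln r1} t"]
    by (simp add: cone_const_full)
  finally show ?thesis .
qed

lemma radial_ball_measurable_from_compacts:
  fixes V :: "'a::euclidean_space \<Rightarrow> real"
  assumes "\<And>K. compact K \<Longrightarrow> K \<subseteq> ball 0 1 - {0} \<Longrightarrow> V absolutely_integrable_on K"
  shows "(\<lambda>x. indicator (ball 0 1 - {0}) x * V x) \<in> borel_measurable lebesgue"
proof (rule borel_measurable_LIMSEQ_real)
  define K where "K n = cball (0::'a) (1 - 1 / (real n + 2)) - ball 0 (1 / (real n + 2))" for n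
  have K: "K n \<subseteq> ball 0 1 - {0}" for n
  proof
    fix x assume "x \<in> K n"
    then have "norm x \<le> 1 - 1 / (real n + 2)" "1 / (real n + 2) \<le> norm x" by (auto simp: K_def)
    moreover have "0 < 1 / (real n + 2)" by simp
    ultimately have "norm x < 1" "0 < norm x" by linarith+
    then show "x \<in> ball 0 1 - {0}" by auto
  qed
  show "(\<lambda>x. indicator (K n) x * V x) \<in> borel_measurable lebesgue" for n
  proof -
    have "compact (K n)" unfolding K_def by (intro compact_diff compact_cball open_ball)
    moreover have "K n \<subseteq> ball 0 1 - {0}"
      using K by blast
    ultimately have "V absolutely_integrable_on K n" by (rule assms)
    then show ?thesis using borel_measurable_integrable unfolding set_integrable_def by fastforce
  qed
  show "(\<lambda>n. indicator (K n) x * V x) \<longlonglongrightarrow> indicator (ball 0 1 - {0}) x * V x" for x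
  proof (cases "x \<in> ball 0 1 - {0}")
    case True
    then have p: "0 < min (norm x) (1 - norm x)" by auto
    obtain N :: nat where N: "1 / min (norm x) (1 - norm x) < real N" using reals_Archimedean2 by blast
    have "x \<in> K n" if "N \<le> n" for n
    proof -
      have "1 / min (norm x) (1 - norm x) < real n + 2" using N that by linarith
      then have "1 < (real n + 2) * min (norm x) (1 - norm x)" using p by (simp add: divide_less_eq)
      then have "1 / (real n + 2) < min (norm x) (1 - norm x)"
        by (intro mult_imp_div_pos_less) (simp, simp only: mult.commute)
      then show ?thesis by (auto simp: K_def)
    qed
    then have "eventually (\<lambda>n. indicator (K n) x * V x = indicator (ball 0 1 - {0}) x * V x) sequentially"
      using True by (intro eventually_sequentiallyI[of N]) auto
    then show ?thesis by (rule tendsto_eventually)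
  next
    case False
    have "x \<notin> K n" for n
      using False K by blast
    then show ?thesis using False by simp
  qed
qed

section \<open>Uniformly local bounds from dyadic shells\<close>

lemma nn_integral_exp_abs: "(\<integral>\<^sup>+y. ennreal (exp (- \<bar>t - y\<bar>)) \<partial>lborel) \<le> 2"
proof -
  have "(\<integral>\<^sup>+y. ennreal (exp (- \<bar>t - y\<bar>)) \<partial>lborel)
    \<le> (\<integral>\<^sup>+y. ennreal (exp (- t)) * (ennreal (exp (1 * y)) * indicator {..t} y)
         + ennreal (exp t) * (ennreal (exp (- 1 * y)) * indicator {t..} y) \<partial>lborel)"
  proof (intro nn_integral_mono)
    fix y
    show "ennreal (exp (- \<bar>t - y\<bar>)) \<le> ennreal (exp (- t)) * (ennreal (exp (1 * y)) * indicator {..t} y)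
         + ennreal (exp t) * (ennreal (exp (- 1 * y)) * indicator {t..} y)"
    proof (cases "y < t")
      case True
      then have "exp (- \<bar>t - y\<bar>) = exp (- t) * exp (1 * y)" by (simp add: exp_add[symmetric])
      then show ?thesis using True by (simp only: ennreal_mult' exp_ge_zero) simp
    next
      case False
      then have "exp (- \<bar>t - y\<bar>) = exp t * exp (- 1 * y)" by (simp add: exp_add[symmetric])
      then show ?thesis using False by (simp only: ennreal_mult' exp_ge_zero) simp
    qed
  qed
  also have "\<dots> = ennreal (exp (- t)) * ennreal (exp (1 * t) / 1) + ennreal (exp t) * ennreal (exp (- 1 * t) / 1)"
    using nn_integral_exp_atMost[of 1 t] nn_integral_exp_atLeast[of 1 t]
    by (subst nn_integral_add) (auto simp: nn_integral_cmult)
  also have "\<dots> = 2" by (simp add: ennreal_mult'[symmetric] exp_add[symmetric])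
  finally show ?thesis .
qed

text \<open>On a window of length L the weight e^(-|t - x|) varies by a factor of at most e^L, so it may be
replaced by a multiple of its mean over the window. The means add up to the integral of e^(-|t - y|), which is 2.\<close>

lemma unif_loc_from_windows:
  assumes Qm[measurable]: "Q \<in> borel_measurable borel" and Q0: "\<And>x. x < 0 \<Longrightarrow> Q x = 0"
    and L: "0 < L" "exp L \<le> E" and D: "0 \<le> D"
    and win: "\<And>j::nat. (\<integral>\<^sup>+x. ennreal \<bar>Q x\<bar> * indicator {real j * L..<real (Suc j) * L} x \<partial>lborel) \<le> ennreal D"
  shows "unif_loc Q (2 * (E / L) * D)"
proof -
  let ?I = "\<lambda>j. {real j * L..<real (Suc j) * L}"
  have E0: "0 \<le> E" using L(2) exp_gt_zero[of L] by linarith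
  have disj: "disjoint_family ?I"
  proof -
    have "?I i \<inter> ?I j = {}" if "i < j" for i j
    proof -
      have "real (Suc i) * L \<le> real j * L" using that L by (intro mult_right_mono) auto
      then show ?thesis by auto
    qed
    then show ?thesis unfolding disjoint_family_on_def by (metis Int_commute nat_neq_iff)
  qed
  have cover: "\<exists>j. x \<in> ?I j" if "0 \<le> x" for x
  proof
    let ?j = "nat \<lfloor>x / L\<rfloor>"
    have "0 \<le> x / L" using that L by simp
    then have "real ?j \<le> x / L" "x / L < real ?j + 1" by linarith+
    then show "x \<in> ?I ?j" using L by (simp add: field_simps)
  qed
  have main: "(\<integral>\<^sup>+x. ennreal (\<bar>Q x\<bar> * exp (- \<bar>t - x\<bar>)) \<partial>lborel) \<le> ennreal (2 * (E / L) * D)" for t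
  proof -
    let ?c = "\<lambda>j. \<integral>\<^sup>+y. ennreal (exp (- \<bar>t - y\<bar>)) * indicator (?I j) y \<partial>lborel"
    have avg: "ennreal (exp (- \<bar>t - x\<bar>)) \<le> ennreal (E / L) * ?c j" if x: "x \<in> ?I j" for x j
    proof -
      have "ennreal (exp (- \<bar>t - x\<bar>)) * ennreal L = (\<integral>\<^sup>+y. ennreal (exp (- \<bar>t - x\<bar>)) * indicator (?I j) y \<partial>lborel)"
        using L by (subst nn_integral_cmult) (auto simp: algebra_simps)
      also have "\<dots> \<le> (\<integral>\<^sup>+y. ennreal E * (ennreal (exp (- \<bar>t - y\<bar>)) * indicator (?I j) y) \<partial>lborel)"
      proof (intro nn_integral_mono)
        fix y
        show "ennreal (exp (- \<bar>t - x\<bar>)) * indicator (?I j) y \<le> ennreal E * (ennreal (exp (- \<bar>t - y\<bar>)) * indicator (?I j) y)"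
        proof (cases "y \<in> ?I j")
          case True
          then have "\<bar>x - y\<bar> \<le> L" using x by (auto simp: algebra_simps)
          then have "exp (- \<bar>t - x\<bar>) \<le> exp L * exp (- \<bar>t - y\<bar>)" by (simp add: exp_add[symmetric])
          also have "\<dots> \<le> E * exp (- \<bar>t - y\<bar>)" using L by (intro mult_right_mono) auto
          finally show ?thesis using True E0 by (simp add: ennreal_mult'[symmetric] ennreal_leI)
        qed simp
      qed
      also have "\<dots> = ennreal E * ?c j" by (subst nn_integral_cmult) auto
      finally have a: "ennreal (exp (- \<bar>t - x\<bar>)) * ennreal L \<le> ennreal E * ?c j" .
      have "ennreal (exp (- \<bar>t - x\<bar>)) = (ennreal (exp (- \<bar>t - x\<bar>)) * ennreal L) * ennreal (1 / L)"
        using L by (simp add: ennreal_mult''[symmetric] ennreal_mult'[symmetric])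
      also have "\<dots> \<le> (ennreal E * ?c j) * ennreal (1 / L)" by (intro mult_right_mono a) auto
      also have "\<dots> = (ennreal E * ennreal (1 / L)) * ?c j" by (simp only: mult_ac)
      also have "ennreal E * ennreal (1 / L) = ennreal (E / L)"
        using E0 L by (simp add: ennreal_mult'[symmetric])
      finally show ?thesis .
    qed
    have "(\<integral>\<^sup>+x. ennreal (\<bar>Q x\<bar> * exp (- \<bar>t - x\<bar>)) \<partial>lborel)
        \<le> (\<integral>\<^sup>+x. (\<Sum>j. (ennreal (E / L) * ?c j) * (ennreal \<bar>Q x\<bar> * indicator (?I j) x)) \<partial>lborel)"
    proof (intro nn_integral_mono)
      fix x
      show "ennreal (\<bar>Q x\<bar> * exp (- \<bar>t - x\<bar>)) \<le> (\<Sum>j. (ennreal (E / L) * ?c j) * (ennreal \<bar>Q x\<bar> * indicator (?I j) x))"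
      proof (cases "x < 0")
        case False
        then obtain j where j: "x \<in> ?I j" using cover[of x] by auto
        have "ennreal (\<bar>Q x\<bar> * exp (- \<bar>t - x\<bar>)) = ennreal (exp (- \<bar>t - x\<bar>)) * ennreal \<bar>Q x\<bar>"
          by (simp add: ennreal_mult' mult.commute)
        also have "\<dots> \<le> (ennreal (E / L) * ?c j) * ennreal \<bar>Q x\<bar>" by (intro mult_right_mono avg[OF j]) auto
        also have "\<dots> = (\<Sum>j. ((ennreal (E / L) * ?c j) * ennreal \<bar>Q x\<bar>) * indicator (?I j) x)"
          by (rule suminf_cmult_indicator[OF disj j, symmetric])
        finally show ?thesis by (simp only: mult.assoc)
      qed (simp add: Q0)
    qed
    also have "\<dots> = (\<Sum>j. (ennreal (E / L) * ?c j) * (\<integral>\<^sup>+x. ennreal \<bar>Q x\<bar> * indicator (?I j) x \<partial>lborel))"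
      by (subst nn_integral_suminf) (auto simp: nn_integral_cmult)
    also have "\<dots> \<le> (\<Sum>j. (ennreal (E / L) * ?c j) * ennreal D)"
      by (intro suminf_le mult_left_mono win) auto
    also have "\<dots> = ennreal (E / L) * ennreal D * (\<Sum>j. ?c j)"
      by (simp add: mult_ac ennreal_suminf_cmult flip: mult.assoc)
    also have "(\<Sum>j. ?c j) = (\<integral>\<^sup>+y. (\<Sum>j. ennreal (exp (- \<bar>t - y\<bar>)) * indicator (?I j) y) \<partial>lborel)"
      by (subst nn_integral_suminf) auto
    also have "\<dots> \<le> (\<integral>\<^sup>+y. ennreal (exp (- \<bar>t - y\<bar>)) \<partial>lborel)"
    proof (intro nn_integral_mono)
      fix y
      show "(\<Sum>j. ennreal (exp (- \<bar>t - y\<bar>)) * indicator (?I j) y) \<le> ennreal (exp (- \<bar>t - y\<bar>))"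
      proof (cases "\<exists>j. y \<in> ?I j")
        case True
        then obtain j where j: "y \<in> ?I j" by blast
        have "(\<Sum>j. ennreal (exp (- \<bar>t - y\<bar>)) * indicator (?I j) y) = ennreal (exp (- \<bar>t - y\<bar>))"
          by (rule suminf_cmult_indicator[OF disj j])
        then show ?thesis by (simp only: order_refl)
      next
        case False
        then have "indicator (?I j) y = (0::ennreal)" for j by (intro indicator_simps(2)) blast
        then show ?thesis by (simp only: mult_zero_right suminf_zero zero_le)
      qed
    qed
    also have "\<dots> \<le> 2" by (rule nn_integral_exp_abs)
    finally have "(\<integral>\<^sup>+x. ennreal (\<bar>Q x\<bar> * exp (- \<bar>t - x\<bar>)) \<partial>lborel) \<le> ennreal (E / L) * ennreal D * 2"
      by (simp add: mult_left_mono)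
    also have "\<dots> = ennreal (2 * (E / L) * D)"
      using E0 L D by (simp add: ennreal_mult'[symmetric] ennreal_mult''[symmetric] mult_ac flip: ennreal_numeral)
    finally show ?thesis .
  qed
  show ?thesis unfolding unif_loc_def using main Q0 E0 L D by auto
qed

text \<open>Q is the half-line potential that belongs to the profile q: the substitution r = e^(-t) turns r^2 q(r) into Q(t).\<close>

abbreviation log_rep :: "(real \<Rightarrow> real) \<Rightarrow> (real \<Rightarrow> real) \<Rightarrow> bool" where
  "log_rep q Q \<equiv> AE t in lborel. 0 < t \<longrightarrow> q (exp (- t)) = exp (2 * t) * Q t"

lemma norm_powi_logr:
  assumes "x \<noteq> (0::'a::euclidean_space)"
  shows "norm x powi n = exp (- real_of_int n * logr x)"
proof -
  have "norm x powi n = norm x powr real_of_int n" using assms by (intro powr_real_of_int'[symmetric]) auto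
  then show ?thesis using assms by (simp add: powr_def logr_def)
qed

text \<open>The dyadic shells become windows of length ln 2, and the factor |x|^(2 - d) together with the volume
element turns |V| dx into |Q| dt, up to the area of the sphere.\<close>

lemma V_space_log_potential:
  fixes V :: "'a::euclidean_space \<Rightarrow> real"
  assumes V: "V \<in> V_space"
  shows "\<exists>Q B. unif_loc Q B \<and> log_rep (profile V) Q"
proof -
  have rad: "radial V" and ac: "\<And>K. compact K \<Longrightarrow> K \<subseteq> ball 0 1 - {0} \<Longrightarrow> V absolutely_integrable_on K"
    and fin: "V_norm V < \<infinity>" using V by (auto simp: V_space_def)
  obtain q where q[measurable]: "q \<in> borel_measurable borel"
    and aq: "AE t in lborel. 0 < t \<longrightarrow> profile V (exp (- t)) = q t"
    using radial_borel_log_profile[OF rad radial_ball_measurable_from_compacts[OF ac]] by blast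
  define Q where "Q t = (if 0 < t then exp (- 2 * t) * q t else 0)" for t
  have Qm[measurable]: "Q \<in> borel_measurable borel" unfolding Q_def by measurable
  have aQ: "log_rep (profile V) Q"
    using aq by eventually_elim (auto simp: Q_def mult.assoc[symmetric] exp_add[symmetric])
  let ?S = "sphere_area DIM('a)"
  have S: "0 < ?S" by (simp add: sphere_area_def)
  obtain D where D: "V_norm V = ennreal D" "0 \<le> D" using fin by (cases "V_norm V") auto
  let ?g = "\<lambda>t. ennreal (\<bar>Q t\<bar> * exp (real DIM('a) * t))"
  have ae: "AE x in lborel. x \<in> ball 0 1 \<longrightarrow> ennreal (\<bar>V x\<bar> * norm x powi (2 - int DIM('a))) = ?g (logr x)"
    using radial_AE_profile[OF rad aQ] AE_lborel_singleton[of "0::'a"]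
  proof eventually_elim
    case (elim x)
    then show ?case
      by (auto simp: norm_powi_logr abs_mult mult_ac exp_add[symmetric] algebra_simps)
  qed
  have "(\<integral>\<^sup>+x. ennreal \<bar>Q x\<bar> * indicator {real j * ln 2..<real (Suc j) * ln 2} x \<partial>lborel) \<le> ennreal (D / ?S)" for j :: nat
  proof -
    let ?I = "{real j * ln 2<..<real (Suc j) * ln 2}"
    have l: "- ln (1 / 2 ^ j) = real j * ln (2::real)" "- ln (1 / 2 ^ (j + 1)) = real (Suc j) * ln (2::real)"
      by (simp_all only: ln_div zero_less_one zero_less_power zero_less_numeral ln_realpow ln_one) auto
    have "(\<integral>\<^sup>+x. ennreal (\<bar>V x\<bar> * norm x powi (2 - int DIM('a))) \<partial>lebesgue_on (shell (1 / 2 ^ (j + 1)) (1 / 2 ^ j)))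
       = (\<integral>\<^sup>+t. ennreal (?S * exp (- real DIM('a) * t)) * (?g t * indicator ?I t) \<partial>lborel)"
      by (subst nn_integral_shell[OF _ ae]) (simp_all only: l, simp_all)
    also have "\<dots> = (\<integral>\<^sup>+t. ennreal ?S * (ennreal \<bar>Q t\<bar> * indicator ?I t) \<partial>lborel)"
    proof (intro nn_integral_cong)
      fix t
      have "(?S * exp (- real DIM('a) * t)) * (\<bar>Q t\<bar> * exp (real DIM('a) * t)) = ?S * \<bar>Q t\<bar>"
        by (simp add: exp_minus)
      then have "ennreal (?S * exp (- real DIM('a) * t)) * ?g t = ennreal ?S * ennreal \<bar>Q t\<bar>"
        using S by (simp add: ennreal_mult'[symmetric] ennreal_mult''[symmetric])
      then show "ennreal (?S * exp (- real DIM('a) * t)) * (?g t * indicator ?I t) = ennreal ?S * (ennreal \<bar>Q t\<bar> * indicator ?I t)"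
        by (simp only: mult.assoc[symmetric])
    qed
    also have "\<dots> = ennreal ?S * (\<integral>\<^sup>+t. ennreal \<bar>Q t\<bar> * indicator ?I t \<partial>lborel)"
      by (rule nn_integral_cmult) measurable
    also have "(\<integral>\<^sup>+t. ennreal \<bar>Q t\<bar> * indicator ?I t \<partial>lborel) = (\<integral>\<^sup>+x. ennreal \<bar>Q x\<bar> * indicator {real j * ln 2..<real (Suc j) * ln 2} x \<partial>lborel)"
    proof (rule nn_integral_cong_AE)
      show "AE t in lborel. ennreal \<bar>Q t\<bar> * indicator ?I t = ennreal \<bar>Q t\<bar> * indicator {real j * ln 2..<real (Suc j) * ln 2} t"
        using AE_lborel_singleton[of "real j * ln 2"] by eventually_elim (auto simp: indicator_def)
    qed
    finally have e: "ennreal ?S * (\<integral>\<^sup>+x. ennreal \<bar>Q x\<bar> * indicator {real j * ln 2..<real (Suc j) * ln 2} x \<partial>lborel)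
       = (\<integral>\<^sup>+x. ennreal (\<bar>V x\<bar> * norm x powi (2 - int DIM('a))) \<partial>lebesgue_on (shell (1 / 2 ^ (j + 1)) (1 / 2 ^ j)))" ..
    have "\<dots> \<le> V_norm V" unfolding V_norm_def by (rule SUP_upper) simp
    then have le: "ennreal ?S * (\<integral>\<^sup>+x. ennreal \<bar>Q x\<bar> * indicator {real j * ln 2..<real (Suc j) * ln 2} x \<partial>lborel) \<le> ennreal D"
      unfolding e[symmetric] D .
    let ?J = "\<integral>\<^sup>+x. ennreal \<bar>Q x\<bar> * indicator {real j * ln 2..<real (Suc j) * ln 2} x \<partial>lborel"
    have "?J = ennreal (1 / ?S) * (ennreal ?S * ?J)"
      using S by (simp add: mult.assoc[symmetric] ennreal_mult'[symmetric])
    also have "\<dots> \<le> ennreal (1 / ?S) * ennreal D" by (intro mult_left_mono le) auto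
    also have "\<dots> = ennreal (D / ?S)" using S D by (simp add: ennreal_mult'[symmetric])
    finally show ?thesis .
  qed
  then have "unif_loc Q (2 * (2 / ln 2) * (D / ?S))"
    using S D by (intro unif_loc_from_windows) (auto simp: Q_def)
  then show ?thesis using aQ by blast
qed

section \<open>The radial equation in the logarithmic variable\<close>

lemma log_change_of_variables:
  fixes g :: "real \<Rightarrow> real"
  assumes r: "0 < r" "r \<le> 1"
  shows "g absolutely_integrable_on {r..1} \<and> integral {r..1} g = b \<longleftrightarrow>
    (\<lambda>t. exp (- t) * g (exp (- t))) absolutely_integrable_on {0..- ln r} \<and>
     integral {0..- ln r} (\<lambda>t. exp (- t) * g (exp (- t))) = b"
proof -
  have im: "(\<lambda>t. exp (- t)) ` {0..- ln r} = {r..1}"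
  proof (intro equalityI subsetI)
    fix x assume "x \<in> (\<lambda>t. exp (- t)) ` {0..- ln r}"
    then obtain t where "x = exp (- t)" "0 \<le> t" "ln r \<le> - t" by auto
    moreover have "exp (ln r) \<le> exp (- t)" using calculation by simp
    ultimately show "x \<in> {r..1}" using r by auto
  next
    fix x assume x: "x \<in> {r..1}"
    then have "- ln x \<in> {0..- ln r}" "x = exp (- (- ln x))" using r by auto
    then show "x \<in> (\<lambda>t. exp (- t)) ` {0..- ln r}" by blast
  qed
  have "(\<lambda>t. \<bar>- exp (- t)\<bar> * g (exp (- t))) absolutely_integrable_on {0..- ln r} \<and>
     integral {0..- ln r} (\<lambda>t. \<bar>- exp (- t)\<bar> * g (exp (- t))) = b \<longleftrightarrow>
     g absolutely_integrable_on (\<lambda>t. exp (- t)) ` {0..- ln r} \<and> integral ((\<lambda>t. exp (- t)) ` {0..- ln r}) g = b"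
    by (rule has_absolute_integral_change_of_variables_1')
       (auto intro!: derivative_eq_intros inj_onI)
  then show ?thesis unfolding im by simp
qed

lemma abs_integrable_Icc_AE_cong:
  fixes f g :: "real \<Rightarrow> real"
  assumes ae: "AE t in lborel. 0 < t \<longrightarrow> f t = g t"
  shows "f absolutely_integrable_on {0..T} \<longleftrightarrow> g absolutely_integrable_on {0..T}"
    and "integral {0..T} f = integral {0..T} g"
proof -
  have "AE t in lborel. 0 \<le> t \<longrightarrow> f t = g t"
    using ae AE_lborel_singleton[of "0::real"] by eventually_elim (auto simp: less_le)
  then obtain N where N0: "\<And>x. x \<in> space lborel - N \<Longrightarrow> 0 \<le> x \<longrightarrow> f x = g x" and N1: "N \<in> null_sets lborel"
    by (rule AE_E3) blast
  have neg: "negligible N" using N1 by (simp add: negligible_iff_null_sets null_sets_completionI)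
  have fg: "f x = g x" "g x = f x" if "x \<in> {0..T} - N" for x using N0[of x] that by auto
  show "f absolutely_integrable_on {0..T} \<longleftrightarrow> g absolutely_integrable_on {0..T}"
    using fg by (intro absolutely_integrable_spike_eq[OF neg]) auto
  show "integral {0..T} f = integral {0..T} g"
    using fg by (intro integral_spike[OF neg]) auto
qed

lemma set_integrable_lborel_iff_abs_integrable:
  fixes f :: "real \<Rightarrow> real"
  assumes "(\<lambda>t. indicator A t * f t) \<in> borel_measurable borel"
  shows "set_integrable lborel A f \<longleftrightarrow> f absolutely_integrable_on A"
  unfolding set_integrable_def using assms by (subst integrable_completion) auto

text \<open>Minus the derivative of r^(d-1) v with respect to t = - ln r, for w(t) = u(r).\<close>

definition log_source :: "nat \<Rightarrow> nat \<Rightarrow> (real \<Rightarrow> real) \<Rightarrow> (real \<Rightarrow> real) \<Rightarrow> real \<Rightarrow> real" where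
  "log_source d k Q w t = exp (- (real d - 2) * t) * (real k * (real k + real d - 2) + Q t) * w t"

lemma log_source_eq:
  assumes d: "2 \<le> d" and q: "q (exp (- t)) = exp (2 * t) * Q t"
  shows "exp (- t) * (exp (- t) ^ (d - 1) * (real k * (real k + real d - 2) / (exp (- t))\<^sup>2 + q (exp (- t))) * u (exp (- t)))
     = log_source d k Q (\<lambda>t. u (exp (- t))) t"
proof -
  have "exp (- t) ^ (d - 1) = exp (- ((real d - 1) * t))"
    using d exp_of_nat_mult[of "d - 1" "- t", symmetric] by (simp add: of_nat_diff)
  then have e: "exp (- t) * exp (- t) ^ (d - 1) * exp (2 * t) = exp (- (real d - 2) * t)"
    by (simp add: exp_add[symmetric] algebra_simps)
  have k: "real k * (real k + real d - 2) / (exp (- t))\<^sup>2 = exp (2 * t) * (real k * (real k + real d - 2))"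
  proof -
    have "(exp (- t))\<^sup>2 = 1 / exp (2 * t)" by (simp add: power2_eq_square exp_add[symmetric] exp_minus inverse_eq_divide[symmetric] flip: inverse_mult_distrib)
    then show ?thesis by simp
  qed
  have "exp (- t) * (exp (- t) ^ (d - 1) * (exp (2 * t) * (real k * (real k + real d - 2)) + exp (2 * t) * Q t) * u (exp (- t)))
    = (exp (- t) * exp (- t) ^ (d - 1) * exp (2 * t)) * (real k * (real k + real d - 2) + Q t) * u (exp (- t))"
    by (simp only: distrib_left mult_ac)
  then show ?thesis unfolding k q e log_source_def .
qed

lemma radial_solution_iff_log:
  fixes u v q Q :: "real \<Rightarrow> real"
  assumes d: "2 \<le> d" and Qm: "Q \<in> borel_measurable borel"
    and ae: "log_rep q Q"
  shows "radial_solution d k q u v \<longleftrightarrow>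
    (\<forall>r\<in>{0<..1}. (u has_real_derivative v r) (at r within {0<..1})) \<and>
    primitive (\<lambda>t. exp (- t) ^ (d - 1) * v (exp (- t))) (\<lambda>t. - 1 * log_source d k Q (\<lambda>t. u (exp (- t))) t)"
    (is "_ \<longleftrightarrow> ?D \<and> primitive ?p _")
proof -
  let ?w = "\<lambda>t. u (exp (- t))"
  let ?G = "log_source d k Q ?w"
  define g where "g s = s ^ (d - 1) * (real k * (real k + real d - 2) / s\<^sup>2 + q s) * u s" for s
  have gG: "AE t in lborel. 0 < t \<longrightarrow> exp (- t) * g (exp (- t)) = ?G t"
    using ae
  proof eventually_elim
    case (elim t)
    then show ?case unfolding g_def using log_source_eq[OF d, of q t Q k u] by blast
  qed
  have rs: "radial_solution d k q u v \<longleftrightarrow> ?D \<and> (\<forall>r\<in>{0<..1}. g absolutely_integrable_on {r..1} \<and> integral {r..1} g = v 1 - r ^ (d - 1) * v r)"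
    unfolding radial_solution_def Let_def g_def by auto
  have "(\<forall>r\<in>{0<..1}. g absolutely_integrable_on {r..1} \<and> integral {r..1} g = v 1 - r ^ (d - 1) * v r)
     \<longleftrightarrow> (\<forall>t\<ge>0. g absolutely_integrable_on {exp (- t)..1} \<and> integral {exp (- t)..1} g = v 1 - ?p t)"
  proof (intro iffI ballI allI impI)
    fix t :: real assume "\<forall>r\<in>{0<..1}. g absolutely_integrable_on {r..1} \<and> integral {r..1} g = v 1 - r ^ (d - 1) * v r" "0 \<le> t"
    then show "g absolutely_integrable_on {exp (- t)..1} \<and> integral {exp (- t)..1} g = v 1 - ?p t" by auto
  next
    fix r :: real assume *: "\<forall>t\<ge>0. g absolutely_integrable_on {exp (- t)..1} \<and> integral {exp (- t)..1} g = v 1 - ?p t" "r \<in> {0<..1}"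
    then have "0 \<le> - ln r" "exp (- (- ln r)) = r" by auto
    then show "g absolutely_integrable_on {r..1} \<and> integral {r..1} g = v 1 - r ^ (d - 1) * v r"
      using *(1) by metis
  qed
  also have "\<dots> \<longleftrightarrow> (\<forall>t\<ge>0. ?G absolutely_integrable_on {0..t} \<and> integral {0..t} ?G = ?p 0 - ?p t)"
  proof (intro all_cong1 imp_cong refl)
    fix t :: real assume t: "0 \<le> t"
    have "(g absolutely_integrable_on {exp (- t)..1} \<and> integral {exp (- t)..1} g = v 1 - ?p t)
      \<longleftrightarrow> (\<lambda>t. exp (- t) * g (exp (- t))) absolutely_integrable_on {0..t} \<and>
          integral {0..t} (\<lambda>t. exp (- t) * g (exp (- t))) = v 1 - ?p t"
      using log_change_of_variables[of "exp (- t)" g] t by simp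
    also have "\<dots> \<longleftrightarrow> ?G absolutely_integrable_on {0..t} \<and> integral {0..t} ?G = ?p 0 - ?p t"
      using abs_integrable_Icc_AE_cong[OF gG] by simp
    finally show "(g absolutely_integrable_on {exp (- t)..1} \<and> integral {exp (- t)..1} g = v 1 - ?p t)
      \<longleftrightarrow> ?G absolutely_integrable_on {0..t} \<and> integral {0..t} ?G = ?p 0 - ?p t" .
  qed
  finally have rs2: "radial_solution d k q u v \<longleftrightarrow> ?D \<and> (\<forall>t\<ge>0. ?G absolutely_integrable_on {0..t} \<and> integral {0..t} ?G = ?p 0 - ?p t)"
    unfolding rs by blast
  have "?D \<Longrightarrow> (\<forall>t\<ge>0. ?G absolutely_integrable_on {0..t} \<and> integral {0..t} ?G = ?p 0 - ?p t)
     \<longleftrightarrow> primitive ?p (\<lambda>t. - 1 * ?G t)"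
  proof -
    assume D: ?D
    have "continuous_on {0<..1} u" using D by (meson DERIV_continuous continuous_on_eq_continuous_within)
    then have wc: "continuous_on {0..} ?w"
      by (rule continuous_on_compose2) (auto intro!: continuous_intros)
    have Gm: "(\<lambda>x. indicator {0..t} x * ?G x) \<in> borel_measurable borel" for t
    proof -
      have [measurable]: "(\<lambda>x. indicator {0..} x * ?w x) \<in> borel_measurable borel" by (rule set_borel_measurable_halfline[OF wc])
      note [measurable] = Qm
      have "(\<lambda>x. indicator {0..t} x * (exp (- (real d - 2) * x) * (real k * (real k + real d - 2) + Q x)) * (indicator {0..} x * ?w x)) \<in> borel_measurable borel"
        by measurable
      also have "(\<lambda>x. indicator {0..t} x * (exp (- (real d - 2) * x) * (real k * (real k + real d - 2) + Q x)) * (indicator {0..} x * ?w x))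
        = (\<lambda>x. indicator {0..t} x * ?G x)"
        by (auto simp: fun_eq_iff log_source_def indicator_def)
      finally show ?thesis .
    qed
    show ?thesis unfolding primitive_def
    proof (intro all_cong1 imp_cong refl)
      fix t :: real assume t: "0 \<le> t"
      have 1: "set_integrable lborel {0..t} (\<lambda>t. - 1 * ?G t) \<longleftrightarrow> ?G absolutely_integrable_on {0..t}"
        using set_integrable_lborel_iff_abs_integrable[OF Gm[of t]]
        by (simp add: set_integrable_def)
      have 2: "(LBINT x:{0..t}. - 1 * ?G x) = - integral {0..t} ?G" if "?G absolutely_integrable_on {0..t}"
      proof -
        have "set_integrable lborel {0..t} ?G" using that set_integrable_lborel_iff_abs_integrable[OF Gm[of t]] by simp
        from set_borel_integral_eq_integral(2)[OF this] show ?thesis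
          by (simp add: set_lebesgue_integral_def)
      qed
      show "(?G absolutely_integrable_on {0..t} \<and> integral {0..t} ?G = ?p 0 - ?p t)
         \<longleftrightarrow> (set_integrable lborel {0..t} (\<lambda>t. - 1 * ?G t) \<and> ?p t = ?p 0 + (LBINT x:{0..t}. - 1 * ?G x))"
        using 1 2 by auto
    qed
  qed
  then show ?thesis using rs2 by blast
qed

text \<open>Liouville transform: the factor e^(-\<mu> t) removes the first-order term and shifts the spectral parameter
k (k + d - 2) by \<mu>^2, which completes the square (k + \<mu>)^2.\<close>

lemma radial_solution_to_halfline:
  fixes u v q Q :: "real \<Rightarrow> real" and k d :: nat
  assumes d: "2 \<le> d" and Qm: "Q \<in> borel_measurable borel"
    and ae: "log_rep q Q"
    and rs: "radial_solution d k q u v"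
  defines "\<mu> \<equiv> (real d - 2) / 2"
  shows "\<exists>\<psi>. primitive (\<lambda>t. exp (- \<mu> * t) * u (exp (- t))) \<psi>
    \<and> primitive \<psi> (\<lambda>t. ((real k + \<mu>)\<^sup>2 + Q t) * (exp (- \<mu> * t) * u (exp (- t))))
    \<and> \<psi> 0 = - \<mu> * u 1 - v 1"
proof -
  define p where "p t = exp (- t) ^ (d - 1) * v (exp (- t))" for t
  define w where "w t = u (exp (- t))" for t
  have D: "\<And>r. r \<in> {0<..1} \<Longrightarrow> (u has_real_derivative v r) (at r within {0<..1})"
    and P: "primitive p (\<lambda>t. - 1 * log_source d k Q w t)"
    using rs unfolding radial_solution_iff_log[OF d Qm ae] p_def w_def by blast+
  have m: "2 * \<mu> + 1 = real d - 1" by (simp add: \<mu>_def field_simps)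
  have e1: "exp (- t) ^ (d - 1) = exp (- ((2 * \<mu> + 1) * t))" for t
    unfolding m using exp_of_nat_mult[of "d - 1" "- t", symmetric] d by (simp add: of_nat_diff)
  have vp: "v (exp (- t)) = exp ((2 * \<mu> + 1) * t) * p t" for t
    unfolding p_def e1 by (simp add: mult.assoc[symmetric] exp_add[symmetric])
  have W: "primitive w (\<lambda>t. v (exp (- t)) * (- exp (- t)))"
  proof (rule primitive_C1)
    fix t :: real assume t: "0 \<le> t"
    have "(u has_real_derivative v (exp (- t))) (at (exp (- t)) within (\<lambda>t. exp (- t)) ` {0..})"
      using t by (intro DERIV_subset[OF D]) auto
    then have "(u \<circ> (\<lambda>t. exp (- t)) has_real_derivative v (exp (- t)) * (- exp (- t))) (at t within {0..})"
      by (rule DERIV_image_chain) (auto intro!: derivative_eq_intros)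
    then show "(w has_real_derivative v (exp (- t)) * (- exp (- t))) (at t within {0..})"
      by (simp add: w_def[abs_def] comp_def)
  next
    show "continuous_on {0..} (\<lambda>t. v (exp (- t)) * - exp (- t))"
      unfolding vp by (intro continuous_intros primitive_continuous[OF P])
  qed
  define \<phi> where "\<phi> t = exp (- \<mu> * t) * w t" for t
  define \<psi> where "\<psi> t = (- \<mu>) * \<phi> t - exp (\<mu> * t) * p t" for t
  have E: "primitive (\<lambda>t. exp (a * t)) (\<lambda>t. a * exp (a * t))" for a
    by (rule primitive_C1) (auto intro!: derivative_eq_intros continuous_intros)
  have \<phi>: "primitive \<phi> \<psi>"
  proof (rule primitive_cong[OF primitive_mult[OF E[of "-\<mu>"] W]])
    fix t
    have e: "exp (- \<mu> * t) * exp ((2 * \<mu> + 1) * t) * exp (- t) = exp (\<mu> * t)"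
      by (simp only: exp_add[symmetric]) (simp add: algebra_simps)
    have "exp (- \<mu> * t) * (v (exp (- t)) * - exp (- t)) = - ((exp (- \<mu> * t) * exp ((2 * \<mu> + 1) * t) * exp (- t)) * p t)"
      unfolding vp by (simp only: mult_minus_right mult_ac)
    then have "exp (- \<mu> * t) * (v (exp (- t)) * - exp (- t)) = - (exp (\<mu> * t) * p t)"
      unfolding e .
    then show "- \<mu> * exp (- \<mu> * t) * w t + exp (- \<mu> * t) * (v (exp (- t)) * - exp (- t)) = \<psi> t"
      unfolding \<psi>_def \<phi>_def by (simp add: mult.assoc)
  qed (simp add: \<phi>_def)
  have \<psi>: "primitive \<psi> (\<lambda>t. ((real k + \<mu>)\<^sup>2 + Q t) * \<phi> t)"
  proof (rule primitive_cong[OF primitive_diff[OF primitive_cmult[OF \<phi>, of "-\<mu>"] primitive_mult[OF E[of \<mu>] P]]])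
    fix t
    have "exp (\<mu> * t) * log_source d k Q w t = (real k * (real k + real d - 2) + Q t) * \<phi> t"
    proof -
      have e: "exp (- \<mu> * t) = exp (\<mu> * t) * exp (- (real d - 2) * t)"
        by (simp add: \<mu>_def exp_add[symmetric] field_simps)
      show ?thesis unfolding log_source_def \<phi>_def e by (simp only: mult_ac)
    qed
    moreover have "exp (\<mu> * t) * p t = - \<mu> * \<phi> t - \<psi> t" by (simp add: \<psi>_def)
    moreover have "real k * (real k + real d - 2) = (real k + \<mu>)\<^sup>2 - \<mu> * \<mu>"
      by (simp add: \<mu>_def power2_eq_square field_simps)
    ultimately have e: "exp (\<mu> * t) * log_source d k Q w t = ((real k + \<mu>)\<^sup>2 - \<mu> * \<mu> + Q t) * \<phi> t"
      "exp (\<mu> * t) * p t = - \<mu> * \<phi> t - \<psi> t"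
      by (simp_all only:)
    have "- \<mu> * \<psi> t - (\<mu> * exp (\<mu> * t) * p t + exp (\<mu> * t) * (- 1 * log_source d k Q w t))
      = - \<mu> * \<psi> t - \<mu> * (exp (\<mu> * t) * p t) + exp (\<mu> * t) * log_source d k Q w t"
      by (simp add: mult.assoc)
    also have "\<dots> = ((real k + \<mu>)\<^sup>2 + Q t) * \<phi> t"
      unfolding e by (simp add: algebra_simps)
    finally show "- \<mu> * \<psi> t - (\<mu> * exp (\<mu> * t) * p t + exp (\<mu> * t) * (- 1 * log_source d k Q w t))
      = ((real k + \<mu>)\<^sup>2 + Q t) * \<phi> t" .
  qed (simp add: \<psi>_def)
  have "\<psi> 0 = - \<mu> * u 1 - v 1" by (simp add: \<psi>_def \<phi>_def w_def p_def)
  then show ?thesis using \<phi> \<psi> unfolding \<phi>_def w_def by blast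
qed

lemma halfline_to_radial_solution:
  fixes \<phi> \<psi> q Q :: "real \<Rightarrow> real" and k d :: nat
  assumes d: "2 \<le> d" and Qm: "Q \<in> borel_measurable borel"
    and ae: "log_rep q Q"
  defines "\<mu> \<equiv> (real d - 2) / 2"
  assumes \<phi>: "primitive \<phi> \<psi>" and \<psi>: "primitive \<psi> (\<lambda>t. ((real k + \<mu>)\<^sup>2 + Q t) * \<phi> t)"
  shows "\<exists>v. radial_solution d k q (\<lambda>r. exp (\<mu> * (- ln r)) * \<phi> (- ln r)) v \<and> v 1 = - \<mu> * \<phi> 0 - \<psi> 0"
proof -
  define u where "u r = exp (\<mu> * (- ln r)) * \<phi> (- ln r)" for r
  define p where "p t = - 1 * (exp (- \<mu> * t) * (\<mu> * \<phi> t + \<psi> t))" for t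
  define v where "v r = (1 / r) ^ (d - 1) * p (- ln r)" for r
  have E: "primitive (\<lambda>t. exp (a * t)) (\<lambda>t. a * exp (a * t))" for a
    by (rule primitive_C1) (auto intro!: derivative_eq_intros continuous_intros)
  have m: "2 * \<mu> + 1 = real d - 1" by (simp add: \<mu>_def field_simps)
  have e1: "exp (- t) ^ (d - 1) = exp (- ((2 * \<mu> + 1) * t))" for t
    unfolding m using exp_of_nat_mult[of "d - 1" "- t", symmetric] d by (simp add: of_nat_diff)
  have pv: "exp (- t) ^ (d - 1) * v (exp (- t)) = p t" for t
    by (simp add: v_def power_one_over)
  have P: "primitive p (\<lambda>t. - 1 * log_source d k Q (\<lambda>t. u (exp (- t))) t)"
    unfolding p_def
  proof (rule primitive_cong[OF primitive_cmult[OF primitive_mult[OF E[of "-\<mu>"] primitive_add[OF primitive_cmult[OF \<phi>, of \<mu>] \<psi>]], of "-1"]])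
    fix t
    have "log_source d k Q (\<lambda>t. u (exp (- t))) t = exp (- \<mu> * t) * ((real k * (real k + real d - 2) + Q t) * \<phi> t)"
    proof -
      have "exp (- (real d - 2) * t) * exp (\<mu> * t) = exp (- \<mu> * t)"
        by (simp add: \<mu>_def exp_add[symmetric] field_simps)
      then show ?thesis unfolding log_source_def u_def by (simp add: mult_ac)
    qed
    moreover have "real k * (real k + real d - 2) = (real k + \<mu>)\<^sup>2 - \<mu> * \<mu>"
      by (simp add: \<mu>_def power2_eq_square field_simps)
    ultimately have "log_source d k Q (\<lambda>t. u (exp (- t))) t = exp (- \<mu> * t) * (((real k + \<mu>)\<^sup>2 - \<mu> * \<mu> + Q t) * \<phi> t)"
      by (simp only:)
    then show "- 1 * (- \<mu> * exp (- \<mu> * t) * (\<mu> * \<phi> t + \<psi> t) + exp (- \<mu> * t) * (\<mu> * \<psi> t + ((real k + \<mu>)\<^sup>2 + Q t) * \<phi> t))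
       = - 1 * log_source d k Q (\<lambda>t. u (exp (- t))) t"
      by (simp add: algebra_simps)
  qed simp
  have D: "(u has_real_derivative v r) (at r within {0<..1})" if r: "r \<in> {0<..1}" for r
  proof -
    let ?t = "- ln r"
    have t: "0 \<le> ?t" using r by auto
    have "((\<lambda>t. exp (\<mu> * t) * \<phi> t) has_real_derivative (\<mu> * exp (\<mu> * ?t) * \<phi> ?t + exp (\<mu> * ?t) * \<psi> ?t)) (at ?t within {0..})"
      using primitive_has_derivative[OF \<phi> primitive_continuous[OF \<psi>] t] by (auto intro!: derivative_eq_intros)
    then have "((\<lambda>t. exp (\<mu> * t) * \<phi> t) has_real_derivative (\<mu> * exp (\<mu> * ?t) * \<phi> ?t + exp (\<mu> * ?t) * \<psi> ?t)) (at ?t within (\<lambda>r. - ln r) ` {0<..1})"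
      by (rule DERIV_subset) auto
    then have "((\<lambda>t. exp (\<mu> * t) * \<phi> t) \<circ> (\<lambda>r. - ln r) has_real_derivative
        (\<mu> * exp (\<mu> * ?t) * \<phi> ?t + exp (\<mu> * ?t) * \<psi> ?t) * (- (1 / r))) (at r within {0<..1})"
      by (rule DERIV_image_chain) (use r in \<open>auto intro!: derivative_eq_intros\<close>)
    moreover have "(\<mu> * exp (\<mu> * ?t) * \<phi> ?t + exp (\<mu> * ?t) * \<psi> ?t) * (- (1 / r)) = v r"
    proof -
      have r': "1 / r = exp ?t" using r by (simp add: exp_minus inverse_eq_divide)
      have "(1 / r) ^ (d - 1) = exp ((2 * \<mu> + 1) * ?t)"
      proof -
        have "(1 / r) ^ (d - 1) = 1 / exp (- ?t) ^ (d - 1)" using r by (simp add: power_one_over)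
        also have "\<dots> = exp ((2 * \<mu> + 1) * ?t)" unfolding e1 by (simp only: exp_minus inverse_eq_divide) simp
        finally show ?thesis .
      qed
      then have "v r = - (exp ((2 * \<mu> + 1) * ?t) * exp (- \<mu> * ?t)) * (\<mu> * \<phi> ?t + \<psi> ?t)"
        by (simp add: v_def p_def)
      also have "exp ((2 * \<mu> + 1) * ?t) * exp (- \<mu> * ?t) = exp (\<mu> * ?t) * exp ?t"
        by (simp only: exp_add[symmetric]) (simp add: algebra_simps)
      finally show ?thesis unfolding r' by (simp add: algebra_simps)
    qed
    ultimately show ?thesis by (simp add: comp_def u_def[abs_def])
  qed
  have "radial_solution d k q u v"
    unfolding radial_solution_iff_log[OF d Qm ae] pv using D P by blast
  moreover have "v 1 = - \<mu> * \<phi> 0 - \<psi> 0" by (simp add: v_def p_def)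
  ultimately show ?thesis unfolding u_def by blast
qed

section \<open>Spherical harmonics and regular solutions\<close>

text \<open>The real part of (x_i + \<i> x_j)^k: a spherical harmonic of every degree, available as soon as
there are two coordinates.\<close>

definition planar_harmonic :: "'a::euclidean_space \<Rightarrow> 'a \<Rightarrow> nat \<Rightarrow> 'a \<Rightarrow> real" where
  "planar_harmonic i j k x = Re (Complex (x \<bullet> i) (x \<bullet> j) ^ k)"

lemma planar_harmonic_polynomial: "real_polynomial_function (planar_harmonic i j k)"
proof -
  have "real_polynomial_function (\<lambda>x. Re (Complex (x \<bullet> i) (x \<bullet> j) ^ k)) \<and>
        real_polynomial_function (\<lambda>x. Im (Complex (x \<bullet> i) (x \<bullet> j) ^ k))"
  proof (induction k)
    case (Suc k)
    have l: "real_polynomial_function (\<lambda>x. x \<bullet> i)" "real_polynomial_function (\<lambda>x. x \<bullet> j)"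
      by (auto intro!: real_polynomial_function.intros(1) bounded_linear_inner_left)
    from Suc l show ?case
      by (auto intro!: real_polynomial_function_diff real_polynomial_function.intros(3) real_polynomial_function.intros(4))
  qed (auto intro: real_polynomial_function.intros(2))
  then show ?thesis by (simp add: planar_harmonic_def[abs_def])
qed

lemma planar_harmonic_scale: "planar_harmonic i j k (c *\<^sub>R x) = c ^ k * planar_harmonic i j k x"
proof -
  have "Complex (c * (x \<bullet> i)) (c * (x \<bullet> j)) = of_real c * Complex (x \<bullet> i) (x \<bullet> j)"
    by (simp add: complex_eq_iff)
  then show ?thesis
    by (simp add: planar_harmonic_def power_mult_distrib del: of_real_power flip: of_real_power)
qed

lemma planar_harmonic_laplacian:
  assumes ij: "i \<in> Basis" "j \<in> Basis" "i \<noteq> j"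
  shows "laplacian (planar_harmonic i j k) x = 0"
proof -
  have der: "((\<lambda>t. Re (c * (z + of_real t * e) ^ n)) has_real_derivative
      Re (c * of_nat n * e * (z + of_real t * e) ^ (n - 1))) (at t)" for c z e :: complex and n t
  proof -
    have "((\<lambda>y. c * (z + y * e) ^ n) has_field_derivative c * of_nat n * e * (z + of_real t * e) ^ (n - 1)) (at (of_real t))"
      by (auto intro!: derivative_eq_intros)
    then have "((\<lambda>t. c * (z + of_real t * e) ^ n) has_vector_derivative c * of_nat n * e * (z + of_real t * e) ^ (n - 1)) (at t)"
      by (rule has_vector_derivative_real_field)
    then show ?thesis
      unfolding has_real_derivative_iff_has_vector_derivative
      by (rule bounded_linear.has_vector_derivative[OF bounded_linear_Re])
  qed
  let ?z = "Complex (x \<bullet> i) (x \<bullet> j)"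
  let ?e = "\<lambda>l. Complex (l \<bullet> i) (l \<bullet> j)"
  have second: "(deriv ^^ 2) (\<lambda>t. planar_harmonic i j k (x + t *\<^sub>R l)) 0
     = Re (of_nat k * of_nat (k - 1) * ?z ^ (k - 1 - 1) * (?e l)\<^sup>2)" for l
  proof -
    have "(\<lambda>t. planar_harmonic i j k (x + t *\<^sub>R l)) = (\<lambda>t. Re (1 * (?z + of_real t * ?e l) ^ k))"
    proof
      fix t
      have "Complex ((x + t *\<^sub>R l) \<bullet> i) ((x + t *\<^sub>R l) \<bullet> j) = ?z + of_real t * ?e l"
        by (simp add: complex_eq_iff inner_add_left)
      then show "planar_harmonic i j k (x + t *\<^sub>R l) = Re (1 * (?z + of_real t * ?e l) ^ k)"
        by (simp only: planar_harmonic_def mult_1)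
    qed
    moreover have "deriv (\<lambda>t. Re (1 * (?z + of_real t * ?e l) ^ k))
       = (\<lambda>t. Re (1 * of_nat k * ?e l * (?z + of_real t * ?e l) ^ (k - 1)))"
      by (rule ext, rule DERIV_imp_deriv[OF der])
    ultimately have "deriv (\<lambda>t. planar_harmonic i j k (x + t *\<^sub>R l))
       = (\<lambda>t. Re (1 * of_nat k * ?e l * (?z + of_real t * ?e l) ^ (k - 1)))"
      by simp
    then have "(deriv ^^ 2) (\<lambda>t. planar_harmonic i j k (x + t *\<^sub>R l)) 0
       = Re (1 * of_nat k * ?e l * of_nat (k - 1) * ?e l * (?z + of_real 0 * ?e l) ^ (k - 1 - 1))"
      using DERIV_imp_deriv[OF der[of "1 * of_nat k * ?e l" ?z "?e l" "k - 1" 0]]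
      by (simp only: numeral_2_eq_2 funpow.simps comp_apply id_apply)
    then show ?thesis by (simp add: power2_eq_square mult_ac)
  qed
  have "(\<Sum>l\<in>Basis. (?e l)\<^sup>2) = (\<Sum>l\<in>{i, j}. (?e l)\<^sup>2)"
  proof (rule sum.mono_neutral_right)
    show "\<forall>l\<in>Basis - {i, j}. (?e l)\<^sup>2 = 0"
      using ij by (auto simp: inner_Basis Complex_eq_0)
  qed (use ij in auto)
  also have "\<dots> = 0" using ij by (auto simp: inner_Basis power2_eq_square complex_eq_iff)
  finally have z: "(\<Sum>l\<in>Basis. (?e l)\<^sup>2) = 0" .
  have "laplacian (planar_harmonic i j k) x = Re (of_nat k * of_nat (k - 1) * ?z ^ (k - 1 - 1) * (\<Sum>l\<in>Basis. (?e l)\<^sup>2))"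
    unfolding laplacian_def second by (simp only: sum_distrib_left Re_sum)
  then show ?thesis unfolding z by simp
qed

lemma planar_harmonic_spherical:
  assumes "i \<in> Basis" "j \<in> Basis" "i \<noteq> j"
  shows "spherical_harmonic k (planar_harmonic i j k)"
  unfolding spherical_harmonic_def
  by (intro exI[of _ "planar_harmonic i j k"] conjI allI ballI refl planar_harmonic_polynomial
      planar_harmonic_scale planar_harmonic_laplacian[OF assms])

text \<open>Regularity speaks about the products of u with spherical harmonics. On the cone where
P(x) > |x|^k / 2 the harmonic P is bounded below, and the cone has positive measure since it is open and contains a
basis vector; so square integrability of u itself follows.\<close>

lemma regular_solution_L2:
  fixes V :: "'a::euclidean_space \<Rightarrow> real"
  assumes d: "2 \<le> DIM('a)" and reg: "regular_solution V k u v"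
    and cont: "continuous_on {0..} (\<lambda>t. exp (- ((real DIM('a) - 2) / 2) * t) * u (exp (- t)))"
  shows "set_integrable lborel {0..} (\<lambda>t. (exp (- ((real DIM('a) - 2) / 2) * t) * u (exp (- t)))\<^sup>2)"
proof -
  let ?d = "real DIM('a)"
  define \<phi> where "\<phi> t = exp (- ((?d - 2) / 2) * t) * u (exp (- t))" for t
  have [measurable]: "(\<lambda>t. indicator {0..} t * \<phi> t) \<in> borel_measurable borel"
    using set_borel_measurable_halfline[OF cont] unfolding \<phi>_def .
  obtain i j :: 'a where ij: "i \<in> Basis" "j \<in> Basis" "i \<noteq> j"
    using d by (metis card_le_Suc0_iff_eq finite_Basis not_less_eq_eq numeral_2_eq_2)
  define P where "P = planar_harmonic i j k"
  have Pc: "continuous_on UNIV P"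
    unfolding P_def by (intro continuous_at_imp_continuous_on ballI continuous_real_polymonial_function planar_harmonic_polynomial)
  \<comment> \<open>The origin is excluded because P is constant, and the inequality true there, when k = 0.\<close>
  define C where "C = {x. x \<noteq> 0 \<and> norm x ^ k / 2 < P x}"
  have Co: "open C"
    unfolding C_def by (intro open_Collect_conj open_Collect_neq open_Collect_less continuous_intros Pc) auto
  then have Cb[measurable]: "C \<in> sets borel" by auto
  have cone: "\<forall>x. \<forall>r>0. r *\<^sub>R x \<in> C \<longleftrightarrow> x \<in> C"
    unfolding C_def P_def by (auto simp: planar_harmonic_scale power_mult_distrib mult_less_cancel_left_pos field_simps)
  have C0: "0 \<notin> C" by (simp add: C_def)
  have pos: "0 < cone_const C"
  proof -
    have "Complex (i \<bullet> i) (i \<bullet> j) = 1" using ij by (simp add: complex_eq_iff inner_Basis)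
    then have "P i = 1" by (simp add: P_def planar_harmonic_def)
    then have "i \<in> C" using ij by (auto simp: C_def)
    then have "(1/2) *\<^sub>R i \<in> C \<inter> ball 0 1" using cone ij by auto
    then have nn: "\<not> negligible (C \<inter> ball 0 1)"
      using Co by (intro open_not_negligible) auto
    have "measure lborel (C \<inter> cball 0 1) \<noteq> 0"
    proof
      assume z: "measure lborel (C \<inter> cball 0 1) = 0"
      have "emeasure lborel (C \<inter> cball 0 1) \<le> emeasure lborel (cball (0::'a) 1)" by (intro emeasure_mono) auto
      also have "\<dots> < \<infinity>" by (simp add: emeasure_cball)
      finally have "emeasure lborel (C \<inter> cball 0 1) = 0"
        using z emeasure_eq_ennreal_measure[of lborel "C \<inter> cball 0 1"] by simp
      then have "C \<inter> cball 0 1 \<in> null_sets lebesgue" by (intro null_sets_completionI) (auto simp: null_sets_def)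
      then have "negligible (C \<inter> cball 0 1)" by (simp add: negligible_iff_null_sets)
      then have "negligible (C \<inter> ball 0 1)" by (rule negligible_subset) auto
      then show False using nn by simp
    qed
    then show ?thesis using d by (simp add: cone_const_def less_le)
  qed
  have "(\<lambda>x. (u (norm x) * P (x /\<^sub>R norm x))\<^sup>2 * norm x powi (-2)) absolutely_integrable_on ball 0 1"
    using reg planar_harmonic_spherical[OF ij, of k] unfolding regular_solution_def P_def by blast
  then have int: "integrable lebesgue (\<lambda>x. indicator (ball 0 1) x *\<^sub>R ((u (norm x) * P (x /\<^sub>R norm x))\<^sup>2 * norm x powi (-2)))"
    by (simp add: set_integrable_def)
  define f0 where "f0 t = ennreal (indicator {0<..} t * (indicator {0..} t * \<phi> t)\<^sup>2 * exp (?d * t))" for t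
  have [measurable]: "f0 \<in> borel_measurable borel" unfolding f0_def by measurable
  have "(\<integral>\<^sup>+x. f0 (logr x) * indicator C x \<partial>lborel) = (\<integral>\<^sup>+x. f0 (logr x) * indicator C x \<partial>lebesgue)"
    by (rule nn_integral_completion[symmetric]) measurable
  also have "\<dots> \<le> (\<integral>\<^sup>+x. 4 * ennreal (norm (indicator (ball 0 1) x *\<^sub>R ((u (norm x) * P (x /\<^sub>R norm x))\<^sup>2 * norm x powi (-2)))) \<partial>lebesgue)"
  proof (intro nn_integral_mono)
    fix x :: 'a
    show "f0 (logr x) * indicator C x \<le> 4 * ennreal (norm (indicator (ball 0 1) x *\<^sub>R ((u (norm x) * P (x /\<^sub>R norm x))\<^sup>2 * norm x powi (-2))))"
    proof (cases "x \<in> C \<and> 0 < logr x")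
      case True
      then have x: "x \<noteq> 0" "norm x ^ k / 2 < P x" by (auto simp: C_def)
      have nx: "norm x = exp (- logr x)" using exp_logr[OF x(1)] by simp
      have xb: "x \<in> ball 0 1" using True unfolding mem_ball_0 nx by simp
      have Px: "1/2 < P (x /\<^sub>R norm x)"
        using x unfolding P_def by (simp add: planar_harmonic_scale field_simps)
      then have "(1/2)\<^sup>2 \<le> (P (x /\<^sub>R norm x))\<^sup>2" by (intro power_mono) auto
      then have P4: "1 \<le> 4 * (P (x /\<^sub>R norm x))\<^sup>2" by (simp add: power2_eq_square)
      have e: "(\<phi> (logr x))\<^sup>2 * exp (?d * logr x) = (u (norm x))\<^sup>2 * norm x powi (-2)"
      proof -
        have "(exp (- ((?d - 2) / 2) * logr x))\<^sup>2 * exp (?d * logr x) = norm x powi (-2)"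
          unfolding norm_powi_logr[OF x(1)] power2_eq_square exp_add[symmetric] by (simp add: field_simps)
        moreover have "(\<phi> (logr x))\<^sup>2 * exp (?d * logr x) = (u (norm x))\<^sup>2 * ((exp (- ((?d - 2) / 2) * logr x))\<^sup>2 * exp (?d * logr x))"
          by (simp add: \<phi>_def nx power_mult_distrib)
        ultimately show ?thesis by simp
      qed
      have "f0 (logr x) * indicator C x = ennreal ((u (norm x))\<^sup>2 * norm x powi (-2))"
        using True by (simp add: f0_def e)
      also have "\<dots> \<le> ennreal ((u (norm x))\<^sup>2 * norm x powi (-2) * (4 * (P (x /\<^sub>R norm x))\<^sup>2))"
      proof (rule ennreal_leI)
        have "0 \<le> (u (norm x))\<^sup>2 * norm x powi (-2)" by (intro mult_nonneg_nonneg zero_le_power_int) auto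
        from mult_left_mono[OF P4 this]
        show "(u (norm x))\<^sup>2 * norm x powi (-2) \<le> (u (norm x))\<^sup>2 * norm x powi (-2) * (4 * (P (x /\<^sub>R norm x))\<^sup>2)"
          by (simp only: mult_1_right)
      qed
      also have "\<dots> = 4 * ennreal (norm (indicator (ball 0 1) x *\<^sub>R ((u (norm x) * P (x /\<^sub>R norm x))\<^sup>2 * norm x powi (-2))))"
      proof -
        have "(u (norm x))\<^sup>2 * norm x powi (-2) * (4 * (P (x /\<^sub>R norm x))\<^sup>2)
          = 4 * norm (indicator (ball 0 1) x *\<^sub>R ((u (norm x) * P (x /\<^sub>R norm x))\<^sup>2 * norm x powi (-2)))"
          using xb by (simp add: abs_mult power_mult_distrib power_int_abs[symmetric])
        then show ?thesis by (simp only: ennreal_mult' ennreal_numeral zero_le_numeral)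
      qed
      finally show ?thesis .
    next
      case False
      then have "f0 (logr x) * indicator C x = 0" by (auto simp: f0_def indicator_def)
      then show ?thesis by (simp only: zero_le)
    qed
  qed
  also have "\<dots> = 4 * (\<integral>\<^sup>+x. ennreal (norm (indicator (ball 0 1) x *\<^sub>R ((u (norm x) * P (x /\<^sub>R norm x))\<^sup>2 * norm x powi (-2)))) \<partial>lebesgue)"
    by (rule nn_integral_cmult) (use borel_measurable_integrable[OF int] in measurable)
  also have "\<dots> < \<infinity>"
    using int unfolding integrable_iff_bounded by (simp add: ennreal_mult_less_top)
  finally have fin: "(\<integral>\<^sup>+x. f0 (logr x) * indicator C x \<partial>lborel) < \<infinity>" .
  have "(\<integral>\<^sup>+x. f0 (logr x) * indicator C x \<partial>lborel) = (\<integral>\<^sup>+t. ennreal (cone_const C * exp (- ?d * t)) * f0 t \<partial>lborel)"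
    by (rule polar_nn_integral[OF Cb cone C0]) measurable
  also have "\<dots> = (\<integral>\<^sup>+t. ennreal (cone_const C) * ennreal (indicator {0<..} t * (indicator {0..} t * \<phi> t)\<^sup>2) \<partial>lborel)"
  proof (intro nn_integral_cong)
    fix t
    have "(cone_const C * exp (- ?d * t)) * (indicator {0<..} t * (indicator {0..} t * \<phi> t)\<^sup>2 * exp (?d * t))
       = cone_const C * (indicator {0<..} t * (indicator {0..} t * \<phi> t)\<^sup>2)"
      by (simp add: exp_minus)
    then show "ennreal (cone_const C * exp (- ?d * t)) * f0 t = ennreal (cone_const C) * ennreal (indicator {0<..} t * (indicator {0..} t * \<phi> t)\<^sup>2)"
      unfolding f0_def by (subst (1 2) ennreal_mult[symmetric]) simp_all
  qed
  also have "\<dots> = ennreal (cone_const C) * (\<integral>\<^sup>+t. ennreal (indicator {0<..} t * (indicator {0..} t * \<phi> t)\<^sup>2) \<partial>lborel)"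
    by (rule nn_integral_cmult) measurable
  finally have "(\<integral>\<^sup>+t. ennreal (indicator {0<..} t * (indicator {0..} t * \<phi> t)\<^sup>2) \<partial>lborel) < \<infinity>"
    using fin pos by (auto simp: ennreal_mult_less_top)
  then have "integrable lborel (\<lambda>t. indicator {0<..} t * (indicator {0..} t * \<phi> t)\<^sup>2)"
    by (intro integrableI_bounded) (auto simp: abs_mult)
  moreover have "AE t in lborel. indicator {0<..} t * (indicator {0..} t * \<phi> t)\<^sup>2 = indicator {0..} t *\<^sub>R (\<phi> t)\<^sup>2"
    using AE_lborel_singleton[of "0::real"] by eventually_elim (auto simp: indicator_def)
  moreover have "(\<lambda>t. indicator {0..} t *\<^sub>R (\<phi> t)\<^sup>2) \<in> borel_measurable lborel"
  proof -
    have "(\<lambda>t. (indicator {0..} t * \<phi> t)\<^sup>2) \<in> borel_measurable lborel" by measurable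
    also have "(\<lambda>t. (indicator {0..} t * \<phi> t)\<^sup>2) = (\<lambda>t. indicator {0..} t *\<^sub>R (\<phi> t)\<^sup>2)"
      by (auto simp: fun_eq_iff indicator_def)
    finally show ?thesis .
  qed
  ultimately have "set_integrable lborel {0..} (\<lambda>t. (\<phi> t)\<^sup>2)"
    unfolding set_integrable_def by (subst integrable_cong_AE[symmetric]) auto
  then show ?thesis unfolding \<phi>_def .
qed

text \<open>A spherical harmonic is bounded on the sphere, so its square only costs a constant factor.\<close>

lemma decaying_solution_regular:
  fixes V :: "'a::euclidean_space \<Rightarrow> real" and k :: nat
  assumes d: "2 \<le> DIM('a)" and Qm: "Q \<in> borel_measurable borel"
    and ae: "log_rep (profile V) Q"
  defines "\<mu> \<equiv> (real DIM('a) - 2) / 2"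
  assumes f: "primitive f h" and h: "primitive h (\<lambda>t. ((real k + \<mu>)\<^sup>2 + Q t) * f t)"
    and fb: "\<And>t. 0 \<le> t \<Longrightarrow> \<bar>f t\<bar> \<le> M * exp (- t)" and f0: "f 0 = 1"
  shows "\<exists>u v. regular_solution V k u v \<and> v 1 = - \<mu> - h 0"
proof -
  let ?d = "real DIM('a)"
  define u where "u r = exp (\<mu> * (- ln r)) * f (- ln r)" for r
  obtain v where rs: "radial_solution DIM('a) k (profile V) u v" and v1: "v 1 = - \<mu> * f 0 - h 0"
    using halfline_to_radial_solution[OF d Qm ae f[unfolded \<mu>_def] h[unfolded \<mu>_def]]
    unfolding u_def \<mu>_def by blast
  have [measurable]: "(\<lambda>t. indicator {0..} t * f t) \<in> borel_measurable borel"
    by (rule set_borel_measurable_halfline[OF primitive_continuous[OF f]])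
  have "(\<lambda>x. (u (norm x) * Y (x /\<^sub>R norm x))\<^sup>2 * norm x powi (-2)) absolutely_integrable_on ball 0 1"
    if Y: "spherical_harmonic k Y" for Y :: "'a \<Rightarrow> real"
  proof -
    obtain P where P: "real_polynomial_function P" "\<And>x. x \<in> sphere 0 1 \<Longrightarrow> Y x = P x"
      using Y unfolding spherical_harmonic_def by blast
    have Pc: "continuous_on UNIV P"
      by (intro continuous_at_imp_continuous_on ballI continuous_real_polymonial_function P(1))
    then have [measurable]: "P \<in> borel_measurable borel" by (rule borel_measurable_continuous_onI)
    have "bounded (P ` sphere 0 1)"
      by (intro compact_imp_bounded compact_continuous_image compact_sphere continuous_on_subset[OF Pc]) auto
    then obtain R where R: "\<And>x. x \<in> sphere 0 1 \<Longrightarrow> \<bar>P x\<bar> \<le> R" unfolding bounded_iff real_norm_def by blast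
    define g where "g t = indicator {0<..} t * (indicator {0..} t * f t)\<^sup>2 * exp (?d * t)" for t
    have [measurable]: "g \<in> borel_measurable borel" unfolding g_def by measurable
    have gi: "integrable lborel (\<lambda>t. exp (- ?d * t) * g t)"
    proof -
      have "integrable lborel (\<lambda>t. indicator {0..} t *\<^sub>R (M\<^sup>2 * exp (- 2 * t)))"
        using set_integrable_exp_halfline[of 2 "M\<^sup>2"] by (simp add: set_integrable_def)
      then show ?thesis
      proof (rule Bochner_Integration.integrable_bound)
        show "(\<lambda>t. exp (- ?d * t) * g t) \<in> borel_measurable lborel" by measurable
        have "norm (exp (- ?d * t) * g t) \<le> norm (indicator {0..} t *\<^sub>R (M\<^sup>2 * exp (- 2 * t)))" for t
        proof (cases "0 < t")
          case True
          have "(f t)\<^sup>2 \<le> (M * exp (- t))\<^sup>2" using fb[of t] True by (metis abs_ge_zero less_imp_le power2_abs power_mono)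
          also have "\<dots> = M\<^sup>2 * exp (- 2 * t)" by (simp add: power_mult_distrib power2_eq_square exp_add[symmetric])
          finally have "(f t)\<^sup>2 \<le> M\<^sup>2 * exp (- 2 * t)" .
          moreover have "exp (- ?d * t) * g t = (f t)\<^sup>2" using True by (simp add: g_def exp_minus)
          ultimately show ?thesis using True by simp
        qed (simp add: g_def)
        then show "AE t in lborel. norm (exp (- ?d * t) * g t) \<le> norm (indicator {0..} t *\<^sub>R (M\<^sup>2 * exp (- 2 * t)))" by simp
      qed
    qed
    then have gx: "integrable lborel (\<lambda>x::'a. g (logr x))" by (subst polar_integral(1)) auto
    have eq: "indicator (ball 0 1) x *\<^sub>R ((u (norm x) * Y (x /\<^sub>R norm x))\<^sup>2 * norm x powi (-2))
       = indicator (- {0}) x * (g (logr x) * (P (x /\<^sub>R norm x))\<^sup>2)" for x :: 'a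
    proof (cases "x = 0")
      case False
      have nx: "norm x = exp (- logr x)" using exp_logr[OF False] by simp
      have xb: "x \<in> ball 0 1 \<longleftrightarrow> 0 < logr x" unfolding mem_ball_0 nx by simp
      have YP: "Y (x /\<^sub>R norm x) = P (x /\<^sub>R norm x)" using False by (intro P(2)) simp
      have "(u (norm x))\<^sup>2 * norm x powi (-2) = (f (logr x))\<^sup>2 * exp (?d * logr x)"
      proof -
        have "u (norm x) = exp (\<mu> * logr x) * f (logr x)" by (simp add: u_def logr_def)
        moreover have "(exp (\<mu> * logr x))\<^sup>2 * norm x powi (-2) = exp (?d * logr x)"
          unfolding norm_powi_logr[OF False] power2_eq_square exp_add[symmetric] \<mu>_def by (simp add: field_simps)
        ultimately show ?thesis by (simp add: power_mult_distrib mult_ac)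
      qed
      then have "(u (norm x) * P (x /\<^sub>R norm x))\<^sup>2 * norm x powi (-2) = (f (logr x))\<^sup>2 * exp (?d * logr x) * (P (x /\<^sub>R norm x))\<^sup>2"
        unfolding power_mult_distrib by (metis mult.assoc mult.commute)
      then show ?thesis using False xb unfolding YP by (cases "0 < logr x") (simp_all add: g_def)
    qed simp
    have "integrable lborel (\<lambda>x::'a. indicator (- {0}) x * (g (logr x) * (P (x /\<^sub>R norm x))\<^sup>2))"
    proof (rule Bochner_Integration.integrable_bound[OF integrable_mult_right[OF gx, of "R\<^sup>2"]])
      show "(\<lambda>x::'a. indicator (- {0}) x * (g (logr x) * (P (x /\<^sub>R norm x))\<^sup>2)) \<in> borel_measurable lborel" by measurable
      have "norm (indicator (- {0}) x * (g (logr x) * (P (x /\<^sub>R norm x))\<^sup>2)) \<le> norm (R\<^sup>2 * g (logr x))" for x :: 'a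
      proof (cases "x = 0")
        case False
        have "\<bar>P (x /\<^sub>R norm x)\<bar>\<^sup>2 \<le> R\<^sup>2" using False by (intro power_mono R) auto
        then have "(P (x /\<^sub>R norm x))\<^sup>2 * \<bar>g (logr x)\<bar> \<le> R\<^sup>2 * \<bar>g (logr x)\<bar>" by (intro mult_right_mono) auto
        then show ?thesis using False by (simp add: abs_mult mult_ac)
      qed simp
      then show "AE x::'a in lborel. norm (indicator (- {0}) x * (g (logr x) * (P (x /\<^sub>R norm x))\<^sup>2)) \<le> norm (R\<^sup>2 * g (logr x))"
        by simp
    qed
    then have "integrable lebesgue (\<lambda>x::'a. indicator (- {0}) x * (g (logr x) * (P (x /\<^sub>R norm x))\<^sup>2))"
      by (subst integrable_completion) measurable
    then show ?thesis unfolding set_integrable_def eq .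
  qed
  then have "regular_solution V k u v"
    unfolding regular_solution_def using rs f0 by (simp add: u_def)
  then show ?thesis using v1 f0 by auto
qed

text \<open>The Weyl solution gives a regular solution, and the Wronskian argument shows that all regular
solutions have its derivative at r = 1.\<close>

theorem DN_eigenvalue_response:
  fixes V :: "'a::euclidean_space \<Rightarrow> real" and k :: nat
  assumes d: "2 \<le> DIM('a)"
    and ae: "log_rep (profile V) Q"
    and bk: "bounded_wave_kernel Q B K c"
  defines "\<mu> \<equiv> (real DIM('a) - 2) / 2"
  assumes k: "c + 2 \<le> real k + \<mu>"
  shows "DN_eigenvalue V k - real k = (\<integral>\<sigma>. response Q K \<sigma> * exp (- 2 * (real k + \<mu>) * \<sigma>) \<partial>lborel)"
proof -
  interpret bounded_wave_kernel Q B K c by fact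
  define \<kappa> where "\<kappa> = real k + \<mu>"
  have \<kappa>: "c + 2 \<le> \<kappa>" using k by (simp add: \<kappa>_def)
  let ?f = "weyl K \<kappa>" and ?h = "weyl_deriv \<kappa>"
  obtain M where M: "\<And>t. 0 \<le> t \<Longrightarrow> \<bar>?f t\<bar> \<le> M * exp (- t)" "\<And>t. 0 \<le> t \<Longrightarrow> \<bar>?h t\<bar> \<le> M * exp (- t)"
    using weyl_decay[OF \<kappa>] by blast
  note f = primitive_weyl[OF \<kappa>]
  have "\<exists>u v. regular_solution V k u v \<and> v 1 = - \<mu> - ?h 0"
    unfolding \<mu>_def
    by (rule decaying_solution_regular[OF d Q_measurable ae f(1) _ M(1) weyl_initial(1)[OF \<kappa>]])
       (use f(2) in \<open>auto simp: \<kappa>_def \<mu>_def\<close>)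
  moreover have "v 1 = - \<mu> - ?h 0" if reg: "regular_solution V k u v" for u v
  proof -
    have rs: "radial_solution DIM('a) k (profile V) u v" and u1: "u 1 = 1"
      using reg by (auto simp: regular_solution_def)
    obtain \<psi> where \<psi>: "primitive (\<lambda>t. exp (- \<mu> * t) * u (exp (- t))) \<psi>"
        "primitive \<psi> (\<lambda>t. ((real k + \<mu>)\<^sup>2 + Q t) * (exp (- \<mu> * t) * u (exp (- t))))"
        "\<psi> 0 = - \<mu> * u 1 - v 1"
      using radial_solution_to_halfline[OF d Q_measurable ae rs] unfolding \<mu>_def by blast
    have "set_integrable lborel {0..} (\<lambda>t. (exp (- \<mu> * t) * u (exp (- t)))\<^sup>2)"
      unfolding \<mu>_def by (rule regular_solution_L2[OF d reg primitive_continuous[OF \<psi>(1)[unfolded \<mu>_def]]])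
    then have "\<psi> 0 = ?h 0"
      by (intro decaying_solution_unique[OF f(1) f(2) \<psi>(1) \<psi>(2)[folded \<kappa>_def] M])
         (use u1 weyl_initial(1)[OF \<kappa>] in auto)
    then show ?thesis using \<psi>(3) u1 by simp
  qed
  ultimately have "DN_eigenvalue V k = - \<mu> - ?h 0"
    unfolding DN_eigenvalue_def by (intro the_equality) metis+
  then show ?thesis using weyl_initial(2)[OF \<kappa>] by (simp add: \<kappa>_def)
qed

section \<open>The Born approximation is the response function\<close>

text \<open>Both functions have the same Laplace transform at 2 (k + \<mu>) for all large k. After multiplication by
e^(-2 \<kappa> t) for the first such \<kappa>, these are the moments of an integrable function.\<close>

theorem born_profile_eq_response:
  fixes V W :: "'a::euclidean_space \<Rightarrow> real"
  assumes d: "2 \<le> DIM('a)"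
    and ae: "log_rep (profile V) Q"
    and bk: "bounded_wave_kernel Q B K c" and born: "is_Born_approximation V W"
  shows "log_rep (profile W) (response Q K)"
proof -
  interpret bounded_wave_kernel Q B K c by fact
  let ?d = "real DIM('a)"
  define \<mu> where "\<mu> = (?d - 2) / 2"
  obtain s where rad: "radial W" and s: "0 < s"
    and Ws: "(\<lambda>x. W x * norm x powr (2 * s)) absolutely_integrable_on ball 0 1"
    and ev: "\<forall>\<^sub>F k in sequentially. 1 / sphere_area DIM('a) * (LINT x:ball 0 1|lebesgue. W x * norm x ^ (2 * k))
           = DN_eigenvalue V k - real k"
    using born unfolding is_Born_approximation_def by blast
  have iW: "integrable lebesgue (\<lambda>x. indicator (ball 0 1) x *\<^sub>R (W x * norm x powr (2 * s)))"
    using Ws by (simp add: set_integrable_def)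
  have "(\<lambda>x::'a. norm x powr (- 2 * s)) \<in> borel_measurable lborel" by measurable
  then have "(\<lambda>x::'a. norm x powr (- 2 * s)) \<in> borel_measurable lebesgue" by (rule measurable_completion)
  from borel_measurable_times[OF borel_measurable_integrable[OF iW] this]
  have "(\<lambda>x. (indicator (ball 0 1) x *\<^sub>R (W x * norm x powr (2 * s))) * norm x powr (- 2 * s)) \<in> borel_measurable lebesgue" .
  also have "(\<lambda>x. (indicator (ball 0 1) x *\<^sub>R (W x * norm x powr (2 * s))) * norm x powr (- 2 * s))
     = (\<lambda>x::'a. indicator (ball 0 1 - {0}) x * W x)"
    by (auto simp: fun_eq_iff indicator_def powr_add[symmetric])
  finally obtain q where q[measurable]: "q \<in> borel_measurable borel"
    and aq: "AE t in lborel. 0 < t \<longrightarrow> profile W (exp (- t)) = q t"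
    using radial_borel_log_profile[OF rad] by blast
  define A where "A t = (if 0 < t then exp (- 2 * t) * q t else 0)" for t
  have Am[measurable]: "A \<in> borel_measurable borel" unfolding A_def by measurable
  have A0: "t \<le> 0 \<Longrightarrow> A t = 0" for t by (simp add: A_def)
  have aA: "log_rep (profile W) A"
    using aq by eventually_elim (auto simp: A_def mult.assoc[symmetric] exp_add[symmetric])
  have wA: "AE x in lborel. indicator (ball 0 1) x *\<^sub>R (W x * norm x powr e) = exp (2 * logr x) * A (logr x) * exp (- e * logr x)" for e
    using radial_AE_profile[OF rad aA] AE_lborel_singleton[of "0::'a"]
  proof eventually_elim
    case (elim x)
    have "norm x = exp (- logr x)" using exp_logr[OF elim(2)] by simp
    then have "x \<in> ball 0 1 \<longleftrightarrow> 0 < logr x" and "norm x powr e = exp (- e * logr x)"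
      by (simp_all add: powr_def)
    then show ?case using elim(1) A0[of "logr x"] by (cases "0 < logr x") (auto simp: indicator_def)
  qed
  have expo: "exp (- ?d * t) * (exp (2 * t) * A t * exp (- e * t)) = A t * exp (- (2 * \<mu> + e) * t)" for t e
  proof -
    have "exp (- ?d * t) * exp (2 * t) * exp (- e * t) = exp (- (2 * \<mu> + e) * t)"
      by (simp only: exp_add[symmetric]) (simp add: \<mu>_def field_simps)
    then show ?thesis by (simp only: mult_ac)
  qed
  have iA: "integrable lborel (\<lambda>t. A t * exp (- (2 * \<mu> + 2 * s) * t))"
  proof -
    have "integrable lebesgue (\<lambda>x::'a. exp (2 * logr x) * A (logr x) * exp (- (2 * s) * logr x))"
    proof (rule integrable_cong_AE_imp[OF iW])
      have "(\<lambda>x::'a. exp (2 * logr x) * A (logr x) * exp (- (2 * s) * logr x)) \<in> borel_measurable lborel" by measurable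
      then show "(\<lambda>x::'a. exp (2 * logr x) * A (logr x) * exp (- (2 * s) * logr x)) \<in> borel_measurable lebesgue"
        by (rule measurable_completion)
      show "AE x in lebesgue. indicator (ball 0 1) x *\<^sub>R (W x * norm x powr (2 * s)) = exp (2 * logr x) * A (logr x) * exp (- (2 * s) * logr x)"
        by (rule AE_completion[OF wA[of "2 * s"]])
    qed
    then have "integrable lborel (\<lambda>x::'a. exp (2 * logr x) * A (logr x) * exp (- (2 * s) * logr x))"
      by (subst (asm) integrable_completion) measurable
    then show ?thesis
      by (subst (asm) polar_integral(1)) (measurable, simp only: expo)
  qed
  have iA\<kappa>: "integrable lborel (\<lambda>t. A t * exp (- 2 * \<kappa> * t))" if "\<mu> + s \<le> \<kappa>" for \<kappa>
  proof (rule Bochner_Integration.integrable_bound[OF iA])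
    have "norm (A t * exp (- 2 * \<kappa> * t)) \<le> norm (A t * exp (- (2 * \<mu> + 2 * s) * t))" for t
    proof (cases "0 < t")
      case True
      have "(2 * \<mu> + 2 * s) * t \<le> (2 * \<kappa>) * t" using that True by (intro mult_right_mono) auto
      then have "exp (- 2 * \<kappa> * t) \<le> exp (- (2 * \<mu> + 2 * s) * t)"
        by (simp only: exp_le_cancel_iff mult_minus_left neg_le_iff_le)
      then have "\<bar>A t\<bar> * exp (- 2 * \<kappa> * t) \<le> \<bar>A t\<bar> * exp (- (2 * \<mu> + 2 * s) * t)"
        by (rule mult_left_mono) simp
      then show ?thesis unfolding real_norm_def abs_mult abs_exp_cancel .
    qed (simp add: A0)
    then show "AE t in lborel. norm (A t * exp (- 2 * \<kappa> * t)) \<le> norm (A t * exp (- (2 * \<mu> + 2 * s) * t))" by simp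
  qed measurable
  have moment: "1 / sphere_area DIM('a) * (LINT x:ball 0 1|lebesgue. W x * norm x ^ (2 * k))
      = (\<integral>t. A t * exp (- 2 * (real k + \<mu>) * t) \<partial>lborel)" if "0 < k" for k :: nat
  proof -
    let ?F = "\<lambda>x::'a. exp (2 * logr x) * A (logr x) * exp (- real (2 * k) * logr x)"
    have Fm: "?F \<in> borel_measurable lborel" by measurable
    have ae1: "AE x in lborel. indicator (ball 0 1) x *\<^sub>R (W x * norm x ^ (2 * k)) = ?F x"
      using wA[of "real (2 * k)"] AE_lborel_singleton[of "0::'a"]
    proof eventually_elim
      case (elim x)
      then have "norm x powr real (2 * k) = norm x ^ (2 * k)" by (intro powr_realpow) auto
      then show ?case using elim(1) by simp
    qed
    have "(LINT x:ball 0 1|lebesgue. W x * norm x ^ (2 * k)) = (\<integral>x. ?F x \<partial>lebesgue)"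
      unfolding set_lebesgue_integral_def
    proof (rule integral_cong_AE)
      show Fl: "?F \<in> borel_measurable lebesgue" by (rule measurable_completion[OF Fm])
      have aeL: "AE x in lebesgue. indicator (ball 0 1) x *\<^sub>R (W x * norm x ^ (2 * k)) = ?F x" by (rule AE_completion[OF ae1])
      then show "AE x in lebesgue. indicator (ball 0 1) x *\<^sub>R (W x * norm x ^ (2 * k)) = ?F x" .
      have "(\<lambda>x::'a. norm x ^ (2 * k) * norm x powr (- 2 * s)) \<in> borel_measurable lborel" by measurable
      then have "(\<lambda>x::'a. norm x ^ (2 * k) * norm x powr (- 2 * s)) \<in> borel_measurable lebesgue" by (rule measurable_completion)
      from borel_measurable_times[OF borel_measurable_integrable[OF iW] this]
      have "(\<lambda>x. (indicator (ball 0 1) x *\<^sub>R (W x * norm x powr (2 * s))) * (norm x ^ (2 * k) * norm x powr (- 2 * s))) \<in> borel_measurable lebesgue" .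
      also have "(\<lambda>x. (indicator (ball 0 1) x *\<^sub>R (W x * norm x powr (2 * s))) * (norm x ^ (2 * k) * norm x powr (- 2 * s)))
         = (\<lambda>x::'a. indicator (ball 0 1) x *\<^sub>R (W x * norm x ^ (2 * k)))"
      proof
        fix x :: 'a
        show "(indicator (ball 0 1) x *\<^sub>R (W x * norm x powr (2 * s))) * (norm x ^ (2 * k) * norm x powr (- 2 * s)) = indicator (ball 0 1) x *\<^sub>R (W x * norm x ^ (2 * k))"
        proof (cases "x = 0")
          case False
          then have "norm x powr (2 * s) * norm x powr (- 2 * s) = 1" by (simp add: powr_add[symmetric])
          then show ?thesis by (simp add: mult_ac)
        qed (use that in simp)
      qed
      finally show "(\<lambda>x::'a. indicator (ball 0 1) x *\<^sub>R (W x * norm x ^ (2 * k))) \<in> borel_measurable lebesgue" .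
    qed
    also have "\<dots> = (\<integral>x. ?F x \<partial>lborel)" by (rule integral_completion[OF Fm])
    also have "\<dots> = sphere_area DIM('a) * (\<integral>t. exp (- ?d * t) * (exp (2 * t) * A t * exp (- real (2 * k) * t)) \<partial>lborel)"
      by (rule polar_integral(2)) measurable
    also have "\<dots> = sphere_area DIM('a) * (\<integral>t. A t * exp (- 2 * (real k + \<mu>) * t) \<partial>lborel)"
      unfolding expo by (simp add: algebra_simps)
    finally have "(LINT x:ball 0 1|lebesgue. W x * norm x ^ (2 * k))
        = sphere_area DIM('a) * (\<integral>t. A t * exp (- 2 * (real k + \<mu>) * t) \<partial>lborel)" .
    moreover have "0 < sphere_area DIM('a)" by (simp add: sphere_area_def)
    ultimately show ?thesis by simp
  qed
  obtain k1 where k1: "\<And>k. k1 \<le> k \<Longrightarrow> 1 / sphere_area DIM('a) * (LINT x:ball 0 1|lebesgue. W x * norm x ^ (2 * k))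
           = DN_eigenvalue V k - real k"
    using ev unfolding eventually_sequentially by blast
  obtain k2 :: nat where k2: "c + 2 + \<bar>\<mu>\<bar> + s < real k2" using reals_Archimedean2 by blast
  \<comment> \<open>From k2 on both Laplace transforms converge; the moments of the Born approximation need k > 0,
    for then |x|^(2k) vanishes at the origin.\<close>
  define k0 where "k0 = Suc (max k1 k2)"
  define \<kappa> where "\<kappa> = real k0 + \<mu>"
  have "real k2 \<le> real k0" by (simp add: k0_def)
  then have \<kappa>: "c + 2 \<le> \<kappa>" "\<mu> + s \<le> \<kappa>"
    unfolding \<kappa>_def using k2 c s by (linarith, linarith)
  define h where "h t = A t * exp (- 2 * \<kappa> * t) - response Q K t * exp (- 2 * \<kappa> * t)" for t
  have split: "(\<integral>t. h t * exp (- 2 * real n * t) \<partial>lborel) = 0" for n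
  proof -
    have \<kappa>n: "c + 2 \<le> real (k0 + n) + \<mu>" "\<mu> + s \<le> real (k0 + n) + \<mu>" using \<kappa> by (auto simp: \<kappa>_def)
    have e: "exp (- 2 * \<kappa> * t) * exp (- 2 * real n * t) = exp (- 2 * (real (k0 + n) + \<mu>) * t)" for t
      by (simp only: exp_add[symmetric]) (simp add: \<kappa>_def algebra_simps)
    have "h t * exp (- 2 * real n * t) = A t * exp (- 2 * (real (k0 + n) + \<mu>) * t) - response Q K t * exp (- 2 * (real (k0 + n) + \<mu>) * t)" for t
      unfolding h_def e[symmetric] by (simp only: left_diff_distrib mult.assoc)
    then have "(\<integral>t. h t * exp (- 2 * real n * t) \<partial>lborel)
      = (\<integral>t. A t * exp (- 2 * (real (k0 + n) + \<mu>) * t) \<partial>lborel) - (\<integral>t. response Q K t * exp (- 2 * (real (k0 + n) + \<mu>) * t) \<partial>lborel)"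
      using iA\<kappa>[OF \<kappa>n(2)] response_laplace(1)[OF \<kappa>n(1)] by (simp only: Bochner_Integration.integral_diff)
    also have "\<dots> = 0"
      using DN_eigenvalue_response[OF d ae bk, of "k0 + n"] \<kappa>n(1) moment[of "k0 + n"] k1[of "k0 + n"]
      by (simp add: \<mu>_def k0_def)
    finally show ?thesis .
  qed
  have r0: "response Q K t = 0" if "t < 0" for t
  proof -
    have "K x (2 * t - x) = 0" for x using K_support[of x "2 * t - x"] that by fastforce
    then show ?thesis using that by (simp add: response_def Q_neg)
  qed
  have "AE t in lborel. h t = 0"
  proof (rule laplace_moments_unique[OF _ _ split])
    show "integrable lborel h"
      unfolding h_def by (intro Bochner_Integration.integrable_diff iA\<kappa> response_laplace(1) \<kappa>)
    show "h t = 0" if "t < 0" for t using that by (simp add: h_def A0 r0)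
  qed
  then show ?thesis
    using aA by eventually_elim (auto simp: h_def)
qed

section \<open>Norms on the shell and the stability estimate\<close>

lemma Lp_norm_1: "Lp_norm 1 S f = (\<integral>\<^sup>+x. ennreal \<bar>f x\<bar> \<partial>lebesgue_on S)"
proof -
  have "(\<integral>\<^sup>+x. ennreal (\<bar>f x\<bar> powr 1) \<partial>lebesgue_on S) = (\<integral>\<^sup>+x. ennreal \<bar>f x\<bar> \<partial>lebesgue_on S)"
    by (intro nn_integral_cong) simp
  then show ?thesis unfolding Lp_norm_def by (simp add: Let_def less_top)
qed

lemma emeasure_shell_le: "emeasure (lebesgue_on (shell r1 1 :: 'a::euclidean_space set)) (space (lebesgue_on (shell r1 1))) \<le> ennreal (unit_ball_vol DIM('a))"
proof -
  have "emeasure (lebesgue_on (shell r1 1 :: 'a set)) (space (lebesgue_on (shell r1 1))) = emeasure lebesgue (shell r1 1 :: 'a set)"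
    by (simp add: emeasure_restrict_space)
  also have "\<dots> = emeasure lborel (shell r1 1 :: 'a set)" by (simp add: main_part_sets)
  also have "\<dots> \<le> emeasure lborel (ball (0::'a) 1)" by (intro emeasure_mono) (auto simp: shell_def)
  also have "\<dots> = ennreal (unit_ball_vol DIM('a))" by (simp add: emeasure_ball)
  finally show ?thesis .
qed

text \<open>For finite p this is |V| \<le> 1 + |V|^p integrated over the shell.\<close>

lemma L1_bound_from_Lp:
  fixes V :: "'a::euclidean_space \<Rightarrow> real"
  assumes p: "1 < p" and b: "0 < b" and g[measurable]: "g \<in> borel_measurable borel"
    and ae: "AE x in lborel. x \<in> ball 0 1 \<longrightarrow> V x = g (logr x)"
    and Lp: "Lp_norm p (shell b 1) V \<le> ennreal N" and N: "0 \<le> N"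
  shows "(\<integral>\<^sup>+x. ennreal \<bar>V x\<bar> \<partial>lebesgue_on (shell b 1))
     \<le> ennreal ((N + 1) * unit_ball_vol DIM('a) + N powr enn2real p)"
proof -
  let ?M = "lebesgue_on (shell b 1) :: 'a measure"
  have vol: "(\<integral>\<^sup>+x. ennreal r \<partial>?M) \<le> ennreal (r * unit_ball_vol DIM('a))" if "0 \<le> r" for r
  proof -
    have "(\<integral>\<^sup>+x. ennreal r \<partial>?M) = ennreal r * emeasure ?M (space ?M)" by simp
    also have "\<dots> \<le> ennreal r * ennreal (unit_ball_vol DIM('a))" by (intro mult_left_mono emeasure_shell_le) auto
    finally show ?thesis using that by (simp add: ennreal_mult'[symmetric])
  qed
  show ?thesis
  proof (cases "p = \<infinity>")
    case True
    then have es: "esssup ?M (\<lambda>x. ennreal \<bar>V x\<bar>) \<le> ennreal N" using Lp by (simp add: Lp_norm_def)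
    have "AE x in ?M. ennreal \<bar>V x\<bar> \<le> ennreal N"
      using esssup_AE[of "\<lambda>x. ennreal \<bar>V x\<bar>" ?M] by eventually_elim (use es in order)
    then have "(\<integral>\<^sup>+x. ennreal \<bar>V x\<bar> \<partial>?M) \<le> (\<integral>\<^sup>+x. ennreal N \<partial>?M)" by (rule nn_integral_mono_AE)
    also have "\<dots> \<le> ennreal (N * unit_ball_vol DIM('a))" by (rule vol[OF N])
    also have "\<dots> \<le> ennreal ((N + 1) * unit_ball_vol DIM('a) + N powr enn2real p)"
      using N by (intro ennreal_leI) (simp add: ring_distribs)
    finally show ?thesis .
  next
    case False
    define P where "P = enn2real p"
    have P: "1 < P" unfolding P_def using p False
      by (metis enn2real_1 enn2real_less_iff ennreal_1 ennreal_enn2real infinity_ennreal_def less_top ennreal_less_iff zero_le_one)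
    let ?I = "\<integral>\<^sup>+x. ennreal (\<bar>V x\<bar> powr P) \<partial>?M"
    have If: "?I \<noteq> \<infinity>" using Lp False by (auto simp: Lp_norm_def P_def Let_def top_unique)
    then obtain i where i: "?I = ennreal i" "0 \<le> i" by (cases ?I) auto
    have "ennreal (i powr (1 / P)) \<le> ennreal N"
      using Lp False If i by (simp add: Lp_norm_def P_def Let_def)
    then have iN: "i powr (1 / P) \<le> N" using N by (simp add: ennreal_le_iff)
    have "i = (i powr (1 / P)) powr P" using P i by (simp add: powr_powr)
    also have "\<dots> \<le> N powr P" using iN P by (intro powr_mono2) auto
    finally have iNP: "i \<le> N powr P" .
    let ?w = "\<lambda>t. ennreal (sphere_area DIM('a) * exp (- real DIM('a) * t))"
    let ?i = "\<lambda>t. indicator {- ln 1<..<- ln b} t :: ennreal"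
    have pt: "\<bar>y\<bar> \<le> 1 + \<bar>y\<bar> powr P" for y :: real
    proof (cases "\<bar>y\<bar> \<le> 1")
      case False
      then have "\<bar>y\<bar> powr 1 \<le> \<bar>y\<bar> powr P" using P by (intro powr_mono) auto
      then show ?thesis using False by simp
    qed (simp add: add_increasing2)
    have c1: "(\<integral>\<^sup>+x. ennreal \<bar>V x\<bar> \<partial>?M) = (\<integral>\<^sup>+t. ?w t * (ennreal \<bar>g t\<bar> * ?i t) \<partial>lborel)"
      by (rule nn_integral_shell) (use ae b in \<open>auto elim!: eventually_mono\<close>)
    have c2: "?I = (\<integral>\<^sup>+t. ?w t * (ennreal (\<bar>g t\<bar> powr P) * ?i t) \<partial>lborel)"
      by (rule nn_integral_shell) (use ae b in \<open>auto elim!: eventually_mono\<close>)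
    have c3: "(\<integral>\<^sup>+x. ennreal 1 \<partial>?M) = (\<integral>\<^sup>+t. ?w t * (ennreal 1 * ?i t) \<partial>lborel)"
      by (rule nn_integral_shell) (use b in auto)
    have "(\<integral>\<^sup>+t. ?w t * (ennreal \<bar>g t\<bar> * ?i t) \<partial>lborel)
      \<le> (\<integral>\<^sup>+t. ?w t * (ennreal 1 * ?i t) + ?w t * (ennreal (\<bar>g t\<bar> powr P) * ?i t) \<partial>lborel)"
    proof (intro nn_integral_mono)
      fix t
      have "ennreal \<bar>g t\<bar> \<le> ennreal 1 + ennreal (\<bar>g t\<bar> powr P)"
        using pt[of "g t"] by (subst ennreal_plus[symmetric]) (auto intro!: ennreal_leI simp del: ennreal_plus)
      then have "?w t * (ennreal \<bar>g t\<bar> * ?i t) \<le> ?w t * ((ennreal 1 + ennreal (\<bar>g t\<bar> powr P)) * ?i t)"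
        by (intro mult_left_mono mult_right_mono) auto
      then show "?w t * (ennreal \<bar>g t\<bar> * ?i t) \<le> ?w t * (ennreal 1 * ?i t) + ?w t * (ennreal (\<bar>g t\<bar> powr P) * ?i t)"
        by (simp only: distrib_left distrib_right)
    qed
    also have "\<dots> = (\<integral>\<^sup>+x. ennreal 1 \<partial>?M) + ?I"
      unfolding c2 c3 by (intro nn_integral_add) auto
    also have "\<dots> \<le> ennreal (1 * unit_ball_vol DIM('a)) + ennreal (N powr P)"
      unfolding i(1) by (intro add_mono vol ennreal_leI iNP) auto
    also have "\<dots> = ennreal (unit_ball_vol DIM('a) + N powr P)" by (simp add: ennreal_plus)
    also have "\<dots> \<le> ennreal ((N + 1) * unit_ball_vol DIM('a) + N powr P)"
      using N by (intro ennreal_leI) (simp add: ring_distribs)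
    finally show ?thesis unfolding c1 P_def .
  qed
qed

lemma powr_le_self_exponent:
  assumes "0 \<le> (x::real)" "x \<le> 1" "0 < \<theta>" "\<theta> \<le> 1"
  shows "x \<le> x powr \<theta>"
proof (cases "x = 0")
  case False
  then have "x powr 1 \<le> x powr \<theta>" using assms by (intro powr_mono') auto
  then show ?thesis using assms by simp
qed simp

lemma hoelder_exponent_bounds:
  fixes p :: ennreal
  assumes "1 < p"
  shows "0 < (if p = \<infinity> then 1 / 2 else enn2real p / (2 * enn2real p - 1))"
    "(if p = \<infinity> then 1 / 2 else enn2real p / (2 * enn2real p - 1)) \<le> 1"
proof -
  have P: "1 < enn2real p" if "p \<noteq> \<infinity>"
  proof -
    obtain r where r: "p = ennreal r" "0 \<le> r" using \<open>p \<noteq> \<infinity>\<close> by (cases p) auto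
    then have "ennreal 1 < ennreal r" using assms by simp
    then have "1 < r" using r by (subst (asm) ennreal_less_iff) auto
    then show ?thesis using r by simp
  qed
  show "0 < (if p = \<infinity> then 1 / 2 else enn2real p / (2 * enn2real p - 1))"
    "(if p = \<infinity> then 1 / 2 else enn2real p / (2 * enn2real p - 1)) \<le> 1"
    using P by (auto simp: divide_le_eq)
qed

text \<open>A bound for the L^1 norm of Q on (0, - ln b) when the L^p norm of V on the shell is at most N.\<close>

definition local_L1_bound :: "nat \<Rightarrow> ennreal \<Rightarrow> real \<Rightarrow> real \<Rightarrow> real" where
  "local_L1_bound d p b N =
     ((N + 1) * unit_ball_vol (real d) + N powr enn2real p) * exp (real d * (- ln b)) / sphere_area d"

definition lipschitz_const :: "nat \<Rightarrow> ennreal \<Rightarrow> real \<Rightarrow> real \<Rightarrow> real" where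
  "lipschitz_const d p b N =
     (let A = local_L1_bound d p b N; a = - ln b
      in 2 * exp (2 * (6 * A * exp ((A + 1) * (2 * a)) + 1) * a) * exp (real d * a))"

text \<open>On 0 < t < - ln b the density e^(-(d-2) t) of the radial integral lies between e^(d ln b) and 1.\<close>

lemma shell_L1_log:
  fixes F :: "'a::euclidean_space \<Rightarrow> real"
  assumes G[measurable]: "G \<in> borel_measurable borel" and b: "0 < b" "b < 1" and d: "2 \<le> DIM('a)"
    and ae: "AE x in lborel. x \<in> ball 0 1 \<longrightarrow> F x = exp (2 * logr x) * G (logr x)"
  shows "(\<integral>\<^sup>+x. ennreal \<bar>F x\<bar> \<partial>lebesgue_on (shell b 1))
      \<le> ennreal (sphere_area DIM('a)) * L1_upto (- ln b) G"
    and "ennreal (sphere_area DIM('a) * exp (- (real DIM('a) * (- ln b)))) * L1_upto (- ln b) G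
      \<le> (\<integral>\<^sup>+x. ennreal \<bar>F x\<bar> \<partial>lebesgue_on (shell b 1))"
proof -
  let ?d = "real DIM('a)" and ?S = "sphere_area DIM('a)" and ?a = "- ln b"
  have S: "0 \<le> ?S" by (simp add: sphere_area_def)
  have a: "0 < ?a" using b by simp
  have "AE x in lborel. x \<in> ball 0 1 \<longrightarrow> ennreal \<bar>F x\<bar> = ennreal (exp (2 * logr x) * \<bar>G (logr x)\<bar>)"
    using ae by eventually_elim (auto simp: abs_mult)
  from nn_integral_shell[OF _ this b(1)]
  have e: "(\<integral>\<^sup>+x. ennreal \<bar>F x\<bar> \<partial>lebesgue_on (shell b 1))
    = (\<integral>\<^sup>+t. ennreal (?S * exp (- ?d * t)) * (ennreal (exp (2 * t) * \<bar>G t\<bar>) * indicator {0<..<?a} t) \<partial>lborel)"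
    by simp
  also have "\<dots> = (\<integral>\<^sup>+t. ennreal (?S * exp (- (?d - 2) * t)) * (ennreal \<bar>G t\<bar> * indicator {0..?a} t) \<partial>lborel)"
  proof (rule nn_integral_cong_AE)
    show "AE t in lborel. ennreal (?S * exp (- ?d * t)) * (ennreal (exp (2 * t) * \<bar>G t\<bar>) * indicator {0<..<?a} t)
       = ennreal (?S * exp (- (?d - 2) * t)) * (ennreal \<bar>G t\<bar> * indicator {0..?a} t)"
      using AE_lborel_singleton[of 0] AE_lborel_singleton[of ?a]
    proof eventually_elim
      case (elim t)
      have "?S * exp (- ?d * t) * (exp (2 * t) * \<bar>G t\<bar>) = ?S * exp (- (?d - 2) * t) * \<bar>G t\<bar>"
        by (simp add: mult.assoc[symmetric]) (simp add: mult.assoc exp_add[symmetric] algebra_simps)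
      then have "ennreal (?S * exp (- ?d * t)) * ennreal (exp (2 * t) * \<bar>G t\<bar>) = ennreal (?S * exp (- (?d - 2) * t)) * ennreal \<bar>G t\<bar>"
        using S by (simp only: ennreal_mult[symmetric] mult_nonneg_nonneg exp_ge_zero abs_ge_zero)
      moreover have "indicator {0<..<?a} t = (indicator {0..?a} t :: ennreal)" using elim by (auto simp: indicator_def)
      ultimately show ?case by (simp only: mult.assoc[symmetric])
    qed
  qed
  finally have e: "(\<integral>\<^sup>+x. ennreal \<bar>F x\<bar> \<partial>lebesgue_on (shell b 1))
    = (\<integral>\<^sup>+t. ennreal (?S * exp (- (?d - 2) * t)) * (ennreal \<bar>G t\<bar> * indicator {0..?a} t) \<partial>lborel)" .
  have up: "ennreal (?S * exp (- (?d - 2) * t)) \<le> ennreal ?S" if "0 \<le> t" for t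
    using that d S by (intro ennreal_leI mult_left_le) (auto intro: mult_nonpos_nonneg)
  have lo: "ennreal (?S * exp (- (?d * ?a))) \<le> ennreal (?S * exp (- (?d - 2) * t))" if "0 \<le> t" "t \<le> ?a" for t
  proof -
    have "(?d - 2) * t \<le> ?d * ?a" using that d by (intro mult_mono) auto
    then have "exp (- (?d * ?a)) \<le> exp (- (?d - 2) * t)" by (simp only: exp_le_cancel_iff mult_minus_left neg_le_iff_le)
    then show ?thesis using S by (intro ennreal_leI mult_left_mono)
  qed
  show "(\<integral>\<^sup>+x. ennreal \<bar>F x\<bar> \<partial>lebesgue_on (shell b 1))
      \<le> ennreal ?S * L1_upto ?a G"
  proof -
    have "(\<integral>\<^sup>+t. ennreal (?S * exp (- (?d - 2) * t)) * (ennreal \<bar>G t\<bar> * indicator {0..?a} t) \<partial>lborel)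
       \<le> (\<integral>\<^sup>+t. ennreal ?S * (ennreal \<bar>G t\<bar> * indicator {0..?a} t) \<partial>lborel)"
    proof (intro nn_integral_mono)
      fix t
      show "ennreal (?S * exp (- (?d - 2) * t)) * (ennreal \<bar>G t\<bar> * indicator {0..?a} t) \<le> ennreal ?S * (ennreal \<bar>G t\<bar> * indicator {0..?a} t)"
        using up[of t] by (cases "t \<in> {0..?a}") (auto intro: mult_right_mono)
    qed
    also have "\<dots> = ennreal ?S * L1_upto ?a G"
      by (rule nn_integral_cmult) measurable
    finally show ?thesis unfolding e .
  qed
  show "ennreal (?S * exp (- (?d * ?a))) * L1_upto ?a G
      \<le> (\<integral>\<^sup>+x. ennreal \<bar>F x\<bar> \<partial>lebesgue_on (shell b 1))"
  proof -
    have "ennreal (?S * exp (- (?d * ?a))) * L1_upto ?a G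
       = (\<integral>\<^sup>+t. ennreal (?S * exp (- (?d * ?a))) * (ennreal \<bar>G t\<bar> * indicator {0..?a} t) \<partial>lborel)"
      by (rule nn_integral_cmult[symmetric]) measurable
    also have "\<dots> \<le> (\<integral>\<^sup>+t. ennreal (?S * exp (- (?d - 2) * t)) * (ennreal \<bar>G t\<bar> * indicator {0..?a} t) \<partial>lborel)"
    proof (intro nn_integral_mono)
      fix t
      show "ennreal (?S * exp (- (?d * ?a))) * (ennreal \<bar>G t\<bar> * indicator {0..?a} t) \<le> ennreal (?S * exp (- (?d - 2) * t)) * (ennreal \<bar>G t\<bar> * indicator {0..?a} t)"
        using lo[of t] by (cases "t \<in> {0..?a}") (auto intro: mult_right_mono)
    qed
    finally show ?thesis unfolding e .
  qed
qed

lemma ennreal_cancel_le: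
  assumes "ennreal r * X \<le> Y" "0 < r" shows "X \<le> ennreal (1 / r) * Y"
proof -
  have "X = ennreal (1 / r) * (ennreal r * X)"
    using assms(2) by (simp add: mult.assoc[symmetric] ennreal_mult'[symmetric])
  also have "\<dots> \<le> ennreal (1 / r) * Y" by (intro mult_left_mono assms(1)) auto
  finally show ?thesis .
qed

theorem born_lipschitz:
  fixes V1 V2 W1 W2 :: "'a::euclidean_space \<Rightarrow> real"
  assumes d: "2 \<le> DIM('a)" and p: "1 < p" and b: "0 < b" "b < 1" and N: "0 \<le> N"
    and V1: "V1 \<in> V_space" and V2: "V2 \<in> V_space"
    and W1: "is_Born_approximation V1 W1" and W2: "is_Born_approximation V2 W2"
    and Lp1: "Lp_norm p (shell b 1) V1 \<le> ennreal N" and Lp2: "Lp_norm p (shell b 1) V2 \<le> ennreal N"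
  shows "Lp_norm 1 (shell b 1) (\<lambda>x. V1 x - V2 x)
     \<le> ennreal (lipschitz_const DIM('a) p b N) * Lp_norm 1 (shell b 1) (\<lambda>x. W1 x - W2 x)"
proof -
  let ?d = "real DIM('a)" and ?S = "sphere_area DIM('a)"
  define a where "a = - ln b"
  define A where "A = local_L1_bound DIM('a) p b N"
  define M where "M = 2 * exp (2 * (6 * A * exp ((A + 1) * (2 * a)) + 1) * a)"
  have S: "0 < ?S" by (simp add: sphere_area_def)
  have A0: "0 \<le> A" using N S by (auto simp: A_def local_L1_bound_def intro!: divide_nonneg_pos mult_nonneg_nonneg add_nonneg_nonneg)
  have ex: "\<exists>Q B K c. bounded_wave_kernel Q B K c \<and> log_rep (profile V) Q
     \<and> log_rep (profile W) (response Q K)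
     \<and> L1_upto a Q \<le> ennreal A"
    if V: "V \<in> V_space" and W: "is_Born_approximation V W" and Lp: "Lp_norm p (shell b 1) V \<le> ennreal N"
    for V W :: "'a \<Rightarrow> real"
  proof -
    obtain Q B where Q: "unif_loc Q B" and ae: "log_rep (profile V) Q"
      using V_space_log_potential[OF V] by blast
    obtain K where K: "wave_kernel Q K" "\<And>t s. \<bar>K t s\<bar> \<le> B * exp (max 1 B * s)"
      using wave_kernel_exists[OF Q, of "max 1 B"] by auto
    have bk: "bounded_wave_kernel Q B K (max 1 B)" by unfold_locales (use Q K in auto)
    have Qm[measurable]: "Q \<in> borel_measurable borel" using Q by (simp add: unif_loc_def)
    have rad: "radial V" using V by (simp add: V_space_def)
    note aeV = radial_AE_profile[OF rad ae]
    have "ennreal (?S * exp (- (?d * a))) * L1_upto a Q \<le> (\<integral>\<^sup>+x. ennreal \<bar>V x\<bar> \<partial>lebesgue_on (shell b 1))"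
      unfolding a_def by (rule shell_L1_log(2)[OF Qm b d aeV])
    also have "\<dots> \<le> ennreal ((N + 1) * unit_ball_vol DIM('a) + N powr enn2real p)"
      by (rule L1_bound_from_Lp[OF p b(1) _ aeV Lp N]) measurable
    finally have "L1_upto a Q
       \<le> ennreal (1 / (?S * exp (- (?d * a)))) * ennreal ((N + 1) * unit_ball_vol DIM('a) + N powr enn2real p)"
      using S by (intro ennreal_cancel_le) auto
    also have "\<dots> = ennreal A"
    proof -
      have "1 / (?S * exp (- (?d * a))) * ((N + 1) * unit_ball_vol DIM('a) + N powr enn2real p) = A"
        by (simp add: A_def local_L1_bound_def a_def exp_minus field_simps)
      then show ?thesis using S by (simp only: ennreal_mult'[symmetric] zero_le_divide_1_iff mult_nonneg_nonneg less_imp_le exp_ge_zero)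
    qed
    finally show ?thesis using bk ae born_profile_eq_response[OF d ae bk W] by blast
  qed
  obtain Q1 B1 K1 c1 where k1: "bounded_wave_kernel Q1 B1 K1 c1"
    and v1: "log_rep (profile V1) Q1"
    and w1: "log_rep (profile W1) (response Q1 K1)"
    and A1: "L1_upto a Q1 \<le> ennreal A"
    using ex[OF V1 W1 Lp1] by blast
  obtain Q2 B2 K2 c2 where k2: "bounded_wave_kernel Q2 B2 K2 c2"
    and v2: "log_rep (profile V2) Q2"
    and w2: "log_rep (profile W2) (response Q2 K2)"
    and A2: "L1_upto a Q2 \<le> ennreal A"
    using ex[OF V2 W2 Lp2] by blast
  interpret k1: bounded_wave_kernel Q1 B1 K1 c1 by fact
  interpret k2: bounded_wave_kernel Q2 B2 K2 c2 by fact
  have [measurable]: "response Q1 K1 \<in> borel_measurable borel" "response Q2 K2 \<in> borel_measurable borel"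
    unfolding response_def by measurable
  have rad: "radial V1" "radial V2" "radial W1" "radial W2"
    using V1 V2 W1 W2 by (auto simp: V_space_def is_Born_approximation_def)
  have dV: "AE x in lborel. x \<in> ball 0 1 \<longrightarrow> V1 x - V2 x = exp (2 * logr x) * (\<lambda>t. Q1 t - Q2 t) (logr x)"
    using radial_AE_profile[OF rad(1) v1] radial_AE_profile[OF rad(2) v2] by eventually_elim (auto simp: algebra_simps)
  have dW: "AE x in lborel. x \<in> ball 0 1 \<longrightarrow> W1 x - W2 x = exp (2 * logr x) * (\<lambda>t. response Q1 K1 t - response Q2 K2 t) (logr x)"
    using radial_AE_profile[OF rad(3) w1] radial_AE_profile[OF rad(4) w2] by eventually_elim (auto simp: algebra_simps)
  let ?IW = "\<integral>\<^sup>+x. ennreal \<bar>W1 x - W2 x\<bar> \<partial>lebesgue_on (shell b 1)"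
  let ?R = "\<integral>\<^sup>+t. ennreal \<bar>response Q1 K1 t - response Q2 K2 t\<bar> * indicator {0..a} t \<partial>lborel"
  have "ennreal (?S * exp (- (?d * a))) * ?R \<le> ?IW"
    unfolding a_def by (rule shell_L1_log(2)[OF _ b d dW]) measurable
  then have R: "?R \<le> ennreal (1 / (?S * exp (- (?d * a)))) * ?IW"
    using S by (intro ennreal_cancel_le) auto
  have "(\<integral>\<^sup>+x. ennreal \<bar>V1 x - V2 x\<bar> \<partial>lebesgue_on (shell b 1))
      \<le> ennreal ?S * L1_upto a (\<lambda>t. Q1 t - Q2 t)"
    unfolding a_def by (rule shell_L1_log(1)[OF _ b d dV]) measurable
  also have "\<dots> \<le> ennreal ?S * (ennreal M * ?R)"
    unfolding M_def by (intro mult_left_mono halfline_stability[OF k1 k2 A1 A2 A0]) auto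
  also have "\<dots> \<le> ennreal ?S * (ennreal M * (ennreal (1 / (?S * exp (- (?d * a)))) * ?IW))"
    by (intro mult_left_mono R) auto
  also have "\<dots> = (ennreal ?S * ennreal M * ennreal (1 / (?S * exp (- (?d * a))))) * ?IW"
    by (simp only: mult.assoc)
  also have "ennreal ?S * ennreal M * ennreal (1 / (?S * exp (- (?d * a)))) = ennreal (?S * M * (1 / (?S * exp (- (?d * a)))))"
    using S by (simp add: ennreal_mult'[symmetric] M_def)
  also have "?S * M * (1 / (?S * exp (- (?d * a)))) = lipschitz_const DIM('a) p b N"
  proof -
    have "?S * M * (1 / (?S * exp (- (?d * a)))) = M * exp (?d * a)"
      using S by (simp add: exp_minus divide_inverse)
    then show ?thesis unfolding lipschitz_const_def Let_def M_def A_def a_def .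
  qed
  finally show ?thesis unfolding Lp_norm_1 .
qed

theorem theorem3:
  fixes p :: ennreal and b :: real
  assumes "CARD('d::finite) \<ge> 2" and "1 < p" and "0 < b" and "b < 1"
  shows "\<exists>\<delta>::real. 0 < \<delta> \<and> \<delta> < 1 \<and>
    (\<forall>N::real. N > (if p = \<infinity> then 1 else sphere_area CARD('d) powr (1 / enn2real p)) \<longrightarrow>
      (\<exists>C::real. C > 0 \<and>
        (\<forall>V\<^sub>1 \<in> V_space. \<forall>V\<^sub>2 \<in> V_space. \<forall>W\<^sub>1 W\<^sub>2 :: real ^ 'd \<Rightarrow> real.
          is_Born_approximation V\<^sub>1 W\<^sub>1 \<longrightarrow> is_Born_approximation V\<^sub>2 W\<^sub>2 \<longrightarrow>
          max (Lp_norm p (shell b 1) V\<^sub>1) (Lp_norm p (shell b 1) V\<^sub>2) \<le> ennreal N \<longrightarrow>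
          Lp_norm 1 (shell b 1) (\<lambda>x. W\<^sub>1 x - W\<^sub>2 x) < ennreal \<delta> \<longrightarrow>
          Lp_norm 1 (shell b 1) (\<lambda>x. V\<^sub>1 x - V\<^sub>2 x)
            \<le> ennreal (C * enn2real (Lp_norm 1 (shell b 1) (\<lambda>x. W\<^sub>1 x - W\<^sub>2 x)) powr
                 (if p = \<infinity> then 1 / 2 else enn2real p / (2 * enn2real p - 1))))))"
proof -
  let ?\<theta> = "if p = \<infinity> then 1 / 2 else enn2real p / (2 * enn2real p - 1)"
  have d: "2 \<le> DIM(real ^ 'd)" using assms(1) by simp
  have main: "Lp_norm 1 (shell b 1) (\<lambda>x. V1 x - V2 x)
      \<le> ennreal (lipschitz_const DIM(real ^ 'd) p b N * enn2real (Lp_norm 1 (shell b 1) (\<lambda>x. W1 x - W2 x)) powr ?\<theta>)"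
    if N: "N > (if p = \<infinity> then 1 else sphere_area CARD('d) powr (1 / enn2real p))"
      and V: "V1 \<in> V_space" "V2 \<in> V_space" and W: "is_Born_approximation V1 W1" "is_Born_approximation V2 W2"
      and Lp: "max (Lp_norm p (shell b 1) V1) (Lp_norm p (shell b 1) V2) \<le> ennreal N"
      and small: "Lp_norm 1 (shell b 1) (\<lambda>x. W1 x - W2 x) < ennreal (1/2)"
    for N and V1 V2 W1 W2 :: "real ^ 'd \<Rightarrow> real"
  proof -
    let ?I = "Lp_norm 1 (shell b 1) (\<lambda>x. W1 x - W2 x)"
    have "(0::real) \<le> (if p = \<infinity> then 1 else sphere_area CARD('d) powr (1 / enn2real p))" by simp
    then have N0: "0 \<le> N" using N by linarith
    obtain i where i: "?I = ennreal i" "0 \<le> i" using small by (cases ?I) auto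
    have "i < 1/2" using small i by (simp only: ennreal_less_iff)
    then have i1: "i < 1" by simp
    have L: "0 \<le> lipschitz_const DIM(real ^ 'd) p b N" by (simp add: lipschitz_const_def Let_def)
    have "Lp_norm 1 (shell b 1) (\<lambda>x. V1 x - V2 x) \<le> ennreal (lipschitz_const DIM(real ^ 'd) p b N) * ?I"
      using Lp by (intro born_lipschitz[OF d assms(2-4) N0 V W]) auto
    also have "\<dots> = ennreal (lipschitz_const DIM(real ^ 'd) p b N * i)"
      using L i by (simp add: ennreal_mult)
    also have "\<dots> \<le> ennreal (lipschitz_const DIM(real ^ 'd) p b N * i powr ?\<theta>)"
      using L i i1 hoelder_exponent_bounds[OF assms(2)] by (intro ennreal_leI mult_left_mono powr_le_self_exponent) auto
    finally show ?thesis using i by simp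
  qed
  have pos: "0 < lipschitz_const DIM(real ^ 'd) p b N" for N by (simp add: lipschitz_const_def Let_def)
  \<comment> \<open>The choice of \<delta> keeps the distance below 1, where it is at most its power.\<close>
  show ?thesis
    by (intro exI[of _ "1/2"] conjI allI impI exI[of _ "lipschitz_const DIM(real ^ 'd) p b _"] ballI pos main) auto
qed

end
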